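(* Let $u\in L^p(X,\nu)$ for some $p>1$. Then $u\in BV(X,\nu)$ if and only if $V(u)<+\infty$. In this case the measure $m$ from the definition of $BV(X,\nu)$ satisfies $|m|(X)=V(u)$.
   Context: $X$ is a separable real Hilbert space with inner product $\langle\cdot,\cdot\rangle$ and norm $\|\cdot\|$, $\nu$ is a Borel probability measure on $X$, and $R\in\mathcal L(X)$. $C^1_b(X)$ is the space of bounded, continuously Fréchet differentiable $\varphi:X\to\mathbb R$ with bounded gradient. Standing assumption: for every $z\in X$ there exists $v_z\in\bigcap_{p>1}L^p(X,\nu)$ with $\int_X\langle R\nabla\varphi,z\rangle\,d\nu=\int_X v_z\varphi\,d\nu$ for all $\varphi\in C^1_b(X)$. (In particular $uv_z\in L^1(X,\nu)$ for all $z$ when $u\in L^p$, $p>1$.) $\widetilde C^1_b(X,X)$ is the set of vector fields $F=\sum_{i=1}^n f_iz_i$ with $n\in\mathbb N$, $f_i\in C^1_b(X)$, $z_i\in X$; for such $F$ set $M^*F:=\sum_{i=1}^n\big(-\langle R\nabla f_i,z_i\rangle+v_{z_i}f_i\big)$. For $u\in L^1(X,\nu)$ with $uv_z\in L^1(X,\nu)$ for all $z\in X$, $V(u):=\sup\{\int_X u\,M^*F\,d\nu:\ F\in\widetilde C^1_b(X,X),\ \|F(x)\|\le1\ \forall x\in X\}$. $\mathcal M(X,X)$ denotes the countably additive $X$-valued Borel measures $m$ on $X$ with finite total variation $|m|(X)=\sup\sum_n\|m(B_n)\|$ (supremum over countable Borel partitions of $X$). Such a $u$ belongs to $BV(X,\nu)$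 if there is $m\in\mathcal M(X,X)$ such that, with $m_z(B):=\langle m(B),z\rangle$, one has $\int_X u(\langle R\nabla\varphi,z\rangle-v_z\varphi)\,d\nu=-\int_X\varphi\,dm_z$ for all $z\in X$ and $\varphi\in C^1_b(X)$. *)

theory Defs
  imports "HOL-Probability.Probability"
begin

definition grad :: "('a::real_inner \<Rightarrow> real) \<Rightarrow> 'a \<Rightarrow> 'a" where
  "grad \<phi> x = (SOME g. (\<phi> has_derivative (\<lambda>h. g \<bullet> h)) (at x))"

definition C1b :: "('a::real_inner \<Rightarrow> real) \<Rightarrow> bool" where
  "C1b \<phi> \<longleftrightarrow> bounded (range \<phi>) \<and>
     (\<exists>g. (\<forall>x. (\<phi> has_derivative (\<lambda>h. g x \<bullet> h)) (at x)) \<and> continuous_on UNIV g \<and> bounded (range g))"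

definition Lp :: "'a measure \<Rightarrow> real \<Rightarrow> ('a \<Rightarrow> real) \<Rightarrow> bool" where
  "Lp M p u \<longleftrightarrow> u \<in> borel_measurable M \<and> integrable M (\<lambda>x. \<bar>u x\<bar> powr p)"

text \<open>Vector fields in tilde C^1_b(X,X) are given by a finite list of pairs (f_i, z_i),
  representing F = sum f_i z_i.\<close>
definition vfield :: "(('a::real_inner \<Rightarrow> real) \<times> 'a) list \<Rightarrow> 'a \<Rightarrow> 'a" where
  "vfield Fs x = (\<Sum>(f,z)\<leftarrow>Fs. f x *\<^sub>R z)"

definition Mstar :: "('a::real_inner \<Rightarrow>\<^sub>L 'a) \<Rightarrow> ('a \<Rightarrow> 'a \<Rightarrow> real)
    \<Rightarrow> (('a \<Rightarrow> real) \<times> 'a) list \<Rightarrow> 'a \<Rightarrow> real" where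
  "Mstar R v Fs x = (\<Sum>(f,z)\<leftarrow>Fs. - (blinfun_apply R (grad f x) \<bullet> z) + v z x * f x)"

definition Vvar :: "'a measure \<Rightarrow> ('a::real_inner \<Rightarrow>\<^sub>L 'a) \<Rightarrow> ('a \<Rightarrow> 'a \<Rightarrow> real)
    \<Rightarrow> ('a \<Rightarrow> real) \<Rightarrow> ereal" where
  "Vvar nu R v u = (SUP Fs \<in> {Fs. (\<forall>(f,z)\<in>set Fs. C1b f) \<and> (\<forall>x. norm (vfield Fs x) \<le> 1)}.
      ereal (\<integral>x. u x * Mstar R v Fs x \<partial>nu))"

definition total_var :: "('a::real_normed_vector set \<Rightarrow> 'a) \<Rightarrow> ereal" where
  "total_var m = (SUP B \<in> {B :: nat \<Rightarrow> 'a set. range B \<subseteq> sets borel \<and> disjoint_family B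
        \<and> \<Union>(range B) = UNIV}. (\<Sum>n. ereal (norm (m (B n)))))"

definition vec_measure :: "('a::real_normed_vector set \<Rightarrow> 'a) \<Rightarrow> bool" where
  "vec_measure m \<longleftrightarrow>
     (\<forall>B :: nat \<Rightarrow> 'a set. range B \<subseteq> sets borel \<longrightarrow> disjoint_family B \<longrightarrow>
        (\<lambda>n. m (B n)) sums m (\<Union>(range B))) \<and> total_var m < \<infinity>"

definition pos_var :: "('a::topological_space set \<Rightarrow> real) \<Rightarrow> 'a set \<Rightarrow> real" where
  "pos_var \<mu> B = (SUP A \<in> {A \<in> sets borel. A \<subseteq> B}. \<mu> A)"

definition neg_var :: "('a::topological_space set \<Rightarrow> real) \<Rightarrow> 'a set \<Rightarrow> real" where
  "neg_var \<mu> B = (SUP A \<in> {A \<in> sets borel. A \<subseteq> B}. - \<mu> A)"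

definition signed_integral :: "('a::topological_space set \<Rightarrow> real) \<Rightarrow> ('a \<Rightarrow> real) \<Rightarrow> real" where
  "signed_integral \<mu> \<phi> =
     (\<integral>x. \<phi> x \<partial>(measure_of UNIV (sets borel) (\<lambda>B. ennreal (pos_var \<mu> B))))
   - (\<integral>x. \<phi> x \<partial>(measure_of UNIV (sets borel) (\<lambda>B. ennreal (neg_var \<mu> B))))"

definition BV_repr :: "'a measure \<Rightarrow> ('a::real_inner \<Rightarrow>\<^sub>L 'a) \<Rightarrow> ('a \<Rightarrow> 'a \<Rightarrow> real)
    \<Rightarrow> ('a \<Rightarrow> real) \<Rightarrow> ('a set \<Rightarrow> 'a) \<Rightarrow> bool" where
  "BV_repr nu R v u m \<longleftrightarrow>
     (\<forall>z \<phi>. C1b \<phi> \<longrightarrow>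
        (\<integral>x. u x * (blinfun_apply R (grad \<phi> x) \<bullet> z - v z x * \<phi> x) \<partial>nu)
          = - signed_integral (\<lambda>B. m B \<bullet> z) \<phi>)"

definition BV :: "'a measure \<Rightarrow> ('a::real_inner \<Rightarrow>\<^sub>L 'a) \<Rightarrow> ('a \<Rightarrow> 'a \<Rightarrow> real)
    \<Rightarrow> ('a \<Rightarrow> real) \<Rightarrow> bool" where
  "BV nu R v u \<longleftrightarrow> (\<exists>m. vec_measure m \<and> BV_repr nu R v u m)"

end

theory Submission
  imports Defs
begin

text \<open>
  The upper bound of the variation by the total variation follows by approximating a field uniformly by
  step functions, the lower bound by approximating indicators of disjoint Borel sets in \<open>L1\<close>
  by functions of class C1b.

  For the existence of the measure, let \<open>h\<close> be the image of \<open>z\<close> under the adjoint of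
  \<open>R\<close>. Only the derivative along \<open>h\<close> enters the functional
  \<open>\<integral> u (v z f - \<langle>R (grad f), z\<rangle>) d nu\<close>, which is bounded in the sup norm because the variation is
  finite. Hence \<open>t \<mapsto> \<integral> u 1_A(x + t h) d nu\<close> is Lipschitz uniformly in the Borel set \<open>A\<close>, so the
  bound persists on all bounded Borel functions that are differentiable along \<open>h\<close> with bounded
  derivative. This class admits cut-offs that are merely Borel transversally to \<open>h\<close>, so
  Dini's theorem on segments of lines suffices to verify the Daniell continuity of the positive part
  of the functional; no compactness in \<open>X\<close> is needed. The resulting signed measures are linear in
  \<open>z\<close> and bounded, and the Riesz representation theorem assembles them to a vector measure.
\<close>

section \<open>Functions of class C1b\<close>

text \<open>The obstacle is countable additivity: on a space that is not locally compact, a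
  functional bounded in the sup norm need not be given by a measure, so boundedness of the variation
  alone does not produce one, and the special form of the functional must be used. Its part with
  \<open>v z\<close> is integration against the L1 function \<open>u v_z\<close>; only the
  derivative part is delicate, and that part sees each line parallel to \<open>h\<close> separately.
  On a line, a long segment is compact, and what lies beyond it is removed by cut-offs whose
  derivatives stay bounded and tend to 0 pointwise, so that dominated convergence applies. The price
  is a class of functions that is an algebra but not a lattice. Hence truncation is replaced by
  composition with a C1 step, the Riesz decomposition is carried out up to a small error, and the
  Daniell construction is done with the operations of an algebra. A second difficulty is that the
  measures are found separately for each \<open>z\<close> and are not unique as pairs; relations
  between different directions are recovered by testing all of them with one common function of
  class \<open>C1b\<close>.\<close>

lemma C1bI:
  assumes "bounded (range f)" "\<And>x. (f has_derivative (\<lambda>h. g x \<bullet> h)) (at x)"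
    "continuous_on UNIV g" "bounded (range g)"
  shows "C1b f"
  using assms unfolding C1b_def by blast

lemma has_derivative_inner_unique:
  assumes "(f has_derivative (\<lambda>h. a \<bullet> h)) (at x)" "(f has_derivative (\<lambda>h. b \<bullet> h)) (at x)"
  shows "a = b"
proof -
  have "(\<lambda>h. a \<bullet> h) = (\<lambda>h. b \<bullet> h)"
    using has_derivative_unique[OF assms] .
  then have "a \<bullet> (a - b) = b \<bullet> (a - b)"
    by metis
  then have "(a - b) \<bullet> (a - b) = 0"
    by (simp add: inner_diff_left)
  then show ?thesis by simp
qed

lemma grad_eq:
  assumes "(f has_derivative (\<lambda>h. g \<bullet> h)) (at x)"
  shows "grad f x = g"
proof -
  have "(f has_derivative (\<lambda>h. grad f x \<bullet> h)) (at x)"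
    unfolding grad_def by (rule someI[of _ g]) (rule assms)
  then show ?thesis
    using assms has_derivative_inner_unique by blast
qed

lemma C1bD:
  assumes "C1b f"
  shows "bounded (range f)" "\<And>x. (f has_derivative (\<lambda>h. grad f x \<bullet> h)) (at x)"
    "continuous_on UNIV (grad f)" "bounded (range (grad f))"
proof -
  obtain g where g: "\<And>x. (f has_derivative (\<lambda>h. g x \<bullet> h)) (at x)"
    "continuous_on UNIV g" "bounded (range g)" and b: "bounded (range f)"
    using assms unfolding C1b_def by blast
  have "grad f = g"
    using grad_eq[OF g(1)] by blast
  then show "bounded (range f)" "\<And>x. (f has_derivative (\<lambda>h. grad f x \<bullet> h)) (at x)"
    "continuous_on UNIV (grad f)" "bounded (range (grad f))"
    using g b by auto
qed

lemma C1b_continuous: "C1b f \<Longrightarrow> continuous_on UNIV f"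
  using C1bD(2) by (metis continuous_at_imp_continuous_on has_derivative_continuous)

lemma C1b_measurable: "C1b f \<Longrightarrow> f \<in> borel_measurable borel"
  by (intro borel_measurable_continuous_onI C1b_continuous)

lemma C1b_bound:
  fixes f :: "'a::real_inner \<Rightarrow> real"
  assumes "C1b f"
  obtains K where "K > 0" "\<And>x. \<bar>f x\<bar> \<le> K" "\<And>x. norm (grad f x) \<le> K"
proof -
  obtain a where a: "\<And>x. \<bar>f x\<bar> \<le> a"
    using C1bD(1)[OF assms] by (auto simp: bounded_iff)
  obtain b where b: "\<And>x. norm (grad f x) \<le> b"
    using C1bD(4)[OF assms] by (auto simp: bounded_iff)
  have "0 \<le> a" "0 \<le> b"
    using a[of undefined] b[of undefined] norm_ge_zero abs_ge_zero order_trans by blast+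
  then show ?thesis
    using a b order_trans[OF a, of "a + b + 1"] order_trans[OF b, of "a + b + 1"]
    by (intro that[of "a + b + 1"]) auto
qed

lemma C1b_const [simp]: "C1b (\<lambda>x. c)"
  by (rule C1bI[where g = "\<lambda>x. 0"]) auto

lemma C1b_add:
  assumes "C1b f" "C1b g"
  shows "C1b (\<lambda>x. f x + g x)" and "grad (\<lambda>x. f x + g x) x = grad f x + grad g x"
proof -
  note f = C1bD[OF assms(1)] and g = C1bD[OF assms(2)]
  have d: "((\<lambda>x. f x + g x) has_derivative (\<lambda>h. (grad f x + grad g x) \<bullet> h)) (at x)" for x
    by (auto intro!: derivative_eq_intros f(2) g(2) simp: inner_add_left)
  show "C1b (\<lambda>x. f x + g x)"
    by (rule C1bI[OF _ d])
      (auto intro!: bounded_plus_comp continuous_intros f g)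
  show "grad (\<lambda>x. f x + g x) x = grad f x + grad g x"
    using grad_eq[OF d] .
qed

lemma C1b_mult:
  fixes f g :: "'a::real_inner \<Rightarrow> real"
  assumes "C1b f" "C1b g"
  shows "C1b (\<lambda>x. f x * g x)" and "grad (\<lambda>x. f x * g x) x = f x *\<^sub>R grad g x + g x *\<^sub>R grad f x"
proof -
  note f = C1bD[OF assms(1)] and g = C1bD[OF assms(2)]
  have d: "((\<lambda>x. f x * g x) has_derivative (\<lambda>h. (f x *\<^sub>R grad g x + g x *\<^sub>R grad f x) \<bullet> h)) (at x)" for x
    by (auto intro!: derivative_eq_intros f(2) g(2) simp: inner_add_left)
  obtain K where K: "K > 0" "\<And>x. \<bar>f x\<bar> \<le> K" "\<And>x. norm (grad f x) \<le> K"
    using C1b_bound[OF assms(1)] by blast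
  obtain L where L: "L > 0" "\<And>x. \<bar>g x\<bar> \<le> L" "\<And>x. norm (grad g x) \<le> L"
    using C1b_bound[OF assms(2)] by blast
  have "bounded (range (\<lambda>x. f x * g x))"
    unfolding bounded_iff
    using K L by (intro exI[of _ "K * L"]) (auto simp: abs_mult intro!: mult_mono)
  moreover have "norm (f x *\<^sub>R grad g x + g x *\<^sub>R grad f x) \<le> K * L + L * K" for x
    using K L by (intro order_trans[OF norm_triangle_ineq] add_mono) (auto intro!: mult_mono)
  then have "bounded (range (\<lambda>x. f x *\<^sub>R grad g x + g x *\<^sub>R grad f x))"
    unfolding bounded_iff by blast
  ultimately show "C1b (\<lambda>x. f x * g x)"
    by (intro C1bI[OF _ d]) (auto intro!: continuous_intros f g C1b_continuous assms)
  show "grad (\<lambda>x. f x * g x) x = f x *\<^sub>R grad g x + g x *\<^sub>R grad f x"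
    using grad_eq[OF d] .
qed

lemma C1b_cmult:
  fixes f :: "'a::real_inner \<Rightarrow> real"
  assumes "C1b f"
  shows "C1b (\<lambda>x. c * f x)" and "grad (\<lambda>x. c * f x) x = c *\<^sub>R grad f x"
proof -
  show "C1b (\<lambda>x. c * f x)"
    using C1b_mult(1)[OF C1b_const assms] .
  have "((\<lambda>x. c * f x) has_derivative (\<lambda>h. (c *\<^sub>R grad f x) \<bullet> h)) (at x)"
    by (auto intro!: derivative_eq_intros C1bD(2)[OF assms])
  then show "grad (\<lambda>x. c * f x) x = c *\<^sub>R grad f x"
    by (rule grad_eq)
qed

lemma C1b_compl:
  fixes f :: "'a::real_inner \<Rightarrow> real"
  assumes "C1b f"
  shows "C1b (\<lambda>x. 1 - f x)"
  using C1b_add(1)[OF C1b_const[of 1] C1b_cmult(1)[OF assms, of "-1"]] by simp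

lemma C1b_prod:
  fixes f :: "'i \<Rightarrow> 'a::real_inner \<Rightarrow> real"
  assumes "\<And>i. i \<in> I \<Longrightarrow> C1b (f i)"
  shows "C1b (\<lambda>x. \<Prod>i\<in>I. f i x)"
  using assms by (induction I rule: infinite_finite_induct) (auto intro: C1b_mult(1))

lemma C1b_compose:
  fixes f :: "'a::real_inner \<Rightarrow> real"
  assumes f: "C1b f" and k: "\<And>s. (k has_real_derivative k' s) (at s)" "continuous_on UNIV k'"
  shows "C1b (\<lambda>x. k (f x))"
proof -
  obtain K where K: "K > 0" "\<And>x. \<bar>f x\<bar> \<le> K" "\<And>x. norm (grad f x) \<le> K"
    using C1b_bound[OF f] by blast
  have ck: "continuous_on UNIV k"
    using k(1) by (meson DERIV_isCont continuous_at_imp_continuous_on)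
  have bk: "bounded (k ` {-K..K})" "bounded (k' ` {-K..K})"
    using compact_Icc by (auto intro!: compact_imp_bounded compact_continuous_image
        continuous_on_subset[OF ck] continuous_on_subset[OF k(2)])
  obtain a where a: "\<And>s. s \<in> {-K..K} \<Longrightarrow> \<bar>k s\<bar> \<le> a"
    using bk(1) unfolding bounded_iff by force
  obtain b where b: "\<And>s. s \<in> {-K..K} \<Longrightarrow> \<bar>k' s\<bar> \<le> b"
    using bk(2) unfolding bounded_iff by force
  note ab = a b
  have fK: "f x \<in> {-K..K}" for x using K(2)[of x] by auto
  have d: "((\<lambda>x. k (f x)) has_derivative (\<lambda>h. (k' (f x) *\<^sub>R grad f x) \<bullet> h)) (at x)" for x
  proof -
    have "((\<lambda>x. k (f x)) has_derivative (\<lambda>h. k' (f x) * (grad f x \<bullet> h))) (at x)"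
      using has_derivative_compose[OF C1bD(2)[OF f], of k "\<lambda>h. k' (f x) * h" x] k(1)[of "f x"]
      by (simp add: has_field_derivative_def)
    then show ?thesis by simp
  qed
  have "norm (k' (f x) *\<^sub>R grad f x) \<le> b * K" for x
    using ab(2)[OF fK[of x]] K(3)[of x] by (auto intro!: mult_mono)
  then have b1: "bounded (range (\<lambda>x. k' (f x) *\<^sub>R grad f x))"
    unfolding bounded_iff by blast
  have b2: "bounded (range (\<lambda>x. k (f x)))"
    unfolding bounded_iff using ab(1)[OF fK] by auto
  have "continuous_on UNIV (\<lambda>x. k' (f x))"
    using continuous_on_compose2[OF k(2) C1b_continuous[OF f]] by simp
  then have c: "continuous_on UNIV (\<lambda>x. k' (f x) *\<^sub>R grad f x)"
    by (intro continuous_on_scaleR C1bD(3)[OF f])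
  show ?thesis
    by (rule C1bI[OF b2 d c b1])
qed

lemma C1b_shift:
  fixes f :: "'a::real_inner \<Rightarrow> real"
  assumes f: "C1b f"
  shows "C1b (\<lambda>x. f (x + a))" and "grad (\<lambda>x. f (x + a)) x = grad f (x + a)"
proof -
  have d: "((\<lambda>x. f (x + a)) has_derivative (\<lambda>h. grad f (x + a) \<bullet> h)) (at x)" for x
  proof -
    have "((\<lambda>x. x + a) has_derivative (\<lambda>h. h)) (at x)"
      using has_derivative_add[OF has_derivative_ident has_derivative_const[of a]] by simp
    from has_derivative_compose[OF this C1bD(2)[OF f, of "x + a"]] show ?thesis .
  qed
  show "C1b (\<lambda>x. f (x + a))"
  proof (rule C1bI[OF _ d])
    show "bounded (range (\<lambda>x. f (x + a)))" "bounded (range (\<lambda>x. grad f (x + a)))"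
      by (rule bounded_subset[OF C1bD(1)[OF f]], blast, rule bounded_subset[OF C1bD(4)[OF f]], blast)
    show "continuous_on UNIV (\<lambda>x. grad f (x + a))"
      by (rule continuous_on_compose2[OF C1bD(3)[OF f]]) (auto intro!: continuous_intros)
  qed
  show "grad (\<lambda>x. f (x + a)) x = grad f (x + a)"
    using grad_eq[OF d] .
qed


section \<open>A C1 step function and bumps supported on balls\<close>

definition smooth_step :: "real \<Rightarrow> real" where
  "smooth_step s = 2 * (max 0 s)\<^sup>2 - 4 * (max 0 (s - 1/2))\<^sup>2 + 2 * (max 0 (s - 1))\<^sup>2"

text \<open>The tent on [0,1] with peak 2 at 1/2, hence of integral 1; \<open>smooth_step\<close> is
  its primitive, written with truncated squares. One continuous derivative is enough to stay inside
  \<open>C1b\<close> under composition.\<close>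

definition smooth_step' :: "real \<Rightarrow> real" where
  "smooth_step' s = 4 * max 0 s - 8 * max 0 (s - 1/2) + 4 * max 0 (s - 1)"

lemma DERIV_max_square: "((\<lambda>s::real. (max 0 s)\<^sup>2) has_real_derivative 2 * max 0 s) (at s)"
proof -
  have "\<bar>((max 0 (s + h))\<^sup>2 - (max 0 s)\<^sup>2) / h - 2 * max 0 s\<bar> \<le> \<bar>h\<bar>" if "h \<noteq> 0" for h
  proof -
    \<comment> \<open>The remainder is at most \<open>h\<^sup>2\<close> in each of the four sign
      patterns of \<open>s\<close> and \<open>s + h\<close>, so the difference quotient is within
      \<open>\<bar>h\<bar>\<close> of its limit.\<close>
    have *: "\<bar>(max 0 (s + h))\<^sup>2 - (max 0 s)\<^sup>2 - 2 * max 0 s * h\<bar> \<le> h\<^sup>2"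
    proof (cases "0 \<le> s"; cases "0 \<le> s + h")
      assume a: "0 \<le> s" "\<not> 0 \<le> s + h"
      then have *: "s * (s + h) \<le> 0" "0 \<le> (h + s) * (h + s)" "0 \<le> s * s" "0 \<le> h * h"
        by (auto intro: mult_nonneg_nonpos)
      have "\<bar>- (s * s) - 2 * (s * h)\<bar> \<le> h * h"
        using * unfolding abs_le_iff ring_distribs mult.commute[of h s] by linarith
      with a show ?thesis
        by (simp add: max_def power2_eq_square algebra_simps)
    next
      assume a: "\<not> 0 \<le> s" "0 \<le> s + h"
      then have "(s + h)\<^sup>2 \<le> h\<^sup>2" by (intro power_mono) auto
      with a show ?thesis by (simp add: max_def)
    qed (auto simp: max_def power2_eq_square algebra_simps)
    have "((max 0 (s + h))\<^sup>2 - (max 0 s)\<^sup>2) / h - 2 * max 0 s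
        = ((max 0 (s + h))\<^sup>2 - (max 0 s)\<^sup>2 - 2 * max 0 s * h) / h"
      using that by (simp add: field_simps)
    also have "\<bar>\<dots>\<bar> \<le> h\<^sup>2 / \<bar>h\<bar>"
      using * by (simp add: abs_divide divide_right_mono)
    also have "\<dots> = \<bar>h\<bar>" using that by (simp add: power2_eq_square divide_simps abs_if)
    finally show ?thesis .
  qed
  then have "\<forall>\<^sub>F h in at 0. norm (((max 0 (s + h))\<^sup>2 - (max 0 s)\<^sup>2) / h - 2 * max 0 s) \<le> \<bar>h\<bar>"
    unfolding eventually_at_filter real_norm_def by simp
  moreover have "((\<lambda>h::real. \<bar>h\<bar>) \<longlongrightarrow> 0) (at 0)"
    using tendsto_rabs_zero[OF tendsto_ident_at] .
  ultimately have "((\<lambda>h. ((max 0 (s + h))\<^sup>2 - (max 0 s)\<^sup>2) / h - 2 * max 0 s) \<longlongrightarrow> 0) (at 0)"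
    by (rule Lim_null_comparison)
  then show ?thesis
    unfolding DERIV_def by (rule Lim_null[THEN iffD2])
qed

lemma smooth_step_DERIV: "(smooth_step has_real_derivative smooth_step' s) (at s)"
proof -
  have *: "((\<lambda>s::real. (max 0 (s - c))\<^sup>2) has_real_derivative 2 * max 0 (s - c)) (at s)" for c
    using DERIV_shift[of "\<lambda>s. (max 0 s)\<^sup>2" "2 * max 0 (s - c)" s "- c"]
      DERIV_max_square[of "s - c"] by simp
  show ?thesis
    unfolding smooth_step_def[abs_def] smooth_step'_def
    by (rule derivative_eq_intros *[of 0, simplified] * refl)+ simp
qed

lemma smooth_step'_continuous: "continuous_on UNIV smooth_step'"
  unfolding smooth_step'_def[abs_def] by (intro continuous_intros)

lemma smooth_step_0: "s \<le> 0 \<Longrightarrow> smooth_step s = 0"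
  by (simp add: smooth_step_def)

lemma smooth_step'_0: "s \<le> 0 \<Longrightarrow> smooth_step' s = 0"
  by (simp add: smooth_step'_def)

lemma smooth_step_1: "1 \<le> s \<Longrightarrow> smooth_step s = 1"
  by (simp add: smooth_step_def max_def power2_eq_square algebra_simps)

lemma smooth_step'_bounds: "0 \<le> smooth_step' s" "smooth_step' s \<le> 2"
  by (auto simp: smooth_step'_def max_def)

lemma smooth_step_mono: "s \<le> t \<Longrightarrow> smooth_step s \<le> smooth_step t"
  by (rule DERIV_nonneg_imp_nondecreasing) (use smooth_step_DERIV smooth_step'_bounds(1) in blast)+

lemma smooth_step_bounds: "0 \<le> smooth_step s" "smooth_step s \<le> 1"
  using smooth_step_mono[of "min 0 s" s] smooth_step_0[of "min 0 s"]
    smooth_step_mono[of s "max 1 s"] smooth_step_1[of "max 1 s"] by auto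

lemma smooth_step_pos: "0 < s \<Longrightarrow> 0 < smooth_step s"
proof -
  assume s: "0 < s"
  have "0 < 2 * (min s (1/2))\<^sup>2" using s by (auto simp: min_def)
  also have "\<dots> = smooth_step (min s (1/2))" using s by (simp add: smooth_step_def)
  also have "\<dots> \<le> smooth_step s" by (intro smooth_step_mono) auto
  finally show ?thesis .
qed

text \<open>The squared distance is used because it is differentiable also at the centre, unlike the
  distance itself.\<close>

definition ball_bump :: "'a::real_inner \<Rightarrow> real \<Rightarrow> 'a \<Rightarrow> real" where
  "ball_bump a r x = smooth_step (r\<^sup>2 - (x - a) \<bullet> (x - a))"

lemma ball_bump_pos_iff:
  assumes "0 < r"
  shows "0 < ball_bump a r x \<longleftrightarrow> x \<in> ball a r"
proof -
  have "0 < ball_bump a r x \<longleftrightarrow> 0 < r\<^sup>2 - (x - a) \<bullet> (x - a)"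
    using smooth_step_0[of "r\<^sup>2 - (x - a) \<bullet> (x - a)"] smooth_step_pos[of "r\<^sup>2 - (x - a) \<bullet> (x - a)"]
    unfolding ball_bump_def by linarith
  also have "\<dots> \<longleftrightarrow> norm (x - a) < r"
    using assms power_strict_mono[of "norm (x - a)" r 2] power2_less_imp_less[of "norm (x - a)" r]
    by (auto simp: dot_square_norm)
  finally show ?thesis by (simp add: dist_norm norm_minus_commute)
qed

lemma ball_bump_nonneg: "0 \<le> ball_bump a r x"
  by (simp add: ball_bump_def smooth_step_bounds)

lemma ball_bump_C1b:
  assumes "0 < r"
  shows "C1b (ball_bump a r)"
proof -
  let ?q = "\<lambda>x. r\<^sup>2 - (x - a) \<bullet> (x - a)"
  let ?g = "\<lambda>x. (- 2 * smooth_step' (?q x)) *\<^sub>R (x - a)"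
  have d: "(ball_bump a r has_derivative (\<lambda>h. ?g x \<bullet> h)) (at x)" for x
  proof -
    have "(?q has_derivative (\<lambda>h. - 2 * ((x - a) \<bullet> h))) (at x)"
      by (auto intro!: derivative_eq_intros simp: inner_commute)
    from has_derivative_compose[OF this, of smooth_step "\<lambda>h. smooth_step' (?q x) * h"]
    have "((\<lambda>x. smooth_step (?q x)) has_derivative (\<lambda>h. smooth_step' (?q x) * (- 2 * ((x - a) \<bullet> h)))) (at x)"
      using smooth_step_DERIV[of "?q x"] by (simp add: has_field_derivative_def)
    moreover have "(\<lambda>h. smooth_step' (?q x) * (- 2 * ((x - a) \<bullet> h))) = (\<lambda>h. ?g x \<bullet> h)"
      by (auto simp: algebra_simps)
    ultimately show ?thesis unfolding ball_bump_def[abs_def] by simp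
  qed
  \<comment> \<open>Inside the ball \<open>norm (x - a) < r\<close> and the tent is at most 2;
    outside, the tent vanishes, which keeps the gradient bounded although the quadratic has an
    unbounded one.\<close>
  have "norm (?g x) \<le> 4 * r" for x
  proof (cases "norm (x - a) < r")
    case True
    have "norm (?g x) = 2 * smooth_step' (?q x) * norm (x - a)"
      using smooth_step'_bounds[of "?q x"] by simp
    also have "\<dots> \<le> 2 * 2 * r"
      using True smooth_step'_bounds[of "?q x"] by (intro mult_mono) auto
    finally show ?thesis by simp
  next
    case False
    then have "r\<^sup>2 \<le> (x - a) \<bullet> (x - a)"
      using assms by (simp flip: power2_norm_eq_inner)
    then show ?thesis using assms by (simp add: smooth_step'_0)
  qed
  then have b1: "bounded (range ?g)" unfolding bounded_iff by blast
  have b2: "bounded (range (ball_bump a r))"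
    unfolding bounded_iff ball_bump_def by (intro exI[of _ 1]) (simp add: smooth_step_bounds)
  have "continuous_on UNIV (\<lambda>x. smooth_step' (?q x))"
    by (rule continuous_on_compose2[OF smooth_step'_continuous]) (intro continuous_intros, simp)
  then have c: "continuous_on UNIV ?g"
    by (intro continuous_on_scaleR continuous_on_mult continuous_on_diff continuous_on_const continuous_on_id)
  show ?thesis
    by (rule C1bI[OF b2 d c b1])
qed

lemma C1b_smooth_step: "C1b f \<Longrightarrow> C1b (\<lambda>x. smooth_step (c * f x))"
  by (rule C1b_compose[OF C1b_cmult(1) smooth_step_DERIV smooth_step'_continuous])

section \<open>Approximation of Borel sets by functions of class C1b\<close>

lemma finite_measure_integrable_bounded:
  fixes f :: "'a::topological_space \<Rightarrow> real"
  assumes "finite_measure M" "sets M = sets borel" "f \<in> borel_measurable borel" "\<And>x. \<bar>f x\<bar> \<le> B"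
  shows "integrable M f"
  using assms measurable_cong_sets[OF assms(2) refl, of borel]
  by (intro finite_measure.integrable_const_bound[of _ _ B]) auto

lemma open_Union_balls:
  fixes U :: "'a::{metric_space, second_countable_topology} set"
  assumes "open U"
  obtains A :: "nat \<Rightarrow> 'a set" where "U = (\<Union>n. A n)" "\<And>n. \<exists>a r. A n = ball a r"
proof -
  define F where "F = insert (ball undefined 0) {ball a r |a r. ball a r \<subseteq> U}"
  have "\<And>S. S \<in> F \<Longrightarrow> open S" by (auto simp: F_def)
  then obtain F' where F': "F' \<subseteq> F" "countable F'" "\<Union>F' = \<Union>F"
    using Lindelof by metis
  have "\<Union>F = U"
  proof
    show "\<Union>F \<subseteq> U" by (auto simp: F_def)
    show "U \<subseteq> \<Union>F"
    proof
      fix x assume "x \<in> U"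
      then obtain r where "r > 0" "ball x r \<subseteq> U" using assms openE by blast
      then show "x \<in> \<Union>F" unfolding F_def by (auto intro!: exI[of _ "ball x r"])
    qed
  qed
  \<comment> \<open>\<open>ball undefined 0\<close> is the empty set. It makes the family nonempty,
    hence enumerable by \<open>from_nat_into\<close>, also when \<open>U\<close> is empty.\<close>
  let ?F = "insert (ball undefined 0) F'"
  let ?A = "from_nat_into ?F"
  have rng: "range ?A = ?F" using F'(2) by (intro range_from_nat_into) auto
  show ?thesis
  proof (rule that[of ?A])
    show "U = (\<Union>n. ?A n)" unfolding rng using F'(3) \<open>\<Union>F = U\<close> by simp
    fix n
    have "?A n \<in> ?F" using rng by blast
    then show "\<exists>a r. ?A n = ball a r" using F'(1) unfolding F_def by blast
  qed
qed

text \<open>One \<open>f\<close> has to serve all measures in \<open>Ms\<close> at once, with values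
  in [0,1]: the same function is later tested against the measures of several directions, and the
  norm bounds on fields rest on its range.\<close>

definition C1b_approximable :: "'a::real_inner measure set \<Rightarrow> ('a \<Rightarrow> real) \<Rightarrow> bool" where
  "C1b_approximable Ms g \<longleftrightarrow> g \<in> borel_measurable borel \<and> (\<forall>x. 0 \<le> g x \<and> g x \<le> 1) \<and>
     (\<forall>e>0. \<exists>f. C1b f \<and> (\<forall>x. 0 \<le> f x \<and> f x \<le> 1) \<and> (\<forall>M\<in>Ms. (\<integral>x. \<bar>f x - g x\<bar> \<partial>M) < e))"

locale finite_borel_measures =
  fixes Ms :: "'a::{real_inner, second_countable_topology} measure set"
  assumes finite_Ms: "finite Ms"
    and finite_measure_Ms: "\<And>M. M \<in> Ms \<Longrightarrow> finite_measure M"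
    and sets_Ms: "\<And>M. M \<in> Ms \<Longrightarrow> sets M = sets borel"
begin

lemma integrable_Ms:
  fixes f :: "'a \<Rightarrow> real"
  assumes "M \<in> Ms" "f \<in> borel_measurable borel" "\<And>x. \<bar>f x\<bar> \<le> B"
  shows "integrable M f"
  by (rule finite_measure_integrable_bounded[OF finite_measure_Ms[OF assms(1)] sets_Ms[OF assms(1)] assms(2,3)])

lemma integral_abs_diff_le:
  fixes a b c d k l :: "'a \<Rightarrow> real"
  assumes M: "M \<in> Ms" and m: "\<And>g. g \<in> {a, b, c, d, k, l} \<Longrightarrow> g \<in> borel_measurable borel"
    and b01: "\<And>g x. g \<in> {a, b, c, d, k, l} \<Longrightarrow> 0 \<le> g x \<and> g x \<le> 1"
    and le: "\<And>x. \<bar>a x - b x\<bar> \<le> \<bar>c x - d x\<bar> + \<bar>k x - l x\<bar>"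
  shows "(\<integral>x. \<bar>a x - b x\<bar> \<partial>M) \<le> (\<integral>x. \<bar>c x - d x\<bar> \<partial>M) + (\<integral>x. \<bar>k x - l x\<bar> \<partial>M)"
proof -
  have i: "integrable M (\<lambda>x. \<bar>g x - h x\<bar>)" if "g \<in> {a, b, c, d, k, l}" "h \<in> {a, b, c, d, k, l}" for g h
  proof (rule integrable_Ms[OF M, of _ 1])
    show "(\<lambda>x. \<bar>g x - h x\<bar>) \<in> borel_measurable borel"
      using m[OF that(1)] m[OF that(2)] by measurable
    show "\<bar>\<bar>g x - h x\<bar>\<bar> \<le> 1" for x
      using b01[OF that(1), of x] b01[OF that(2), of x] by (auto simp: abs_le_iff)
  qed
  have "(\<integral>x. \<bar>a x - b x\<bar> \<partial>M) \<le> (\<integral>x. \<bar>c x - d x\<bar> + \<bar>k x - l x\<bar> \<partial>M)"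
    by (intro integral_mono Bochner_Integration.integrable_add i le) simp_all
  also have "\<dots> = (\<integral>x. \<bar>c x - d x\<bar> \<partial>M) + (\<integral>x. \<bar>k x - l x\<bar> \<partial>M)"
    by (intro Bochner_Integration.integral_add i) simp_all
  finally show ?thesis .
qed

lemma approximable_C1b:
  assumes "C1b f" "\<And>x. 0 \<le> f x \<and> f x \<le> 1"
  shows "C1b_approximable Ms f"
  unfolding C1b_approximable_def using assms C1b_measurable[OF assms(1)] by (auto intro!: exI[of _ f])

text \<open>Dominated convergence with the constant 1 treats each measure; finiteness of
  \<open>Ms\<close> yields one index that is good for all of them.\<close>

lemma approximable_limit:
  assumes g: "\<And>n::nat. C1b_approximable Ms (g n)" and lim: "\<And>x. (\<lambda>n. g n x) \<longlonglongrightarrow> l x"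
  shows "C1b_approximable Ms l"
  unfolding C1b_approximable_def
proof (intro conjI allI impI)
  have gm: "g n \<in> borel_measurable borel" and g01: "0 \<le> g n x" "g n x \<le> 1" for n x
    using g[of n] by (auto simp: C1b_approximable_def)
  show lm: "l \<in> borel_measurable borel"
    using borel_measurable_LIMSEQ_real[OF lim gm] by simp
  show l01: "0 \<le> l x" "l x \<le> 1" for x
    using LIMSEQ_le_const[OF lim] LIMSEQ_le_const2[OF lim] g01 by blast+
  fix e :: real assume e: "e > 0"
  have bnd: "\<bar>g n x - l x\<bar> \<le> 1" for n x
    using g01[of n x] l01[of x] by auto
  have "\<forall>\<^sub>F n in sequentially. (\<integral>x. \<bar>g n x - l x\<bar> \<partial>M) < e / 2" if M: "M \<in> Ms" for M
  proof -
    have "(\<lambda>n. \<integral>x. \<bar>g n x - l x\<bar> \<partial>M) \<longlonglongrightarrow> (\<integral>x. 0 \<partial>M)"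
    proof (rule integral_dominated_convergence)
      show "integrable M (\<lambda>x. 1 :: real)"
        by (rule integrable_Ms[OF M, of _ 1]) auto
      show "AE x in M. (\<lambda>n. \<bar>g n x - l x\<bar>) \<longlonglongrightarrow> 0"
        using lim by (intro AE_I2) (simp add: LIM_zero tendsto_rabs_zero)
      show "(\<lambda>x. \<bar>g n x - l x\<bar>) \<in> borel_measurable M" for n
        using gm lm by (simp add: measurable_cong_sets[OF sets_Ms[OF M] refl])
    qed (use bnd in auto)
    then show ?thesis using e by (intro order_tendstoD(2)) auto
  qed
  then have "\<forall>\<^sub>F n in sequentially. \<forall>M\<in>Ms. (\<integral>x. \<bar>g n x - l x\<bar> \<partial>M) < e / 2"
    by (intro eventually_ball_finite finite_Ms) auto
  then obtain n where n: "\<And>M. M \<in> Ms \<Longrightarrow> (\<integral>x. \<bar>g n x - l x\<bar> \<partial>M) < e / 2"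
    by (auto simp: eventually_sequentially)
  have "e / 2 > 0" using e by simp
  then obtain f where f: "C1b f" "\<And>x. 0 \<le> f x \<and> f x \<le> 1"
    "\<And>M. M \<in> Ms \<Longrightarrow> (\<integral>x. \<bar>f x - g n x\<bar> \<partial>M) < e / 2"
    using g[of n] unfolding C1b_approximable_def by blast
  have "(\<integral>x. \<bar>f x - l x\<bar> \<partial>M) < e" if M: "M \<in> Ms" for M
  proof -
    have "(\<integral>x. \<bar>f x - l x\<bar> \<partial>M) \<le> (\<integral>x. \<bar>f x - g n x\<bar> \<partial>M) + (\<integral>x. \<bar>g n x - l x\<bar> \<partial>M)"
      using C1b_measurable[OF f(1)] gm lm f(2) g01 l01 by (intro integral_abs_diff_le M) auto
    also have "\<dots> < e" using f(3)[OF M] n[OF M] by simp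
    finally show ?thesis .
  qed
  then show "\<exists>f. C1b f \<and> (\<forall>x. 0 \<le> f x \<and> f x \<le> 1) \<and> (\<forall>M\<in>Ms. (\<integral>x. \<bar>f x - l x\<bar> \<partial>M) < e)"
    using f by blast
qed

lemma approximable_compl:
  assumes "C1b_approximable Ms g"
  shows "C1b_approximable Ms (\<lambda>x. 1 - g x)"
  unfolding C1b_approximable_def
proof (intro conjI allI impI)
  show "(\<lambda>x. 1 - g x) \<in> borel_measurable borel"
    using assms by (auto simp: C1b_approximable_def)
  show "0 \<le> 1 - g x" "1 - g x \<le> 1" for x
    using assms by (auto simp: C1b_approximable_def)
  fix e :: real assume "e > 0"
  then obtain f where f: "C1b f" "\<And>x. 0 \<le> f x \<and> f x \<le> 1"
    "\<And>M. M \<in> Ms \<Longrightarrow> (\<integral>x. \<bar>f x - g x\<bar> \<partial>M) < e"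
    using assms unfolding C1b_approximable_def by blast
  have "\<bar>1 - f x - (1 - g x)\<bar> = \<bar>f x - g x\<bar>" for x by simp
  then show "\<exists>f. C1b f \<and> (\<forall>x. 0 \<le> f x \<and> f x \<le> 1) \<and> (\<forall>M\<in>Ms. (\<integral>x. \<bar>f x - (1 - g x)\<bar> \<partial>M) < e)"
    using f by (intro exI[of _ "\<lambda>x. 1 - f x"]) (auto intro: C1b_compl)
qed

lemma approximable_mult:
  assumes "C1b_approximable Ms g" "C1b_approximable Ms h"
  shows "C1b_approximable Ms (\<lambda>x. g x * h x)"
  unfolding C1b_approximable_def
proof (intro conjI allI impI)
  have [measurable]: "g \<in> borel_measurable borel" "h \<in> borel_measurable borel"
    and gh: "0 \<le> g x" "g x \<le> 1" "0 \<le> h x" "h x \<le> 1" for x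
    using assms by (auto simp: C1b_approximable_def)
  show "(\<lambda>x. g x * h x) \<in> borel_measurable borel" by measurable
  show "0 \<le> g x * h x" "g x * h x \<le> 1" for x
    using gh[of x] by (auto intro: mult_le_one)
  fix e :: real assume "e > 0"
  then have e: "e / 2 > 0" by simp
  from e obtain f where f: "C1b f" "\<And>x. 0 \<le> f x \<and> f x \<le> 1"
    "\<And>M. M \<in> Ms \<Longrightarrow> (\<integral>x. \<bar>f x - g x\<bar> \<partial>M) < e / 2"
    using assms(1) unfolding C1b_approximable_def by blast
  from e obtain k where k: "C1b k" "\<And>x. 0 \<le> k x \<and> k x \<le> 1"
    "\<And>M. M \<in> Ms \<Longrightarrow> (\<integral>x. \<bar>k x - h x\<bar> \<partial>M) < e / 2"
    using assms(2) unfolding C1b_approximable_def by blast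
  note [measurable] = C1b_measurable[OF f(1)] C1b_measurable[OF k(1)]
  have "(\<integral>x. \<bar>f x * k x - g x * h x\<bar> \<partial>M) < e" if M: "M \<in> Ms" for M
  proof -
    have tri: "\<bar>f x * k x - g x * h x\<bar> \<le> \<bar>f x - g x\<bar> + \<bar>k x - h x\<bar>" for x
    proof -
      have "f x * k x - g x * h x = (f x - g x) * k x + g x * (k x - h x)"
        by (simp add: algebra_simps)
      also have "\<bar>\<dots>\<bar> \<le> \<bar>f x - g x\<bar> * \<bar>k x\<bar> + \<bar>g x\<bar> * \<bar>k x - h x\<bar>"
        by (metis abs_mult abs_triangle_ineq)
      also have "\<dots> \<le> \<bar>f x - g x\<bar> * 1 + 1 * \<bar>k x - h x\<bar>"
        using k(2)[of x] gh[of x] by (intro add_mono mult_mono) auto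
      finally show ?thesis by simp
    qed
    have "(\<integral>x. \<bar>f x * k x - g x * h x\<bar> \<partial>M) \<le> (\<integral>x. \<bar>f x - g x\<bar> \<partial>M) + (\<integral>x. \<bar>k x - h x\<bar> \<partial>M)"
      using f(2) k(2) gh by (intro integral_abs_diff_le M tri) (auto intro: mult_le_one)
    also have "\<dots> < e" using f(3)[OF M] k(3)[OF M] by simp
    finally show ?thesis .
  qed
  moreover have "0 \<le> f x * k x \<and> f x * k x \<le> 1" for x
    using f(2)[of x] k(2)[of x] by (auto intro: mult_le_one)
  ultimately show "\<exists>f. C1b f \<and> (\<forall>x. 0 \<le> f x \<and> f x \<le> 1) \<and> (\<forall>M\<in>Ms. (\<integral>x. \<bar>f x - g x * h x\<bar> \<partial>M) < e)"
    using f k by (intro exI[of _ "\<lambda>x. f x * k x"]) (auto intro: C1b_mult(1))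
qed

lemma approximable_indicator_compl:
  assumes "C1b_approximable Ms (indicator A)"
  shows "C1b_approximable Ms (indicator (- A))"
proof -
  have "(\<lambda>x. 1 - indicator A x) = (indicator (- A) :: 'a \<Rightarrow> real)"
    by (auto simp: indicator_def)
  then show ?thesis using approximable_compl[OF assms] by simp
qed

text \<open>De Morgan: complements and products of approximable indicators give finite unions, and
  pointwise limits give countable ones.\<close>

lemma approximable_indicator_UN:
  assumes "\<And>i::nat. C1b_approximable Ms (indicator (A i))"
  shows "C1b_approximable Ms (indicator (\<Union>i. A i))"
proof (rule approximable_limit)
  show "C1b_approximable Ms (indicator (\<Union>i<n. A i))" for n
  proof (induction n)
    case 0
    have "C1b_approximable Ms (\<lambda>x. 0)"
      by (rule approximable_C1b) auto
    then show ?case by (simp add: indicator_def[abs_def])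
  next
    case (Suc n)
    have "(\<lambda>x. indicator (- (\<Union>i<n. A i)) x * indicator (- A n) x)
       = (indicator (- (\<Union>i<Suc n. A i)) :: 'a \<Rightarrow> real)"
      by (auto simp: indicator_def fun_eq_iff less_Suc_eq)
    then have "C1b_approximable Ms (indicator (- (\<Union>i<Suc n. A i)))"
      using approximable_mult[OF approximable_indicator_compl[OF Suc]
          approximable_indicator_compl[OF assms[of n]]] by simp
    then show ?case using approximable_indicator_compl by fastforce
  qed
  show "(\<lambda>n. indicator (\<Union>i<n. A i) x) \<longlonglongrightarrow> (indicator (\<Union>i. A i) x :: real)" for x
    by (rule LIMSEQ_indicator_UN)
qed

text \<open>The bump is positive exactly on the ball, so \<open>smooth_step\<close> of its large
  multiples tends pointwise to the indicator.\<close>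

lemma approximable_ball: "C1b_approximable Ms (indicator (ball a r))"
proof (cases "0 < r")
  case True
  show ?thesis
  proof (rule approximable_limit)
    fix n
    show "C1b_approximable Ms (\<lambda>x. smooth_step (real n * ball_bump a r x))"
      by (intro approximable_C1b C1b_smooth_step ball_bump_C1b[OF True]) (auto intro: smooth_step_bounds)
  next
    fix x
    show "(\<lambda>n. smooth_step (real n * ball_bump a r x)) \<longlonglongrightarrow> indicator (ball a r) x"
    proof (cases "x \<in> ball a r")
      case x: True
      then have pos: "0 < ball_bump a r x" using ball_bump_pos_iff[OF True] by blast
      obtain n0 :: nat where "inverse (ball_bump a r x) \<le> real n0"
        using real_arch_simple by blast
      then have n0: "1 \<le> real n0 * ball_bump a r x"
        using pos by (simp add: field_simps)
      have "smooth_step (real n * ball_bump a r x) = 1" if "n \<ge> n0" for n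
      proof (rule smooth_step_1)
        have "real n0 * ball_bump a r x \<le> real n * ball_bump a r x"
          using that pos by simp
        then show "1 \<le> real n * ball_bump a r x" using n0 by simp
      qed
      then have "\<forall>\<^sub>F n in sequentially. smooth_step (real n * ball_bump a r x) = 1"
        unfolding eventually_sequentially by blast
      then show ?thesis using x by (simp add: tendsto_eventually)
    next
      case False
      then have "ball_bump a r x = 0"
        using ball_bump_pos_iff[OF True, of a x] ball_bump_nonneg[of a r x] by simp
      then show ?thesis using False by (simp add: smooth_step_0)
    qed
  qed
next
  case False
  have "C1b_approximable Ms (\<lambda>x. 0)"
    by (rule approximable_C1b) auto
  moreover have "(indicator (ball a r) :: 'a \<Rightarrow> real) = (\<lambda>x. 0)"
    using False by (simp add: ball_empty fun_eq_iff)
  ultimately show ?thesis by simp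
qed

text \<open>Open sets are countable unions of balls by second countability, and approximability
  passes to complements and countable unions; thus it spreads over the generated sigma-algebra
  without any appeal to regularity of the measures.\<close>

lemma approximable_indicator:
  assumes "A \<in> sets borel"
  shows "C1b_approximable Ms (indicator A)"
proof -
  have "A \<in> sigma_sets UNIV {S. open S}"
    using assms by (simp add: borel_def)
  then show ?thesis
  proof induction
    case (Basic U)
    then have "open U" by simp
    then show ?case
    proof (rule open_Union_balls)
      fix A :: "nat \<Rightarrow> 'a set" assume A: "U = (\<Union>n. A n)" "\<And>n. \<exists>a r. A n = ball a r"
      show ?thesis unfolding A(1)
        by (rule approximable_indicator_UN) (use A(2) approximable_ball in metis)
    qed
  next
    case Empty
    show ?case using approximable_ball[of undefined 0] unfolding ball_trivial .
  next
    case (Compl a)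
    then show ?case using approximable_indicator_compl by (simp flip: Compl_eq_Diff_UNIV)
  next
    case (Union a)
    then show ?case by (intro approximable_indicator_UN)
  qed
qed

lemma approx_indicator:
  assumes "A \<in> sets borel" "0 < e"
  obtains f where "C1b f" "\<And>x. 0 \<le> f x" "\<And>x. f x \<le> 1"
    "\<And>M. M \<in> Ms \<Longrightarrow> (\<integral>x. \<bar>f x - indicator A x\<bar> \<partial>M) < e"
  using approximable_indicator[OF assms(1)] assms(2) unfolding C1b_approximable_def by blast

text \<open>Replacing \<open>f i\<close> by \<open>f i * (\<Prod>j<i. 1 - f j)\<close> keeps the sum below 1 and does not spoil
  the approximation, because the sets are disjoint.\<close>
lemma approx_partition:
  assumes B: "\<And>i. i < n \<Longrightarrow> B i \<in> sets borel" and disj: "disjoint_family_on B {..<n::nat}" and e: "0 < e"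
  obtains f where "\<And>i. i < n \<Longrightarrow> C1b (f i)" "\<And>i x. i < n \<Longrightarrow> 0 \<le> f i x" "\<And>x. (\<Sum>i<n. f i x) \<le> 1"
    "\<And>i M. \<lbrakk>i < n; M \<in> Ms\<rbrakk> \<Longrightarrow> (\<integral>x. \<bar>f i x - indicator (B i) x\<bar> \<partial>M) < e"
proof (cases "n = 0")
  case True
  then show ?thesis using that[of "\<lambda>_ _. 0"] by simp
next
  case False
  \<comment> \<open>The error of \<open>g i\<close> is at most the sum of the errors of
    \<open>f 0\<close>, ..., \<open>f i\<close>, that is, of at most \<open>n\<close>
    functions.\<close>
  define d where "d = e / real n"
  have d: "d > 0" using e False by (simp add: d_def)
  have "\<exists>f. C1b f \<and> (\<forall>x. 0 \<le> f x \<and> f x \<le> 1) \<and> (\<forall>M\<in>Ms. (\<integral>x. \<bar>f x - indicator (B i) x\<bar> \<partial>M) < d)"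
    if "i < n" for i
    using approx_indicator[OF B[OF that] d] by metis
  then obtain f where f: "\<And>i. i < n \<Longrightarrow> C1b (f i)" "\<And>i x. i < n \<Longrightarrow> 0 \<le> f i x \<and> f i x \<le> 1"
    "\<And>i M. \<lbrakk>i < n; M \<in> Ms\<rbrakk> \<Longrightarrow> (\<integral>x. \<bar>f i x - indicator (B i) x\<bar> \<partial>M) < d"
    by metis
  define g where "g i x = f i x * (\<Prod>j<i. 1 - f j x)" for i x
  \<comment> \<open>\<open>g k x\<close> is the decrease of the product caused by the new factor
    \<open>1 - f k x\<close>, so the sum telescopes.\<close>
  have sum_g: "(\<Sum>i<k. g i x) = 1 - (\<Prod>i<k. 1 - f i x)" for k x
    by (induction k) (simp_all add: g_def algebra_simps)
  have prod01: "0 \<le> (\<Prod>j<i. 1 - f j x)" "(\<Prod>j<i. 1 - f j x) \<le> 1" if "i \<le> n" for i x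
    using f(2) that by (auto intro!: prod_nonneg prod_le_1)
  have close: "\<bar>g i x - indicator (B i) x\<bar> \<le> (\<Sum>j\<le>i. \<bar>f j x - indicator (B j) x\<bar>)" if i: "i < n" for i x
  proof -
    let ?a = "\<lambda>j. if j = i then f i x else 1 - f j x"
    let ?b = "\<lambda>j. if j = i then indicator (B i) x else 1 - indicator (B j) x :: real"
    have "g i x = (\<Prod>j\<le>i. ?a j)"
      by (simp add: g_def lessThan_Suc_atMost[symmetric] mult.commute)
    \<comment> \<open>By disjointness the indicator of \<open>B i\<close> absorbs the factors
      \<open>1 - indicator (B j)\<close> for \<open>j < i\<close>. Two products of numbers in [0,1]
      differ by at most the sum of the differences of their factors.\<close>
    moreover have "indicator (B i) x = (\<Prod>j\<le>i. ?b j)"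
    proof (cases "x \<in> B i")
      case True
      then have "x \<notin> B j" if "j < i" for j
        using disj that i unfolding disjoint_family_on_def by (metis IntI empty_iff lessThan_iff less_trans nat_neq_iff)
      with True show ?thesis by (intro prod.neutral[symmetric, THEN trans[rotated]]) auto
    next
      case False
      then have "(\<Prod>j\<le>i. ?b j) = 0" by (intro prod_zero) auto
      with False show ?thesis by simp
    qed
    moreover have "norm ((\<Prod>j\<le>i. ?a j) - (\<Prod>j\<le>i. ?b j)) \<le> (\<Sum>j\<le>i. norm (?a j - ?b j))"
      using f(2) i by (intro norm_prod_diff) (auto simp: indicator_def)
    moreover have "norm (?a j - ?b j) = \<bar>f j x - indicator (B j) x\<bar>" for j
      by auto
    ultimately show ?thesis by simp
  qed
  show ?thesis
  proof (rule that[of g])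
    show C: "C1b (g i)" if "i < n" for i
      unfolding g_def using that f(1) by (intro C1b_mult(1) C1b_prod C1b_compl) auto
    show "0 \<le> g i x" if "i < n" for i x
      unfolding g_def using that f(2) prod01(1)[of i x] by (intro mult_nonneg_nonneg) auto
    show "(\<Sum>i<n. g i x) \<le> 1" for x
      using prod01(1)[of n x] by (simp add: sum_g)
    fix i M assume i: "i < n" and M: "M \<in> Ms"
    have m: "(\<lambda>x. f j x - indicator (B j) x) \<in> borel_measurable borel" if "j \<le> i" for j
      using C1b_measurable[OF f(1)[of j]] B[of j] that i by simp
    have b: "\<bar>f j x - indicator (B j) x\<bar> \<le> 1" if "j \<le> i" for j x
      using f(2)[of j x] that i by (auto simp: indicator_def)
    have int: "integrable M (\<lambda>x. \<bar>f j x - indicator (B j) x\<bar>)" if "j \<le> i" for j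
      using m[OF that] b[OF that] by (intro integrable_Ms[OF M, of _ 1]) auto
    have "(\<integral>x. \<bar>g i x - indicator (B i) x\<bar> \<partial>M) \<le> (\<integral>x. (\<Sum>j\<le>i. \<bar>f j x - indicator (B j) x\<bar>) \<partial>M)"
    proof (intro integral_mono close i)
      show "integrable M (\<lambda>x. \<Sum>j\<le>i. \<bar>f j x - indicator (B j) x\<bar>)"
        using int by (intro Bochner_Integration.integrable_sum) auto
      show "integrable M (\<lambda>x. \<bar>g i x - indicator (B i) x\<bar>)"
      proof (rule integrable_Ms[OF M])
        show "(\<lambda>x. \<bar>g i x - indicator (B i) x\<bar>) \<in> borel_measurable borel"
          using C1b_measurable[OF C[OF i]] B[OF i] by simp
        show "\<bar>\<bar>g i x - indicator (B i) x\<bar>\<bar> \<le> real (card {..i})" for x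
          using close[OF i, of x] sum_bounded_above[of "{..i}" "\<lambda>j. \<bar>f j x - indicator (B j) x\<bar>" 1] b by force
      qed
    qed
    also have "\<dots> = (\<Sum>j\<le>i. (\<integral>x. \<bar>f j x - indicator (B j) x\<bar> \<partial>M))"
      using int by (intro Bochner_Integration.integral_sum) auto
    also have "\<dots> < (\<Sum>j\<le>i. d)"
      using f(3)[OF _ M] i by (intro sum_strict_mono) auto
    also have "\<dots> = real (Suc i) * d" by simp
    also have "\<dots> \<le> real n * d" using i d by (intro mult_right_mono) auto
    also have "\<dots> = e" using False by (simp add: d_def)
    finally show "(\<integral>x. \<bar>g i x - indicator (B i) x\<bar> \<partial>M) < e" .
  qed
qed

end

lemma finite_borel_measures_images:
  assumes "finite J" "\<And>j. j \<in> J \<Longrightarrow> finite_measure (P j)" "\<And>j. j \<in> J \<Longrightarrow> sets (P j) = sets borel"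
    "\<And>j. j \<in> J \<Longrightarrow> finite_measure (N j)" "\<And>j. j \<in> J \<Longrightarrow> sets (N j) = sets borel"
  shows "finite_borel_measures (P ` J \<union> N ` J)"
proof (rule finite_borel_measures.intro)
  show "finite (P ` J \<union> N ` J)" using assms(1) by simp
qed (elim UnE imageE, simp_all only: assms)+

text \<open>The mean of the indicators of the level sets is
  \<open>\<lfloor>n f\<rfloor> / n\<close>, which is within \<open>1 / n\<close> of
  \<open>f\<close>. This transfers statements about Borel sets to functions with values in [0,1],
  under an integrable weight \<open>w\<close> of any sign.\<close>

lemma integral_layer_limit:
  fixes w f :: "'a \<Rightarrow> real"
  assumes w: "integrable M w" and f: "f \<in> borel_measurable M" "\<And>x. 0 \<le> f x" "\<And>x. f x \<le> 1"
  shows "(\<lambda>n. (\<Sum>j=1..n. \<integral>x. w x * indicator {x. real j \<le> real n * f x} x \<partial>M) / real n)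
     \<longlonglongrightarrow> (\<integral>x. w x * f x \<partial>M)"
proof -
  define s where "s n x = (\<Sum>j=1..n. indicator {x. real j \<le> real n * f x} x) / real n" for n x
  have s: "s n x = real (nat \<lfloor>real n * f x\<rfloor>) / real n" for n x
  proof -
    have "{1..n} \<inter> {j. real j \<le> real n * f x} = {1..nat \<lfloor>real n * f x\<rfloor>}"
    proof -
      have "real n * f x \<le> real n" using f(3)[of x] by (simp add: mult_left_le)
      then have le: "nat \<lfloor>real n * f x\<rfloor> \<le> n" by linarith
      have eq: "real j \<le> real n * f x \<longleftrightarrow> j \<le> nat \<lfloor>real n * f x\<rfloor>" for j :: nat
      proof -
        have "0 \<le> \<lfloor>real n * f x\<rfloor>" using f(2)[of x] by simp
        then show ?thesis by (simp add: le_nat_iff le_floor_iff del: zero_le_floor)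
      qed
      have "{1..n} \<inter> {j. j \<le> N} = {1..N}" if "N \<le> n" for N
        using that by auto
      from this[OF le] show ?thesis by (simp only: eq)
    qed
    moreover have "(\<Sum>j=1..n. indicator {x. real j \<le> real n * f x} x) = real (card ({1..n} \<inter> {j. real j \<le> real n * f x}))"
      by (simp add: indicator_def[abs_def] sum.If_cases)
    ultimately show ?thesis by (simp add: s_def)
  qed
  have s_bounds: "0 \<le> s n x" "s n x \<le> f x" "f x - s n x \<le> inverse (real n)" if "n > 0" for n x
  proof -
    have "0 \<le> real n * f x" using f(2)[of x] by simp
    then have "real (nat \<lfloor>real n * f x\<rfloor>) \<le> real n * f x" "real n * f x - 1 \<le> real (nat \<lfloor>real n * f x\<rfloor>)"
      by linarith+
    then have "real (nat \<lfloor>real n * f x\<rfloor>) / real n \<le> f x" "f x \<le> (real (nat \<lfloor>real n * f x\<rfloor>) + 1) / real n"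
      using that by (auto simp: pos_divide_le_eq pos_le_divide_eq mult.commute)
    then show "0 \<le> s n x" "s n x \<le> f x" "f x - s n x \<le> inverse (real n)"
      by (auto simp: s add_divide_distrib inverse_eq_divide)
  qed
  have lim: "(\<lambda>n. s n x) \<longlonglongrightarrow> f x" for x
  proof -
    have "(\<lambda>n. s n x - f x) \<longlonglongrightarrow> 0"
    proof (rule Lim_null_comparison[OF _ lim_inverse_n])
      show "\<forall>\<^sub>F n in sequentially. norm (s n x - f x) \<le> inverse (real n)"
      proof (rule eventually_sequentiallyI[of 1])
        fix n :: nat assume "1 \<le> n"
        then show "norm (s n x - f x) \<le> inverse (real n)"
          using s_bounds(2,3)[of n x] by simp
      qed
    qed
    then show ?thesis by (simp add: LIM_zero_iff)
  qed
  have meas: "{x \<in> space M. real j \<le> real n * f x} \<in> sets M" for j n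
    using f(1) by measurable
  have i: "integrable M (\<lambda>x. w x * indicator {x. real j \<le> real n * f x} x)" for j n
  proof -
    have "integrable M (\<lambda>x. w x * indicator {x \<in> space M. real j \<le> real n * f x} x)"
      using integrable_real_mult_indicator[OF meas w] by simp
    then show ?thesis by (rule Bochner_Integration.integrable_cong[THEN iffD1, rotated -1]) (auto simp: indicator_def)
  qed
  have "(\<integral>x. w x * s n x \<partial>M) = (\<Sum>j=1..n. \<integral>x. w x * indicator {x. real j \<le> real n * f x} x \<partial>M) / real n" for n
  proof -
    have "(\<integral>x. w x * s n x \<partial>M) = (\<integral>x. (\<Sum>j=1..n. w x * indicator {x. real j \<le> real n * f x} x) / real n \<partial>M)"
      unfolding s_def by (simp only: sum_distrib_left times_divide_eq_right)
    also have "\<dots> = (\<integral>x. (\<Sum>j=1..n. w x * indicator {x. real j \<le> real n * f x} x) \<partial>M) / real n"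
      by (rule integral_divide_zero)
    also have "\<dots> = (\<Sum>j=1..n. \<integral>x. w x * indicator {x. real j \<le> real n * f x} x \<partial>M) / real n"
      by (subst Bochner_Integration.integral_sum[OF i]) (rule refl)
    finally show ?thesis .
  qed
  moreover have "(\<lambda>n. \<integral>x. w x * s n x \<partial>M) \<longlonglongrightarrow> (\<integral>x. w x * f x \<partial>M)"
  proof (rule integral_dominated_convergence[where w = "\<lambda>x. \<bar>w x\<bar>"])
    show "(\<lambda>x. w x * s n x) \<in> borel_measurable M" for n
      unfolding s using w f(1) by measurable
    show "AE x in M. norm (w x * s n x) \<le> \<bar>w x\<bar>" for n
    proof (cases "n > 0")
      case True
      have "\<bar>s n x\<bar> \<le> 1" for x
        using s_bounds(1,2)[OF True, of x] f(3)[of x] by simp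
      then show ?thesis
        by (intro AE_I2) (simp add: abs_mult mult_left_le)
    qed (simp add: s)
  qed (use w f(1) lim in \<open>auto intro!: tendsto_mult_left\<close>)
  ultimately show ?thesis by simp
qed

section \<open>Riesz representation and Daniell extension\<close>

text \<open>Direct method: the representing vector minimises \<open>norm x ^ 2 / 2 - l x\<close>.
  The parallelogram identity makes minimising sequences Cauchy, and vanishing of the first variation
  at the minimiser is the claimed identity.\<close>

lemma riesz_representation:
  fixes l :: "'a::{real_inner, complete_space} \<Rightarrow> real"
  assumes "bounded_linear l"
  obtains g where "\<And>x. l x = g \<bullet> x"
proof -
  interpret l: bounded_linear l by fact
  define J where "J x = (norm x)\<^sup>2 / 2 - l x" for x
  define d where "d = (INF x. J x)"
  obtain K where K: "\<And>x. norm (l x) \<le> norm x * K" using l.bounded by blast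
  have "- (K\<^sup>2) / 2 \<le> J x" for x
  proof -
    have "l x \<le> norm x * K" using K[of x] by simp
    moreover have "0 \<le> (norm x - K)\<^sup>2" by simp
    ultimately show ?thesis by (simp add: J_def power2_diff)
  qed
  then have bdd: "bdd_below (range J)" by (intro bdd_belowI[of _ "- (K\<^sup>2) / 2"]) auto
  have d: "d \<le> J x" for x unfolding d_def by (rule cINF_lower[OF bdd]) auto
  have "\<exists>x. J x < d + inverse (real (Suc n))" for n
  proof -
    have "(INF x. J x) < d + inverse (real (Suc n))" by (simp add: d_def)
    then show ?thesis using cINF_less_iff[OF _ bdd] by auto
  qed
  then obtain X where X: "\<And>n. J (X n) < d + inverse (real (Suc n))" by metis
  have par: "(norm (x - y))\<^sup>2 \<le> 4 * (J x - d) + 4 * (J y - d)" for x y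
  proof -
    have "J x + J y = 2 * J ((1/2) *\<^sub>R (x + y)) + (norm (x - y))\<^sup>2 / 4"
      unfolding J_def by (simp add: l.scaleR l.add power2_norm_eq_inner inner_diff_left inner_diff_right
          inner_add_left inner_add_right inner_commute field_simps)
    moreover have "n \<le> 4 * (p - d) + 4 * (q - d)" if "p + q = 2 * r + n / 4" "d \<le> r" for p q r n :: real
      using that by (simp add: field_simps)
    ultimately show ?thesis using d by blast
  qed
  have "Cauchy X"
  proof (rule metric_CauchyI)
    fix e :: real assume e: "0 < e"
    then obtain N where N: "inverse (real (Suc N)) < e\<^sup>2 / 8"
      using reals_Archimedean[of "e\<^sup>2 / 8"] by auto
    have "dist (X m) (X n) < e" if "m \<ge> N" "n \<ge> N" for m n
    proof -
      have "inverse (real (Suc k)) \<le> inverse (real (Suc N))" if "k \<ge> N" for k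
        using that by (intro le_imp_inverse_le) auto
      then have "J (X m) - d < e\<^sup>2 / 8" "J (X n) - d < e\<^sup>2 / 8"
        using X[of m] X[of n] N that by (smt (verit))+
      moreover have "a < c" if "a \<le> 4 * p + 4 * q" "p < c / 8" "q < c / 8" for a c p q :: real
        using that by linarith
      ultimately have "(norm (X m - X n))\<^sup>2 < e\<^sup>2" using par[of "X m" "X n"] by blast
      then show ?thesis using e by (auto simp: dist_norm intro: power2_less_imp_less)
    qed
    then show "\<exists>M. \<forall>m\<ge>M. \<forall>n\<ge>M. dist (X m) (X n) < e" by blast
  qed
  then obtain g where g: "X \<longlonglongrightarrow> g" using Cauchy_convergent convergent_def by blast
  have "(\<lambda>n. J (X n)) \<longlonglongrightarrow> J g"
    unfolding J_def by (intro tendsto_intros l.tendsto g) simp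
  moreover have "(\<lambda>n. d + inverse (real (Suc n))) \<longlonglongrightarrow> d + 0"
    by (intro tendsto_intros LIMSEQ_inverse_real_of_nat)
  ultimately have "J g \<le> d + 0"
    using X by (intro LIMSEQ_le) (auto intro: less_imp_le)
  then have min: "J g \<le> J x" for x using d[of x] by simp
  have "l x = g \<bullet> x" for x
  proof -
    define a where "a = g \<bullet> x - l x"
    have q: "0 \<le> t * a + t\<^sup>2 * ((norm x)\<^sup>2 / 2)" for t
    proof -
      have "J (g + t *\<^sub>R x) = J g + t * a + t\<^sup>2 * ((norm x)\<^sup>2 / 2)"
        unfolding J_def a_def power2_norm_eq_inner
        by (simp add: l.add l.scaleR inner_add_left inner_add_right inner_commute power2_eq_square field_simps)
      then show ?thesis using min[of "g + t *\<^sub>R x"] by linarith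
    qed
    define c where "c = (norm x)\<^sup>2 / 2 + 1"
    have c: "c > 0" by (simp add: c_def add_nonneg_pos)
    \<comment> \<open>At \<open>t = - a / c\<close> the quadratic equals
      \<open>- (a / c) ^ 2\<close>, which forces \<open>a = 0\<close>. The summand 1 in
      \<open>c\<close> makes this work for \<open>x = 0\<close> as well.\<close>
    have "0 \<le> (- a / c) * a + (- a / c)\<^sup>2 * (c - 1)" using q[of "- a / c"] by (simp add: c_def)
    also have "\<dots> = - (a\<^sup>2 / c\<^sup>2)" using c by (simp add: field_simps power2_eq_square)
    finally have "a = 0" using c by (simp add: divide_le_0_iff)
    then show ?thesis by (simp add: a_def)
  qed
  then show ?thesis using that by blast
qed

text \<open>Closure under \<open>smooth_step\<close> takes the place of the lattice operations of a
  Daniell system. \<open>I\<close> is additive only on nonnegative functions because it will be a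
  supremum, the positive part of a functional. \<open>I_sigma\<close> is Daniell continuity in
  subadditive form.\<close>

locale daniell_functional =
  fixes F :: "('a::{real_inner, second_countable_topology} \<Rightarrow> real) set" and I :: "('a \<Rightarrow> real) \<Rightarrow> real"
  assumes F_measurable: "\<And>f. f \<in> F \<Longrightarrow> f \<in> borel_measurable borel"
    and F_const: "\<And>c. (\<lambda>x. c) \<in> F"
    and F_add: "\<And>f g. f \<in> F \<Longrightarrow> g \<in> F \<Longrightarrow> (\<lambda>x. f x + g x) \<in> F"
    and F_mult: "\<And>f g. f \<in> F \<Longrightarrow> g \<in> F \<Longrightarrow> (\<lambda>x. f x * g x) \<in> F"
    and F_step: "\<And>f. f \<in> F \<Longrightarrow> (\<lambda>x. smooth_step (f x)) \<in> F"
    and F_ball: "\<And>a r. r > 0 \<Longrightarrow> ball_bump a r \<in> F"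
    and I_nonneg: "\<And>f. f \<in> F \<Longrightarrow> (\<And>x. 0 \<le> f x) \<Longrightarrow> 0 \<le> I f"
    and I_add: "\<And>f g. f \<in> F \<Longrightarrow> g \<in> F \<Longrightarrow> (\<And>x. 0 \<le> f x) \<Longrightarrow> (\<And>x. 0 \<le> g x) \<Longrightarrow>
        I (\<lambda>x. f x + g x) = I f + I g"
    and I_sigma: "\<And>f g. f \<in> F \<Longrightarrow> (\<And>x. 0 \<le> f x) \<Longrightarrow> (\<And>n::nat. g n \<in> F) \<Longrightarrow> (\<And>n x. 0 \<le> g n x) \<Longrightarrow>
        (\<And>x. ennreal (f x) \<le> (\<Sum>n. ennreal (g n x))) \<Longrightarrow> ennreal (I f) \<le> (\<Sum>n. ennreal (I (g n)))"
begin

text \<open>Covers consist of functions rather than sets, so \<open>outer\<close> is the Daniell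
  upper integral of the indicator of \<open>A\<close>.\<close>

definition covers :: "'a set \<Rightarrow> (nat \<Rightarrow> 'a \<Rightarrow> real) set" where
  "covers A = {g. (\<forall>n. g n \<in> F \<and> (\<forall>x. 0 \<le> g n x)) \<and> (\<forall>x\<in>A. 1 \<le> (\<Sum>n. ennreal (g n x)))}"

definition outer :: "'a set \<Rightarrow> ennreal" where
  "outer A = (INF g\<in>covers A. \<Sum>n. ennreal (I (g n)))"

lemma F_diff: "f \<in> F \<Longrightarrow> g \<in> F \<Longrightarrow> (\<lambda>x. f x - g x) \<in> F"
  using F_add[of f "\<lambda>x. -1 * g x"] F_mult[OF F_const[of "-1"], of g] by simp

lemma F_affine: "f \<in> F \<Longrightarrow> (\<lambda>x. a * f x + b) \<in> F"
  by (intro F_add F_mult F_const)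

lemma F_sum: "(\<And>i. i \<in> S \<Longrightarrow> f i \<in> F) \<Longrightarrow> (\<lambda>x. \<Sum>i\<in>S. f i x) \<in> F"
  by (induction S rule: infinite_finite_induct) (auto intro: F_const F_add)

lemma I_0: "I (\<lambda>x. 0) = 0"
  using I_add[OF F_const[of 0] F_const[of 0]] by simp

lemma I_mono:
  assumes "f \<in> F" "g \<in> F" "\<And>x. 0 \<le> f x" "\<And>x. f x \<le> g x"
  shows "I f \<le> I g"
proof -
  have "I (\<lambda>x. f x + (g x - f x)) = I f + I (\<lambda>x. g x - f x)"
    using assms by (intro I_add F_diff) auto
  moreover have "0 \<le> I (\<lambda>x. g x - f x)"
    using assms by (intro I_nonneg F_diff) auto
  ultimately show ?thesis by simp
qed

lemma I_sum:
  assumes "\<And>i. i \<in> S \<Longrightarrow> f i \<in> F" "\<And>i x. i \<in> S \<Longrightarrow> 0 \<le> f i x"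
  shows "I (\<lambda>x. \<Sum>i\<in>S. f i x) = (\<Sum>i\<in>S. I (f i))"
  using assms
proof (induction S rule: infinite_finite_induct)
  case (insert i S)
  then have "I (\<lambda>x. f i x + (\<Sum>i\<in>S. f i x)) = I (f i) + I (\<lambda>x. \<Sum>i\<in>S. f i x)"
    by (intro I_add F_sum sum_nonneg) auto
  with insert show ?case by simp
qed (auto simp: I_0)

lemma outer_le:
  assumes "\<And>n. g n \<in> F" "\<And>n x. 0 \<le> g n x" "\<And>x. x \<in> A \<Longrightarrow> 1 \<le> (\<Sum>n. ennreal (g n x))"
  shows "outer A \<le> (\<Sum>n. ennreal (I (g n)))"
  unfolding outer_def by (rule INF_lower) (use assms in \<open>auto simp: covers_def\<close>)

lemma outer_le_single:
  assumes "f \<in> F" "\<And>x. 0 \<le> f x" "\<And>x. x \<in> A \<Longrightarrow> 1 \<le> f x"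
  shows "outer A \<le> ennreal (I f)"
proof -
  let ?g = "\<lambda>n::nat. if n = 0 then f else (\<lambda>x. 0)"
  have s: "(\<Sum>n. ennreal (?g n x)) = ennreal (f x)" for x
    by (subst suminf_finite[of "{0}"]) auto
  have "outer A \<le> (\<Sum>n. ennreal (I (?g n)))"
  proof (rule outer_le)
    show "?g n \<in> F" for n using assms(1) F_const by simp
    show "0 \<le> ?g n x" for n x using assms(2) by simp
    show "1 \<le> (\<Sum>n. ennreal (?g n x))" if "x \<in> A" for x
      unfolding s using assms(3)[OF that] by (simp add: ennreal_ge_1)
  qed
  also have "\<dots> = ennreal (I f)"
    by (subst suminf_finite[of "{0}"]) (auto simp: I_0)
  finally show ?thesis .
qed

lemma outer_finite: "outer A < \<infinity>"
proof -
  have "outer A \<le> ennreal (I (\<lambda>x. 1))"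
    by (rule outer_le_single) (auto intro: F_const)
  then show ?thesis by (simp add: le_less_trans ennreal_less_top)
qed

lemma outer_mono: "A \<subseteq> B \<Longrightarrow> outer A \<le> outer B"
  unfolding outer_def by (rule INF_superset_mono) (auto simp: covers_def)

lemma outer_empty: "outer {} = 0"
proof -
  have "outer {} \<le> ennreal (I (\<lambda>x. 0))"
    by (rule outer_le_single) (auto intro: F_const)
  then show ?thesis by (simp add: I_0)
qed

lemma outer_UN:
  fixes A :: "nat \<Rightarrow> 'a set"
  shows "outer (\<Union>i. A i) \<le> (\<Sum>i. outer (A i))"
proof (rule ennreal_le_epsilon)
  fix e :: real assume e: "0 < e"
  have "\<exists>g\<in>covers (A i). (\<Sum>n. ennreal (I (g n))) < outer (A i) + ennreal (e * (1/2) ^ Suc i)" for i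
  proof -
    have "outer (A i) < outer (A i) + ennreal (e * (1/2) ^ Suc i)"
      using outer_finite[of "A i"] e
      by (cases "outer (A i)" rule: ennreal_cases) (auto intro!: ennreal_lessI add_nonneg_pos simp flip: ennreal_plus)
    then show ?thesis unfolding outer_def INF_less_iff .
  qed
  then obtain g where g: "\<And>i. g i \<in> covers (A i)"
    "\<And>i. (\<Sum>n. ennreal (I (g i n))) < outer (A i) + ennreal (e * (1/2) ^ Suc i)" by metis
  define h where "h k = (case prod_decode k of (i, n) \<Rightarrow> g i n)" for k
  have h1: "(\<Sum>k. ennreal (h k x)) = (\<Sum>i. \<Sum>n. ennreal (g i n x))" for x
  proof -
    have "(\<Sum>k. (\<lambda>(i, n). ennreal (g i n x)) (prod_decode k)) = (\<Sum>i. \<Sum>n. ennreal (g i n x))"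
      by (rule suminf_ennreal_2dimen) simp
    then show ?thesis by (simp add: h_def case_prod_beta)
  qed
  have h2: "(\<Sum>k. ennreal (I (h k))) = (\<Sum>i. \<Sum>n. ennreal (I (g i n)))"
  proof -
    have "(\<Sum>k. (\<lambda>(i, n). ennreal (I (g i n))) (prod_decode k)) = (\<Sum>i. \<Sum>n. ennreal (I (g i n)))"
      by (rule suminf_ennreal_2dimen) simp
    then show ?thesis by (simp add: h_def case_prod_beta)
  qed
  have "outer (\<Union>i. A i) \<le> (\<Sum>k. ennreal (I (h k)))"
  proof (rule outer_le)
    show "h n \<in> F" "0 \<le> h n x" for n x
      using g(1) by (auto simp: h_def covers_def split: prod.split)
    fix x assume "x \<in> (\<Union>i. A i)"
    then obtain i where "x \<in> A i" by auto
    then have "1 \<le> (\<Sum>n. ennreal (g i n x))" using g(1)[of i] by (auto simp: covers_def)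
    also have "\<dots> \<le> (\<Sum>i. \<Sum>n. ennreal (g i n x))"
      using sum_le_suminf[of "\<lambda>i. \<Sum>n. ennreal (g i n x)" "{i}"] by simp
    finally show "1 \<le> (\<Sum>k. ennreal (h k x))" by (simp add: h1)
  qed
  also have "\<dots> \<le> (\<Sum>i. outer (A i) + ennreal (e * (1/2) ^ Suc i))"
    unfolding h2 by (intro suminf_le) (use g(2) less_imp_le in blast)+
  also have "\<dots> = (\<Sum>i. outer (A i)) + (\<Sum>i. ennreal (e * (1/2) ^ Suc i))"
    by (rule suminf_add[symmetric]) auto
  also have "(\<Sum>i. ennreal (e * (1/2) ^ Suc i)) = ennreal e"
  proof -
    have "(\<lambda>i. e * (1/2) ^ Suc i) sums (e * 1)"
      by (intro sums_mult power_half_series)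
    then show ?thesis using e by (intro suminf_ennreal_eq) auto
  qed
  finally show "outer (\<Union>i. A i) \<le> (\<Sum>i. outer (A i)) + ennreal e" .
qed

lemma outer_Un: "outer (A \<union> B) \<le> outer A + outer B"
proof -
  have "outer (\<Union>i::nat. (if i = 0 then A else if i = 1 then B else {})) \<le>
     (\<Sum>i::nat. outer (if i = 0 then A else if i = 1 then B else {}))"
    using outer_UN[of "\<lambda>i. if i = 0 then A else if i = 1 then B else {}"] .
  also have "\<dots> = outer A + outer B"
    by (subst suminf_finite[of "{0, 1}"]) (auto simp: outer_empty)
  also have "(\<Union>i. (if i = (0::nat) then A else if i = 1 then B else {})) = A \<union> B"
    by (auto split: if_splits)
  finally show ?thesis .
qed

text \<open>The cut-offs \<open>w k\<close> increase to the indicator of the set, and \<open>w (Suc k) = 1\<close> wherever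
  \<open>w k > 0\<close>.\<close>
lemma outer_positive_set:
  assumes f: "f \<in> F"
  shows "outer (A \<inter> {x. 0 < f x}) + outer (A - {x. 0 < f x}) = outer A"
proof (rule antisym)
  let ?U = "{x. 0 < f x}"
  define w where "w k x = smooth_step (2 ^ k * f x - 1)" for k :: nat and x
  have wF: "w k \<in> F" for k
    unfolding w_def[abs_def] using F_step[OF F_affine[OF f, of "2 ^ k" "-1"]] by simp
  have w01: "0 \<le> w k x" "w k x \<le> 1" for k x
    by (auto simp: w_def smooth_step_bounds)
  have w_next: "w (Suc k) x = 1" if "0 < w k x" for k x
  proof -
    have "0 < 2 ^ k * f x - 1"
      using that smooth_step_0 unfolding w_def by (metis less_irrefl not_less)
    then show ?thesis unfolding w_def by (intro smooth_step_1) simp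
  qed
  have w_Suc: "w k x \<le> w (Suc k) x" for k x
    using w01[of k x] w01[of "Suc k" x] w_next[of k x] by (cases "0 < w k x") auto
  have w_out: "w k x = 0" if "x \<notin> ?U" for k x
  proof -
    have "2 ^ k * f x \<le> 0" using that by (simp add: mult_nonneg_nonpos)
    then show ?thesis unfolding w_def by (intro smooth_step_0) linarith
  qed
  have w_in: "\<exists>k. w k x = 1" if "x \<in> ?U" for x
  proof -
    obtain k where "2 / f x < 2 ^ k" using real_arch_pow[of 2 "2 / f x"] by auto
    then have "2 < 2 ^ k * f x" using that by (simp add: field_simps)
    then show ?thesis unfolding w_def by (intro exI[of _ k] smooth_step_1) linarith
  qed
  define U where "U k = {x. w k x = 1}" for k
  \<comment> \<open>A cover of \<open>A\<close> is split by the weights \<open>w k\<close> and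
    \<open>1 - w k\<close>: the first part covers \<open>A \<inter> U k\<close>, where
    \<open>w k = 1\<close>, the second covers \<open>A - ?U\<close>, where \<open>w k = 0\<close>,
    and additivity keeps the total cost.\<close>
  have step1: "outer (A \<inter> U k) + outer (A - ?U) \<le> outer A" for k
  proof -
    have "outer (A \<inter> U k) + outer (A - ?U) \<le> (\<Sum>n. ennreal (I (g n)))" if g: "g \<in> covers A" for g
    proof -
      have gF: "\<And>n. g n \<in> F" "\<And>n x. 0 \<le> g n x" and g1: "\<And>x. x \<in> A \<Longrightarrow> 1 \<le> (\<Sum>n. ennreal (g n x))"
        using g by (auto simp: covers_def)
      have F12: "(\<lambda>x. g n x * w k x) \<in> F" "(\<lambda>x. g n x * (1 - w k x)) \<in> F" for n
        using gF wF F_const by (auto intro!: F_mult F_diff)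
      have nn: "0 \<le> g n x * w k x" "0 \<le> g n x * (1 - w k x)" for n x
        using gF w01 by auto
      have "outer (A \<inter> U k) \<le> (\<Sum>n. ennreal (I (\<lambda>x. g n x * w k x)))"
        using g1 by (intro outer_le F12 nn) (auto simp: U_def)
      moreover have "outer (A - ?U) \<le> (\<Sum>n. ennreal (I (\<lambda>x. g n x * (1 - w k x))))"
        using g1 w_out by (intro outer_le F12 nn) auto
      ultimately have "outer (A \<inter> U k) + outer (A - ?U) \<le>
          (\<Sum>n. ennreal (I (\<lambda>x. g n x * w k x))) + (\<Sum>n. ennreal (I (\<lambda>x. g n x * (1 - w k x))))"
        by (rule add_mono)
      also have "\<dots> = (\<Sum>n. ennreal (I (\<lambda>x. g n x * w k x)) + ennreal (I (\<lambda>x. g n x * (1 - w k x))))"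
        by (rule suminf_add) auto
      also have "\<dots> = (\<Sum>n. ennreal (I (g n)))"
      proof (rule suminf_cong)
        fix n
        have "I (\<lambda>x. g n x * w k x + g n x * (1 - w k x)) = I (\<lambda>x. g n x * w k x) + I (\<lambda>x. g n x * (1 - w k x))"
          by (intro I_add F12 nn)
        moreover have "(\<lambda>x. g n x * w k x + g n x * (1 - w k x)) = g n"
          by (simp add: algebra_simps)
        ultimately show "ennreal (I (\<lambda>x. g n x * w k x)) + ennreal (I (\<lambda>x. g n x * (1 - w k x))) = ennreal (I (g n))"
          using I_nonneg[OF F12(1) nn(1)] I_nonneg[OF F12(2) nn(2)] by (simp flip: ennreal_plus)
      qed
      finally show ?thesis .
    qed
    then show ?thesis unfolding outer_def[of A] by (rule INF_greatest)
  qed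
  have w_mono: "w k x \<le> w (k + j) x" for k j x
    by (induction j) (auto intro: order_trans w_Suc)
  have Iw_mono: "incseq (\<lambda>k. I (w k))"
    by (rule incseq_SucI) (intro I_mono wF w01 w_Suc)
  have Iw_bdd: "I (w k) \<le> I (\<lambda>x. 1)" for k
    by (intro I_mono wF F_const w01)
  obtain S where S: "(\<lambda>k. I (w k)) \<longlonglongrightarrow> S" "\<And>k. I (w k) \<le> S"
    using incseq_convergent[OF Iw_mono] Iw_bdd by blast
  \<comment> \<open>The increments of \<open>w\<close> from index \<open>k\<close> on cover the
    remainder: outside \<open>U (Suc k)\<close> the value \<open>w k x\<close> must be 0, so they
    add up to 1. Their costs telescope to at most \<open>S - I (w k)\<close>, which tends to
    0.\<close>
  have step2: "outer (?U - U (Suc k)) \<le> ennreal (S - I (w k))" for k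
  proof -
    let ?g = "\<lambda>j x. w (Suc (k + j)) x - w (k + j) x"
    have gF: "?g j \<in> F" for j by (intro F_diff wF)
    have g0: "0 \<le> ?g j x" for j x using w_Suc by simp
    have "outer (?U - U (Suc k)) \<le> (\<Sum>j. ennreal (I (?g j)))"
    proof (rule outer_le)
      fix x assume x: "x \<in> ?U - U (Suc k)"
      then have w0: "w k x = 0" using w_next[of k x] w01(1)[of k x] less_eq_real_def by (auto simp: U_def)
      obtain m where m: "w m x = 1" using w_in x by blast
      have "w (k + m) x = 1" using m w_mono[of m x k] w01(2)[of "k + m" x] by (simp add: add.commute)
      moreover have "(\<Sum>j<m. ?g j x) = w (k + m) x - w k x"
        using sum_lessThan_telescope[of "\<lambda>j. w (k + j) x" m] by simp
      ultimately have "1 = (\<Sum>j<m. ?g j x)" using w0 by simp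
      then have "1 = ennreal (\<Sum>j<m. ?g j x)" by simp
      also have "\<dots> = (\<Sum>j<m. ennreal (?g j x))" using g0 by (simp add: sum_ennreal)
      also have "\<dots> \<le> (\<Sum>j. ennreal (?g j x))" by (rule sum_le_suminf) auto
      finally show "1 \<le> (\<Sum>j. ennreal (?g j x))" .
    qed (use gF g0 in auto)
    also have "\<dots> \<le> ennreal (S - I (w k))"
    proof (rule suminf_le_const)
      fix n
      have Ig: "I (?g j) = I (w (Suc (k + j))) - I (w (k + j))" for j
        using I_add[OF gF[of j] wF[of "k + j"]] g0 w01 by simp
      have "(\<Sum>j<n. ennreal (I (?g j))) = ennreal (\<Sum>j<n. I (?g j))"
        using I_nonneg[OF gF g0] by (intro sum_ennreal) blast
      also have "(\<Sum>j<n. I (?g j)) = I (w (k + n)) - I (w k)"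
        using sum_lessThan_telescope[of "\<lambda>j. I (w (k + j))" n] by (simp add: Ig)
      also have "ennreal \<dots> \<le> ennreal (S - I (w k))" using S(2) by (intro ennreal_leI) simp
      finally show "(\<Sum>j<n. ennreal (I (?g j))) \<le> ennreal (S - I (w k))" .
    qed auto
    finally show ?thesis .
  qed
  show "outer (A \<inter> ?U) + outer (A - ?U) \<le> outer A"
  proof (rule ennreal_le_epsilon)
    fix e :: real assume "0 < e"
    then have "\<forall>\<^sub>F k in sequentially. S - e < I (w k)"
      by (intro order_tendstoD(1)[OF S(1)]) simp
    then obtain k where k: "S - e < I (w k)" by (auto simp: eventually_sequentially)
    have "outer (A \<inter> ?U) \<le> outer ((A \<inter> U (Suc k)) \<union> (?U - U (Suc k)))"
      by (rule outer_mono) auto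
    also have "\<dots> \<le> outer (A \<inter> U (Suc k)) + ennreal (S - I (w k))"
      using step2[of k] by (intro order_trans[OF outer_Un] add_mono) auto
    also have "\<dots> \<le> outer (A \<inter> U (Suc k)) + ennreal e"
      using k by (intro add_mono ennreal_leI) auto
    finally have "outer (A \<inter> ?U) + outer (A - ?U) \<le> outer (A \<inter> U (Suc k)) + ennreal e + outer (A - ?U)"
      by (rule add_right_mono)
    also have "\<dots> = outer (A \<inter> U (Suc k)) + outer (A - ?U) + ennreal e"
      by (simp add: ac_simps)
    also have "\<dots> \<le> outer A + ennreal e"
      by (intro add_right_mono step1)
    finally show "outer (A \<inter> ?U) + outer (A - ?U) \<le> outer A + ennreal e" .
  qed
next
  let ?U = "{x. 0 < f x}"
  have "A = (A \<inter> ?U) \<union> (A - ?U)" by blast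
  then show "outer A \<le> outer (A \<inter> ?U) + outer (A - ?U)"
    using outer_Un[of "A \<inter> ?U" "A - ?U"] by simp
qed

text \<open>Caratheodory applied to \<open>outer\<close>: positivity sets of members of
  \<open>F\<close>, in particular balls, are measurable, hence all Borel sets are. A layer argument
  yields one inequality between integral and functional; applying it to \<open>1 - f\<close> yields
  the other.\<close>

theorem representing_measure:
  obtains P where "finite_measure P" "sets P = sets borel"
    "\<And>f. \<lbrakk>f \<in> F; \<And>x. 0 \<le> f x; \<And>x. f x \<le> 1\<rbrakk> \<Longrightarrow> (\<integral>x. f x \<partial>P) = I f"
proof -
  interpret sigma_algebra UNIV "Pow UNIV :: 'a set set" by (rule sigma_algebra_Pow)
  define L where "L = lambda_system UNIV (Pow UNIV) outer"
  have L: "A \<in> L \<longleftrightarrow> (\<forall>B. outer (B \<inter> A) + outer (B - A) = outer B)" for A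
    unfolding L_def lambda_system_eq by simp
  have ms: "measure_space UNIV L outer"
    unfolding L_def
  proof (rule caratheodory_lemma)
    show "outer_measure_space (Pow UNIV) outer"
      unfolding outer_measure_space_def positive_def increasing_def countably_subadditive_def
      using outer_empty outer_mono outer_UN by auto
  qed
  then interpret L: sigma_algebra UNIV L by (simp add: measure_space_def)
  have posL: "{x. 0 < f x} \<in> L" if "f \<in> F" for f
    unfolding L using outer_positive_set[OF that] by blast
  have ball: "ball a r \<in> L" for a r
  proof (cases "0 < r")
    case True
    then have "ball a r = {x. 0 < ball_bump a r x}"
      using ball_bump_pos_iff[OF True] by blast
    then show ?thesis using posL[OF F_ball[OF True]] by simp
  next
    case False
    then have "ball a r = {}" by (simp add: ball_empty)
    then show ?thesis by (metis L.empty_sets)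
  qed
  have "U \<in> L" if opU: "open U" for U
  proof (rule open_Union_balls[OF opU])
    fix A :: "nat \<Rightarrow> 'a set"
    assume A: "U = (\<Union>n. A n)" "\<And>n. \<exists>a r. A n = ball a r"
    show ?thesis unfolding A(1)
      by (rule L.countable_UN) (use A(2) ball in \<open>metis image_subsetI\<close>)
  qed
  then have "{S. open S} \<subseteq> L" by blast
  then have borel_L: "sets borel \<subseteq> L"
    unfolding borel_def using L.sigma_sets_subset[of "{S. open S}"] by simp
  define P where "P = measure_of UNIV (sets borel) outer"
  have sets_P: "sets P = sets borel"
    unfolding P_def using sets.sigma_sets_eq[of borel] by (simp add: sets_measure_of)
  have space_P: "space P = UNIV"
    unfolding P_def by simp
  have emeasure_P: "emeasure P A = outer A" if "A \<in> sets borel" for A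
    unfolding P_def
  proof (rule emeasure_measure_of_sigma)
    show "sigma_algebra UNIV (sets borel)"
      using sets.sigma_algebra_axioms[of borel] by simp
    show "positive (sets borel) outer" by (simp add: positive_def outer_empty)
    show "countably_additive (sets borel) outer"
      using ms borel_L unfolding measure_space_def countably_additive_def by (meson subset_trans subsetD)
  qed fact
  have fin: "finite_measure P"
    using outer_finite[of UNIV] by (intro finite_measureI) (simp add: emeasure_P space_P)
  have bound: "(\<integral>x. f x \<partial>P) \<le> I f" if f: "f \<in> F" "\<And>x. 0 \<le> f x" "\<And>x. f x \<le> 1" for f
  proof -
    have fm [measurable]: "f \<in> borel_measurable borel" by (rule F_measurable[OF f(1)])
    have "(\<lambda>n. (\<Sum>j=1..n. \<integral>x. 1 * indicator {x. real j \<le> real n * f x} x \<partial>P) / real n)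
       \<longlonglongrightarrow> (\<integral>x. 1 * f x \<partial>P)"
    proof (rule integral_layer_limit)
      show "integrable P (\<lambda>x. 1::real)" using fin by (simp add: finite_measure.integrable_const)
      show "f \<in> borel_measurable P" using fm measurable_cong_sets[OF sets_P refl] by blast
    qed (use f in auto)
    moreover have "(\<lambda>n. I f + I (\<lambda>x. 1) * inverse (real n)) \<longlonglongrightarrow> I f + I (\<lambda>x. 1) * 0"
      by (intro tendsto_intros lim_inverse_n)
    moreover have "(\<Sum>j=1..n. \<integral>x. 1 * indicator {x. real j \<le> real n * f x} x \<partial>P) / real n
        \<le> I f + I (\<lambda>x. 1) * inverse (real n)" if n: "n \<ge> 1" for n
    proof -
      \<comment> \<open>\<open>?s j\<close> is 1 where \<open>j \<le> n f\<close> and 0 where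
        \<open>n f \<le> j - 1\<close>. Thus it dominates the indicator of the level set, while the
        sum over \<open>j\<close> exceeds \<open>n f\<close> by at most 1.\<close>
      let ?s = "\<lambda>j x. smooth_step (real n * f x + (1 - real j))"
      have sF: "?s j \<in> F" for j by (intro F_step F_affine f)
      have s0: "0 \<le> ?s j x" for j x by (rule smooth_step_bounds)
      have "(\<integral>x. 1 * indicator {x. real j \<le> real n * f x} x \<partial>P) \<le> I (?s j)" for j
      proof -
        have m: "{x. real j \<le> real n * f x} \<in> sets borel" by measurable
        have "outer {x. real j \<le> real n * f x} \<le> ennreal (I (?s j))"
          by (intro outer_le_single sF s0) (simp add: smooth_step_1)
        then have "measure P {x. real j \<le> real n * f x} \<le> I (?s j)"
          unfolding measure_def emeasure_P[OF m] using I_nonneg[OF sF s0] by (rule enn2real_leI[rotated])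
        then show ?thesis using m by (simp add: sets_P space_P)
      qed
      then have "(\<Sum>j=1..n. \<integral>x. 1 * indicator {x. real j \<le> real n * f x} x \<partial>P) \<le> (\<Sum>j=1..n. I (?s j))"
        by (rule sum_mono)
      also have "\<dots> = I (\<lambda>x. \<Sum>j=1..n. ?s j x)"
        by (intro I_sum[symmetric] sF s0)
      also have "\<dots> \<le> I (\<lambda>x. (\<Sum>j=1..n. f x) + 1)"
      proof (rule I_mono)
        fix x
        show "(\<Sum>j=1..n. ?s j x) \<le> (\<Sum>j=1..n. f x) + 1"
        proof -
          have nf: "0 \<le> real n * f x" using f by simp
          \<comment> \<open>The second bound drives the induction: either \<open>n f \<le> k\<close>
            and the new term is 0, or \<open>k < n f\<close> and the trivial bound
            \<open>k + 1\<close> is already below \<open>n f + 1\<close>.\<close>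
          have "(\<Sum>j=1..k. ?s j x) \<le> real n * f x + 1 \<and> (\<Sum>j=1..k. ?s j x) \<le> real k" for k
          proof (induction k)
            case (Suc k)
            have le1: "?s (Suc k) x \<le> 1" by (rule smooth_step_bounds)
            show ?case
            proof (cases "real n * f x \<le> real k")
              case True
              then have "?s (Suc k) x = 0" by (intro smooth_step_0) simp
              then show ?thesis using Suc by simp
            next
              case False
              have "(\<Sum>j=1..Suc k. ?s j x) = (\<Sum>j=1..k. ?s j x) + ?s (Suc k) x" by simp
              then show ?thesis using Suc le1 False by linarith
            qed
          qed (use nf in auto)
          then show ?thesis by simp
        qed
      qed (use sF s0 f in \<open>auto intro!: F_sum F_add F_mult F_const sum_nonneg\<close>)
      also have "\<dots> = I (\<lambda>x. \<Sum>j=1..n. f x) + I (\<lambda>x. 1)"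
        using f by (intro I_add F_sum F_const sum_nonneg) auto
      also have "I (\<lambda>x. \<Sum>j=1..n. f x) = real n * I f"
        using I_sum[of "{1..n}" "\<lambda>j. f"] f by simp
      finally show ?thesis using n by (simp add: field_simps)
    qed
    ultimately have "(\<integral>x. 1 * f x \<partial>P) \<le> I f + I (\<lambda>x. 1) * 0"
      by (intro LIMSEQ_le) auto
    then show ?thesis by simp
  qed
  have "outer UNIV = ennreal (I (\<lambda>x. 1))"
  proof (rule antisym)
    show "outer UNIV \<le> ennreal (I (\<lambda>x. 1))" by (intro outer_le_single F_const) auto
    \<comment> \<open>Daniell continuity enters here: no countable cover of the whole space can cost
      less than \<open>I 1\<close>, so the measure loses no mass.\<close>
    show "ennreal (I (\<lambda>x. 1)) \<le> outer UNIV"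
      unfolding outer_def by (rule INF_greatest, rule I_sigma) (auto simp: covers_def F_const)
  qed
  then have P1: "measure P UNIV = I (\<lambda>x. 1)"
    by (simp add: measure_def emeasure_P I_nonneg F_const)
  show ?thesis
  proof (rule that[OF fin sets_P])
    fix f assume f: "f \<in> F" "\<And>x. 0 \<le> f x" "\<And>x. f x \<le> (1::real)"
    have int: "integrable P f"
      by (rule finite_measure_integrable_bounded[OF fin sets_P F_measurable[OF f(1)], of 1])
        (use f in \<open>simp add: abs_of_nonneg\<close>)
    have f1: "(\<lambda>x. 1 - f x) \<in> F" by (intro F_diff F_const f)
    have "(\<integral>x. 1 - f x \<partial>P) \<le> I (\<lambda>x. 1 - f x)"
      using f f1 by (intro bound) auto
    moreover have "(\<integral>x. 1 - f x \<partial>P) = measure P UNIV - (\<integral>x. f x \<partial>P)"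
      using int fin by (simp add: finite_measure.integrable_const space_P)
    moreover have "I (\<lambda>x. f x + (1 - f x)) = I f + I (\<lambda>x. 1 - f x)"
      using f f1 by (intro I_add) auto
    ultimately show "(\<integral>x. f x \<partial>P) = I f"
      using bound[OF f] P1 by simp
  qed
qed

end

section \<open>Differentiability along a line\<close>

text \<open>Regularity is asked only along \<open>h\<close>; across the lines mere Borel
  measurability remains. The bound and the measurability of \<open>f'\<close> are included so that
  difference quotients can be integrated by dominated convergence.\<close>

definition line_diff :: "'a::{real_inner, second_countable_topology} \<Rightarrow> ('a \<Rightarrow> real) \<Rightarrow> ('a \<Rightarrow> real) \<Rightarrow> bool" where
  "line_diff h f f' \<longleftrightarrow> f \<in> borel_measurable borel \<and> f' \<in> borel_measurable borel \<and>
     (\<exists>K. \<forall>x. \<bar>f x\<bar> \<le> K \<and> \<bar>f' x\<bar> \<le> K) \<and>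
     (\<forall>x. ((\<lambda>t. f (x + t *\<^sub>R h)) has_real_derivative f' x) (at 0))"

text \<open>The derivative as a function of \<open>f\<close> alone, so that a functional can be
  defined on \<open>f\<close> without carrying \<open>f'\<close> along.\<close>

definition dline :: "'a::real_vector \<Rightarrow> ('a \<Rightarrow> real) \<Rightarrow> 'a \<Rightarrow> real" where
  "dline h f x = deriv (\<lambda>t. f (x + t *\<^sub>R h)) 0"

lemma line_diff_dline: "line_diff h f f' \<Longrightarrow> dline h f = f'"
  unfolding line_diff_def dline_def by (auto intro: DERIV_imp_deriv)

lemma line_diff_measurable:
  assumes "line_diff h f f'"
  shows "f \<in> borel_measurable borel" "f' \<in> borel_measurable borel"
  using assms by (auto simp: line_diff_def)

lemma line_diff_bound:
  assumes "line_diff h f f'"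
  obtains K where "K > 0" "\<And>x. \<bar>f x\<bar> \<le> K" "\<And>x. \<bar>f' x\<bar> \<le> K"
proof -
  obtain K where K: "\<And>x. \<bar>f x\<bar> \<le> K" "\<And>x. \<bar>f' x\<bar> \<le> K"
    using assms unfolding line_diff_def by blast
  have "\<bar>f x\<bar> \<le> \<bar>K\<bar> + 1" "\<bar>f' x\<bar> \<le> \<bar>K\<bar> + 1" for x
    using K[of x] by linarith+
  then show ?thesis by (intro that[of "\<bar>K\<bar> + 1"]) auto
qed

lemma line_diff_DERIV:
  assumes "line_diff h f f'"
  shows "((\<lambda>t. f (x + t *\<^sub>R h)) has_real_derivative f' (x + t *\<^sub>R h)) (at t)"
proof -
  have "((\<lambda>s. f ((x + t *\<^sub>R h) + s *\<^sub>R h)) has_real_derivative f' (x + t *\<^sub>R h)) (at 0)"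
    using assms unfolding line_diff_def by blast
  then have "((\<lambda>s. (\<lambda>t. f (x + t *\<^sub>R h)) (s + t)) has_real_derivative f' (x + t *\<^sub>R h)) (at 0)"
    by (simp add: algebra_simps)
  then show ?thesis using DERIV_shift[of "\<lambda>t. f (x + t *\<^sub>R h)" _ 0 t] by simp
qed

lemma line_diff_continuous: "line_diff h f f' \<Longrightarrow> continuous_on S (\<lambda>t. f (x + t *\<^sub>R h))"
  by (rule DERIV_continuous_on, rule has_field_derivative_at_within, rule line_diff_DERIV)

lemma line_diff_lipschitz:
  assumes "line_diff h f f'" "\<And>x. \<bar>f' x\<bar> \<le> K"
  shows "\<bar>f (x + t *\<^sub>R h) - f x\<bar> \<le> K * \<bar>t\<bar>"
  using field_differentiable_bound[of UNIV "\<lambda>t. f (x + t *\<^sub>R h)" "\<lambda>t. f' (x + t *\<^sub>R h)" K t 0]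
    line_diff_DERIV[OF assms(1)] assms(2) by simp

lemma line_diff_const: "line_diff h (\<lambda>x. c) (\<lambda>x. 0)"
  unfolding line_diff_def by (auto intro: exI[of _ "\<bar>c\<bar>"])

lemma line_diff_add:
  assumes "line_diff h f f'" "line_diff h g g'"
  shows "line_diff h (\<lambda>x. f x + g x) (\<lambda>x. f' x + g' x)"
proof -
  obtain K where K: "0 < K" "\<And>x. \<bar>f x\<bar> \<le> K" "\<And>x. \<bar>f' x\<bar> \<le> K"
    using line_diff_bound[OF assms(1)] by blast
  obtain L where L: "0 < L" "\<And>x. \<bar>g x\<bar> \<le> L" "\<And>x. \<bar>g' x\<bar> \<le> L"
    using line_diff_bound[OF assms(2)] by blast
  have "\<bar>f x + g x\<bar> \<le> K + L" "\<bar>f' x + g' x\<bar> \<le> K + L" for x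
    using K(2,3)[of x] L(2,3)[of x] by linarith+
  then show ?thesis
    using assms unfolding line_diff_def by (auto intro!: exI[of _ "K + L"] DERIV_add)
qed

lemma line_diff_mult:
  assumes "line_diff h f f'" "line_diff h g g'"
  shows "line_diff h (\<lambda>x. f x * g x) (\<lambda>x. f' x * g x + g' x * f x)"
proof -
  obtain K where K: "0 < K" "\<And>x. \<bar>f x\<bar> \<le> K" "\<And>x. \<bar>f' x\<bar> \<le> K"
    using line_diff_bound[OF assms(1)] by blast
  obtain L where L: "0 < L" "\<And>x. \<bar>g x\<bar> \<le> L" "\<And>x. \<bar>g' x\<bar> \<le> L"
    using line_diff_bound[OF assms(2)] by blast
  have "\<bar>f x * g x\<bar> \<le> K * L" "\<bar>f' x * g x\<bar> \<le> K * L" "\<bar>g' x * f x\<bar> \<le> L * K" for x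
    unfolding abs_mult using K(1) L(1) by (intro mult_mono K L; simp)+
  note bounds = this
  have "0 \<le> L * K" using K(1) L(1) by simp
  then have b1: "\<bar>f x * g x\<bar> \<le> K * L + L * K" for x
    using bounds(1)[of x] by linarith
  have b2: "\<bar>f' x * g x + g' x * f x\<bar> \<le> K * L + L * K" for x
    by (rule order_trans[OF abs_triangle_ineq add_mono[OF bounds(2,3)]])
  have "((\<lambda>t. f (x + t *\<^sub>R h) * g (x + t *\<^sub>R h)) has_real_derivative f' x * g x + g' x * f x) (at 0)" for x
    using DERIV_mult[of "\<lambda>t. f (x + t *\<^sub>R h)" "f' x" 0 UNIV "\<lambda>t. g (x + t *\<^sub>R h)" "g' x"] assms
    unfolding line_diff_def by simp
  then show ?thesis
    using assms b1 b2 unfolding line_diff_def by (auto intro!: exI[of _ "K * L + L * K"])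
qed

lemma line_diff_compose:
  assumes f: "line_diff h f f'" and k: "\<And>x. (k has_real_derivative k' (f x)) (at (f x))"
    and m: "(\<lambda>x. k (f x)) \<in> borel_measurable borel" "(\<lambda>x. k' (f x)) \<in> borel_measurable borel"
    and B: "\<And>x. \<bar>k (f x)\<bar> \<le> B" "\<And>x. \<bar>k' (f x)\<bar> \<le> B"
  shows "line_diff h (\<lambda>x. k (f x)) (\<lambda>x. k' (f x) * f' x)"
proof -
  obtain K where K: "0 < K" "\<And>x. \<bar>f x\<bar> \<le> K" "\<And>x. \<bar>f' x\<bar> \<le> K"
    using line_diff_bound[OF f] by blast
  have B0: "0 \<le> B" using B(1)[of undefined] by simp
  have "\<bar>k (f x)\<bar> \<le> B + B * K" "\<bar>k' (f x) * f' x\<bar> \<le> B + B * K" for x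
  proof -
    have "0 \<le> B * K" using B0 K by simp
    then show "\<bar>k (f x)\<bar> \<le> B + B * K" using B(1)[of x] by simp
    have "\<bar>k' (f x) * f' x\<bar> \<le> B * K"
      unfolding abs_mult using B0 by (intro mult_mono B K) auto
    then show "\<bar>k' (f x) * f' x\<bar> \<le> B + B * K" using B0 by simp
  qed
  moreover have "((\<lambda>t. k (f (x + t *\<^sub>R h))) has_real_derivative k' (f x) * f' x) (at 0)" for x
    using DERIV_chain2[of k "k' (f x)" "\<lambda>t. f (x + t *\<^sub>R h)" 0 "f' x" UNIV] k f
    unfolding line_diff_def by simp
  ultimately show ?thesis
    using m f unfolding line_diff_def by (auto intro!: exI[of _ "B + B * K"])
qed

lemma smooth_step_measurable [measurable]:
  "smooth_step \<in> borel_measurable borel" "smooth_step' \<in> borel_measurable borel"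
proof -
  have "continuous_on UNIV smooth_step"
    by (meson DERIV_isCont continuous_at_imp_continuous_on smooth_step_DERIV)
  then show "smooth_step \<in> borel_measurable borel" "smooth_step' \<in> borel_measurable borel"
    using smooth_step'_continuous by (auto intro: borel_measurable_continuous_onI)
qed

lemma line_diff_smooth_step:
  assumes "line_diff h f f'"
  shows "line_diff h (\<lambda>x. smooth_step (f x)) (\<lambda>x. smooth_step' (f x) * f' x)"
proof (rule line_diff_compose[OF assms smooth_step_DERIV])
  note [measurable] = line_diff_measurable[OF assms]
  show "(\<lambda>x. smooth_step (f x)) \<in> borel_measurable borel" "(\<lambda>x. smooth_step' (f x)) \<in> borel_measurable borel"
    by measurable
  show "\<bar>smooth_step (f x)\<bar> \<le> 2" "\<bar>smooth_step' (f x)\<bar> \<le> 2" for x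
    using smooth_step_bounds[of "f x"] smooth_step'_bounds[of "f x"] by auto
qed

lemma line_diff_inverse:
  assumes f: "line_diff h f f'" and e: "0 < e" "\<And>x. e \<le> f x"
  shows "line_diff h (\<lambda>x. inverse (f x)) (\<lambda>x. - (inverse (f x))\<^sup>2 * f' x)"
proof (rule line_diff_compose[OF f, of inverse "\<lambda>s. - (inverse s)\<^sup>2" "inverse e + (inverse e)\<^sup>2"])
  note [measurable] = line_diff_measurable[OF f]
  show "(\<lambda>x. inverse (f x)) \<in> borel_measurable borel" "(\<lambda>x. - (inverse (f x))\<^sup>2) \<in> borel_measurable borel"
    by measurable
  fix x
  have fx: "0 < f x" using e(1) e(2)[of x] by linarith
  show "(inverse has_real_derivative - (inverse (f x))\<^sup>2) (at (f x))"
    using DERIV_inverse[of "f x" UNIV] fx by (simp add: numeral_2_eq_2)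
  have i: "0 < inverse (f x)" "inverse (f x) \<le> inverse e"
    using fx e by (auto intro: le_imp_inverse_le)
  have "(inverse (f x))\<^sup>2 \<le> (inverse e)\<^sup>2" using i by (intro power_mono) auto
  then show "\<bar>inverse (f x)\<bar> \<le> inverse e + (inverse e)\<^sup>2" "\<bar>- (inverse (f x))\<^sup>2\<bar> \<le> inverse e + (inverse e)\<^sup>2"
    using i e by (auto simp: add_increasing add_increasing2)
qed

lemma line_diff_C1b:
  assumes "C1b f"
  shows "line_diff h f (\<lambda>x. grad f x \<bullet> h)"
  unfolding line_diff_def
proof (intro conjI allI)
  obtain K where K: "0 < K" "\<And>x. \<bar>f x\<bar> \<le> K" "\<And>x. norm (grad f x) \<le> K"
    using C1b_bound[OF assms] by blast
  show "f \<in> borel_measurable borel" by (rule C1b_measurable[OF assms])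
  have "continuous_on UNIV (\<lambda>x. grad f x \<bullet> h)"
    by (intro continuous_intros C1bD[OF assms])
  then show "(\<lambda>x. grad f x \<bullet> h) \<in> borel_measurable borel"
    by (rule borel_measurable_continuous_onI)
  have "\<bar>grad f x \<bullet> h\<bar> \<le> K * norm h" for x
    by (rule order_trans[OF Cauchy_Schwarz_ineq2]) (intro mult_right_mono K norm_ge_zero)
  then have "\<bar>f x\<bar> \<le> K + K * norm h \<and> \<bar>grad f x \<bullet> h\<bar> \<le> K + K * norm h" for x
    using K(1) K(2)[of x] mult_nonneg_nonneg[of K "norm h"] by (auto intro: add_increasing2 add_increasing)
  then show "\<exists>K. \<forall>x. \<bar>f x\<bar> \<le> K \<and> \<bar>grad f x \<bullet> h\<bar> \<le> K" by blast
  fix x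
  have "((\<lambda>t. x + t *\<^sub>R h) has_derivative (\<lambda>t. t *\<^sub>R h)) (at 0)"
    by (auto intro!: derivative_eq_intros)
  moreover have "(f has_derivative (\<lambda>k. grad f x \<bullet> k)) (at (x + 0 *\<^sub>R h))"
    using C1bD(2)[OF assms] by simp
  ultimately have "((\<lambda>t. f (x + t *\<^sub>R h)) has_derivative (\<lambda>t. grad f x \<bullet> (t *\<^sub>R h))) (at 0)"
    by (rule has_derivative_compose)
  then show "((\<lambda>t. f (x + t *\<^sub>R h)) has_real_derivative grad f x \<bullet> h) (at 0)"
    unfolding has_field_derivative_def by (simp add: mult.commute[of _ "grad f x \<bullet> h"])
qed

text \<open>Such an \<open>E\<close> is a union of lines parallel to \<open>h\<close>. Its indicator
  is constant on each line, though possibly discontinuous across them.\<close>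

lemma line_diff_invariant_indicator:
  assumes "E \<in> sets borel" "\<And>x t. x + t *\<^sub>R h \<in> E \<longleftrightarrow> x \<in> E"
  shows "line_diff h (indicator E) (\<lambda>x. 0)"
proof -
  have "(\<lambda>t. indicator E (x + t *\<^sub>R h)) = (\<lambda>t. indicator E x :: real)" for x
    using assms(2) by (auto simp: indicator_def)
  then show ?thesis
    using assms(1) unfolding line_diff_def by (auto intro!: exI[of _ 1])
qed

text \<open>Identically zero for \<open>h = 0\<close>, because \<open>inverse 0 = 0\<close>.\<close>
definition coord :: "'a::real_inner \<Rightarrow> 'a \<Rightarrow> real" where
  "coord h x = (x \<bullet> h) * inverse (h \<bullet> h)"

lemma coord_line: "coord h (x + t *\<^sub>R h) = coord h x + t * coord h h"
  by (simp add: coord_def inner_add_left algebra_simps)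

lemma coord_self: "coord h h = (if h = 0 then 0 else 1)"
  by (simp add: coord_def)

lemma coord_measurable [measurable]:
  "coord (h :: 'a::{real_inner, second_countable_topology}) \<in> borel_measurable borel"
  unfolding coord_def[abs_def] by measurable

lemma line_diff_step_coord:
  "line_diff h (\<lambda>x. smooth_step (a + b * coord h x)) (\<lambda>x. smooth_step' (a + b * coord h x) * (b * coord h h))"
  unfolding line_diff_def
proof (intro conjI allI)
  show "(\<lambda>x. smooth_step (a + b * coord h x)) \<in> borel_measurable borel"
    "(\<lambda>x. smooth_step' (a + b * coord h x) * (b * coord h h)) \<in> borel_measurable borel"
    by measurable
  have "\<bar>smooth_step s\<bar> \<le> 1 + 2 * \<bar>b\<bar> \<and> \<bar>smooth_step' s * (b * coord h h)\<bar> \<le> 1 + 2 * \<bar>b\<bar>" for s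
  proof -
    have "\<bar>smooth_step' s\<bar> * \<bar>b\<bar> \<le> 2 * \<bar>b\<bar>"
      using smooth_step'_bounds[of s] by (intro mult_right_mono) auto
    then show ?thesis
      using smooth_step_bounds[of s] by (auto simp: abs_mult coord_self)
  qed
  then show "\<exists>K. \<forall>x. \<bar>smooth_step (a + b * coord h x)\<bar> \<le> K \<and> \<bar>smooth_step' (a + b * coord h x) * (b * coord h h)\<bar> \<le> K"
    by blast
  fix x
  have "((\<lambda>t. a + b * coord h (x + t *\<^sub>R h)) has_real_derivative b * coord h h) (at 0)"
    unfolding coord_line by (auto intro!: derivative_eq_intros)
  moreover have "(smooth_step has_real_derivative smooth_step' (a + b * coord h x))
      (at (a + b * coord h (x + 0 *\<^sub>R h)))"
    using smooth_step_DERIV[of "a + b * coord h x"] by simp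
  ultimately show "((\<lambda>t. smooth_step (a + b * coord h (x + t *\<^sub>R h))) has_real_derivative
      smooth_step' (a + b * coord h x) * (b * coord h h)) (at 0)"
    by (rule DERIV_chain2[rotated])
qed

lemma smooth_step'_1: "1 \<le> s \<Longrightarrow> smooth_step' s = 0"
  by (simp add: smooth_step'_def)

text \<open>Equal to 1 for \<open>\<bar>coord h x\<bar> \<le> T\<close> and to 0 from
  \<open>T + 1\<close> on. The transition has length 1 for every \<open>T\<close>, so the derivative
  is bounded by 4 uniformly in \<open>T\<close>. The factors \<open>-1\<close> and \<open>1\<close>
  match the pattern of \<open>line_diff_step_coord\<close>.\<close>

definition line_cutoff :: "'a::real_inner \<Rightarrow> nat \<Rightarrow> 'a \<Rightarrow> real" where
  "line_cutoff h T x = smooth_step (real T + 1 + -1 * coord h x) * smooth_step (real T + 1 + 1 * coord h x)"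

definition line_cutoff' :: "'a::real_inner \<Rightarrow> nat \<Rightarrow> 'a \<Rightarrow> real" where
  "line_cutoff' h T x =
     smooth_step' (real T + 1 + -1 * coord h x) * (-1 * coord h h) * smooth_step (real T + 1 + 1 * coord h x)
     + smooth_step' (real T + 1 + 1 * coord h x) * (1 * coord h h) * smooth_step (real T + 1 + -1 * coord h x)"

lemma line_cutoff_diff: "line_diff h (line_cutoff h T) (line_cutoff' h T)"
  unfolding line_cutoff_def[abs_def] line_cutoff'_def[abs_def]
  by (intro line_diff_mult line_diff_step_coord)

lemma line_cutoff_bounds: "0 \<le> line_cutoff h T x" "line_cutoff h T x \<le> 1"
  unfolding line_cutoff_def by (auto simp: smooth_step_bounds intro!: mult_le_one)

lemma line_cutoff'_bound: "\<bar>line_cutoff' h T x\<bar> \<le> 4"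
proof -
  have "\<bar>smooth_step' s * c * smooth_step r\<bar> \<le> 2 * 1 * 1" if "\<bar>c\<bar> \<le> 1" for s c r
    unfolding abs_mult using that smooth_step_bounds[of r] smooth_step'_bounds[of s]
    by (intro mult_mono) auto
  then have "\<bar>line_cutoff' h T x\<bar> \<le> 2 * 1 * 1 + 2 * 1 * 1"
    unfolding line_cutoff'_def by (intro order_trans[OF abs_triangle_ineq] add_mono) (auto simp: coord_self)
  then show ?thesis by simp
qed

lemma line_cutoff_0: "\<bar>coord h x\<bar> \<ge> real T + 1 \<Longrightarrow> line_cutoff h T x = 0"
  unfolding line_cutoff_def by (cases "coord h x \<ge> 0") (auto simp: smooth_step_0)

lemma line_cutoff_1:
  assumes "\<bar>coord h x\<bar> \<le> real T"
  shows "line_cutoff h T x = 1" "line_cutoff' h T x = 0"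
  using assms unfolding line_cutoff_def line_cutoff'_def
  by (auto simp: smooth_step_1 smooth_step'_1 abs_le_iff)

text \<open>The mean value theorem bounds the difference quotients along \<open>h\<close> by
  \<open>K\<close>, so \<open>K * \<bar>u x\<bar>\<close> dominates. Only \<open>f\<close> is
  translated, never the measure, hence no quasi-invariance of \<open>nu\<close> is involved.\<close>

lemma DERIV_integral_translate:
  fixes nu :: "'a::{real_inner, second_countable_topology} measure"
  assumes sets: "sets nu = sets borel" and u: "integrable nu u" and f: "line_diff h f f'"
  shows "((\<lambda>t. \<integral>x. u x * f (x + t *\<^sub>R h) \<partial>nu) has_real_derivative (\<integral>x. u x * f' (x + t *\<^sub>R h) \<partial>nu)) (at t)"
proof -
  note [measurable] = line_diff_measurable[OF f]
  have m: "g \<in> borel_measurable nu" if "g \<in> borel_measurable borel" for g :: "'a \<Rightarrow> real"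
    using that measurable_cong_sets[OF sets refl] by blast
  have um: "u \<in> borel_measurable nu" using u by simp
  obtain K where K: "0 < K" "\<And>x. \<bar>f x\<bar> \<le> K" "\<And>x. \<bar>f' x\<bar> \<le> K"
    using line_diff_bound[OF f] by blast
  have int: "integrable nu (\<lambda>x. u x * f (x + s *\<^sub>R h))" for s
  proof (rule Bochner_Integration.integrable_bound[of _ "\<lambda>x. K * u x"])
    show "AE x in nu. norm (u x * f (x + s *\<^sub>R h)) \<le> norm (K * u x)"
      using K by (intro AE_I2) (simp add: abs_mult mult.commute[of K] mult_left_mono)
    have "(\<lambda>x. f (x + s *\<^sub>R h)) \<in> borel_measurable nu" by (rule m) measurable
    then show "(\<lambda>x. u x * f (x + s *\<^sub>R h)) \<in> borel_measurable nu" using um by (rule borel_measurable_times[rotated])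
  qed (use u in simp)
  let ?q = "\<lambda>s x. (f (x + t *\<^sub>R h + s *\<^sub>R h) - f (x + t *\<^sub>R h)) / s"
  have lim: "(\<lambda>n. \<integral>x. u x * ?q (S n) x \<partial>nu) \<longlonglongrightarrow> (\<integral>x. u x * f' (x + t *\<^sub>R h) \<partial>nu)"
    if S: "\<And>n. S n \<noteq> 0" "S \<longlonglongrightarrow> 0" for S
  proof (rule integral_dominated_convergence[where w = "\<lambda>x. K * \<bar>u x\<bar>"])
    have "(\<lambda>x. f' (x + t *\<^sub>R h)) \<in> borel_measurable nu" by (rule m) measurable
    then show "(\<lambda>x. u x * f' (x + t *\<^sub>R h)) \<in> borel_measurable nu" using um by (rule borel_measurable_times[rotated])
    show "integrable nu (\<lambda>x. K * \<bar>u x\<bar>)" using u by simp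
    fix n
    have "?q (S n) \<in> borel_measurable nu" by (rule m) measurable
    then show "(\<lambda>x. u x * ?q (S n) x) \<in> borel_measurable nu" using um by (rule borel_measurable_times[rotated])
    have "\<bar>?q (S n) x\<bar> \<le> K" for x
      using line_diff_lipschitz[OF f K(3), of "x + t *\<^sub>R h" "S n"] S(1)[of n]
      by (simp add: abs_divide pos_divide_le_eq)
    then show "AE x in nu. norm (u x * ?q (S n) x) \<le> K * \<bar>u x\<bar>"
      by (intro AE_I2) (simp only: real_norm_def abs_mult mult.commute[of K] mult_left_mono abs_ge_zero)
  next
    have "(\<lambda>n. ?q (S n) x) \<longlonglongrightarrow> f' (x + t *\<^sub>R h)" for x
    proof -
      have "((\<lambda>s. ?q s x) \<longlongrightarrow> f' (x + t *\<^sub>R h)) (at 0)"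
        using f unfolding line_diff_def DERIV_def by simp
      then show ?thesis using S unfolding tendsto_at_iff_sequentially by (auto simp: o_def)
    qed
    then show "AE x in nu. (\<lambda>n. u x * ?q (S n) x) \<longlonglongrightarrow> u x * f' (x + t *\<^sub>R h)"
      by (intro AE_I2 tendsto_mult_left)
  qed
  have eq: "((\<integral>x. u x * f (x + (t + s) *\<^sub>R h) \<partial>nu) - (\<integral>x. u x * f (x + t *\<^sub>R h) \<partial>nu)) / s = (\<integral>x. u x * ?q s x \<partial>nu)" for s
  proof -
    have "(\<integral>x. u x * ?q s x \<partial>nu) = (\<integral>x. (u x * f (x + (t + s) *\<^sub>R h) - u x * f (x + t *\<^sub>R h)) / s \<partial>nu)"
      by (simp add: algebra_simps diff_divide_distrib)
    also have "\<dots> = (\<integral>x. u x * f (x + (t + s) *\<^sub>R h) - u x * f (x + t *\<^sub>R h) \<partial>nu) / s"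
      by (rule integral_divide_zero)
    finally show ?thesis unfolding Bochner_Integration.integral_diff[OF int int] by (rule sym)
  qed
  show ?thesis
    unfolding DERIV_def eq tendsto_at_iff_sequentially using lim by (auto simp: o_def)
qed

section \<open>Functionals given by a directional derivative\<close>

lemma integrable_mult_bounded:
  fixes u f :: "'a \<Rightarrow> real"
  assumes "integrable M u" "f \<in> borel_measurable M" "\<And>x. \<bar>f x\<bar> \<le> K"
  shows "integrable M (\<lambda>x. u x * f x)"
proof (rule Bochner_Integration.integrable_bound[of _ "\<lambda>x. \<bar>u x\<bar> * K"])
  show "integrable M (\<lambda>x. \<bar>u x\<bar> * K)" using assms(1) by simp
  show "(\<lambda>x. u x * f x) \<in> borel_measurable M" using assms(1,2) by simp
  have "\<bar>f x\<bar> \<le> \<bar>K\<bar>" for x using assms(3)[of x] by linarith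
  then show "AE x in M. norm (u x * f x) \<le> norm (\<bar>u x\<bar> * K)"
    by (intro AE_I2) (simp add: abs_mult mult_left_mono)
qed

lemma integral_mult_bounded_le:
  fixes u f :: "'a \<Rightarrow> real"
  assumes "integrable M u" "f \<in> borel_measurable M" "\<And>x. \<bar>f x\<bar> \<le> K"
  shows "\<bar>\<integral>x. u x * f x \<partial>M\<bar> \<le> K * (\<integral>x. \<bar>u x\<bar> \<partial>M)"
proof -
  have "\<bar>\<integral>x. u x * f x \<partial>M\<bar> \<le> (\<integral>x. \<bar>u x * f x\<bar> \<partial>M)"
    by (rule integral_abs_bound)
  also have "\<dots> \<le> (\<integral>x. K * \<bar>u x\<bar> \<partial>M)"
  proof (rule integral_mono)
    show "integrable M (\<lambda>x. \<bar>u x * f x\<bar>)"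
      using integrable_mult_bounded[OF assms] by (rule integrable_abs)
    show "integrable M (\<lambda>x. K * \<bar>u x\<bar>)" using assms(1) by simp
    show "\<bar>u x * f x\<bar> \<le> K * \<bar>u x\<bar>" for x
      using assms(3)[of x] by (simp add: abs_mult mult.commute mult_right_mono)
  qed
  finally show ?thesis by simp
qed

text \<open>To be used with \<open>h\<close> the adjoint image of \<open>z\<close> and
  \<open>w\<close> the product of \<open>u\<close> and \<open>v z\<close>; \<open>C\<close> comes
  from the finite variation.\<close>

locale line_functional =
  fixes nu :: "'a::{real_inner, second_countable_topology} measure" and h :: 'a and u w :: "'a \<Rightarrow> real" and C :: real
  assumes sets_nu: "sets nu = sets borel"
    and u_int: "integrable nu u" and w_int: "integrable nu w"
    and bound_C1b: "\<And>f. C1b f \<Longrightarrow> (\<And>x. 0 \<le> f x) \<Longrightarrow> (\<And>x. f x \<le> 1) \<Longrightarrow>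
        \<bar>\<integral>x. w x * f x - u x * (grad f x \<bullet> h) \<partial>nu\<bar> \<le> C"
begin

definition F :: "('a \<Rightarrow> real) set" where
  "F = {f. \<exists>f'. line_diff h f f'}"

definition L :: "('a \<Rightarrow> real) \<Rightarrow> real" where
  "L f = (\<integral>x. w x * f x - u x * dline h f x \<partial>nu)"

lemma measurable_nu: "f \<in> borel_measurable borel \<Longrightarrow> f \<in> borel_measurable nu"
  using measurable_cong_sets[OF sets_nu refl] by blast

lemma integrable_line:
  assumes "line_diff h f f'"
  shows "integrable nu (\<lambda>x. w x * f x)" "integrable nu (\<lambda>x. u x * f' x)"
proof -
  obtain K where K: "0 < K" "\<And>x. \<bar>f x\<bar> \<le> K" "\<And>x. \<bar>f' x\<bar> \<le> K"
    using line_diff_bound[OF assms] by blast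
  show "integrable nu (\<lambda>x. w x * f x)" "integrable nu (\<lambda>x. u x * f' x)"
    by (rule integrable_mult_bounded[OF w_int measurable_nu[OF line_diff_measurable(1)[OF assms]] K(2)],
        rule integrable_mult_bounded[OF u_int measurable_nu[OF line_diff_measurable(2)[OF assms]] K(3)])
qed

lemma L_eq:
  assumes "line_diff h f f'"
  shows "L f = (\<integral>x. w x * f x \<partial>nu) - (\<integral>x. u x * f' x \<partial>nu)"
  unfolding L_def line_diff_dline[OF assms]
  by (rule Bochner_Integration.integral_diff[OF integrable_line[OF assms]])

text \<open>A bound for the derivative term alone: the bound on the whole functional plus the L1
  norm of \<open>w\<close> for the zero-order term.\<close>

definition C' :: real where "C' = C + (\<integral>x. \<bar>w x\<bar> \<partial>nu)"

lemma C'_nonneg: "0 \<le> C'"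
proof -
  have "0 \<le> C" using bound_C1b[OF C1b_const[of 0]] by (simp add: order_trans[OF abs_ge_zero])
  then show ?thesis unfolding C'_def by simp
qed

lemma deriv_C1b:
  assumes "C1b f" "\<And>x. 0 \<le> f x" "\<And>x. f x \<le> 1"
  shows "\<bar>\<integral>x. u x * (grad f x \<bullet> h) \<partial>nu\<bar> \<le> C'"
proof -
  note ld = line_diff_C1b[OF assms(1), of h]
  have "(\<integral>x. w x * f x - u x * (grad f x \<bullet> h) \<partial>nu) = (\<integral>x. w x * f x \<partial>nu) - (\<integral>x. u x * (grad f x \<bullet> h) \<partial>nu)"
    by (rule Bochner_Integration.integral_diff[OF integrable_line[OF ld]])
  moreover have "\<bar>\<integral>x. w x * f x \<partial>nu\<bar> \<le> 1 * (\<integral>x. \<bar>w x\<bar> \<partial>nu)"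
    using assms by (intro integral_mult_bounded_le w_int measurable_nu C1b_measurable) (auto simp: abs_of_nonneg)
  ultimately show ?thesis using bound_C1b[OF assms] unfolding C'_def by linarith
qed

text \<open>Translates of \<open>f\<close> are again of class \<open>C1b\<close> with values in
  [0,1], so \<open>deriv_C1b\<close> bounds the derivative at every \<open>t\<close> by the same
  constant.\<close>

lemma translate_C1b:
  assumes "C1b f" "\<And>x. 0 \<le> f x" "\<And>x. f x \<le> 1"
  shows "\<bar>(\<integral>x. u x * f (x + t *\<^sub>R h) \<partial>nu) - (\<integral>x. u x * f x \<partial>nu)\<bar> \<le> C' * \<bar>t\<bar>"
proof -
  let ?G = "\<lambda>t. \<integral>x. u x * f (x + t *\<^sub>R h) \<partial>nu" and ?G' = "\<lambda>t. \<integral>x. u x * (grad f (x + t *\<^sub>R h) \<bullet> h) \<partial>nu"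
  have "(?G has_real_derivative ?G' t) (at t)" for t
    by (rule DERIV_integral_translate[OF sets_nu u_int line_diff_C1b[OF assms(1)]])
  moreover have "norm (?G' t) \<le> C'" for t
    using deriv_C1b[OF C1b_shift(1)[OF assms(1), of "t *\<^sub>R h"]] assms(2,3)
    by (simp add: C1b_shift(2)[OF assms(1)])
  ultimately have "norm (?G t - ?G 0) \<le> C' * norm (t - 0)"
    by (intro field_differentiable_bound[of UNIV ?G ?G']) auto
  then show ?thesis by simp
qed

text \<open>Derivatives do not survive L1 approximation, but the Lipschitz estimate does, since it
  mentions only values of the function. This is how the bound leaves the smooth class.\<close>

lemma translate_indicator:
  assumes A: "A \<in> sets borel"
  shows "\<bar>(\<integral>x. u x * indicator A (x + t *\<^sub>R h) \<partial>nu) - (\<integral>x. u x * indicator A x \<partial>nu)\<bar> \<le> C' * \<bar>t\<bar>"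
proof (rule field_le_epsilon)
  fix e :: real assume "0 < e"
  then have e: "0 < e / 2" by simp
  define M1 where "M1 = density nu (\<lambda>x. ennreal \<bar>u x\<bar>)"
  \<comment> \<open>The image measure controls the approximation error at the shifted point
    \<open>x + t *\<^sub>R h\<close>; one \<open>f\<close> must be close to the indicator at both
    positions.\<close>
  define M2 where "M2 = distr M1 borel (\<lambda>x. x + t *\<^sub>R h)"
  have um [measurable]: "u \<in> borel_measurable nu" using u_int by simp
  have sM1: "sets M1 = sets borel" by (simp add: M1_def sets_nu)
  have "emeasure M1 (space M1) = (\<integral>\<^sup>+x. ennreal \<bar>u x\<bar> \<partial>nu)"
    unfolding M1_def by (simp add: emeasure_density)
  also have "\<dots> < \<infinity>" using u_int by (simp add: integrable_iff_bounded)
  finally have fM1: "finite_measure M1" by (intro finite_measureI) simp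
  have sh: "(\<lambda>x. x + t *\<^sub>R h) \<in> measurable M1 borel"
    unfolding measurable_cong_sets[OF sM1 refl] by measurable
  have fM2: "finite_measure M2"
    unfolding M2_def by (rule finite_measure.finite_measure_distr[OF fM1 sh])
  have sM2: "sets M2 = sets borel" by (simp add: M2_def)
  interpret finite_borel_measures "{M1, M2}"
  proof (rule finite_borel_measures.intro)
    show "finite {M1, M2}" by simp
  qed (use fM1 fM2 sM1 sM2 in blast)+
  obtain f where f: "C1b f" "\<And>x. 0 \<le> f x" "\<And>x. f x \<le> 1"
    "\<And>M. M \<in> {M1, M2} \<Longrightarrow> (\<integral>x. \<bar>f x - indicator A x\<bar> \<partial>M) < e / 2"
    using approx_indicator[OF A e] by blast
  note [measurable] = C1b_measurable[OF f(1)] A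
  have close: "\<bar>(\<integral>x. u x * f (g x) \<partial>nu) - (\<integral>x. u x * indicator A (g x) \<partial>nu)\<bar> \<le> e / 2"
    if g: "g \<in> measurable borel borel" and ge: "(\<integral>x. \<bar>f (g x) - indicator A (g x)\<bar> \<partial>M1) < e / 2" for g :: "'a \<Rightarrow> 'a"
  proof -
    note [measurable] = g
    have m1: "(\<lambda>x. f (g x)) \<in> borel_measurable nu" "(\<lambda>x. indicator A (g x) :: real) \<in> borel_measurable nu"
      "(\<lambda>x. \<bar>f (g x) - indicator A (g x)\<bar>) \<in> borel_measurable nu"
      by (rule measurable_nu, measurable)+
    have i1: "integrable nu (\<lambda>x. u x * f (g x))"
      by (rule integrable_mult_bounded[OF u_int m1(1), of 1]) (simp add: f abs_of_nonneg)
    have i2: "integrable nu (\<lambda>x. u x * indicator A (g x))"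
      by (rule integrable_mult_bounded[OF u_int m1(2), of 1]) (simp add: indicator_def)
    have "(\<integral>x. u x * f (g x) \<partial>nu) - (\<integral>x. u x * indicator A (g x) \<partial>nu)
        = (\<integral>x. u x * f (g x) - u x * indicator A (g x) \<partial>nu)"
      by (rule Bochner_Integration.integral_diff[symmetric, OF i1 i2])
    also have "\<bar>\<dots>\<bar> \<le> (\<integral>x. \<bar>u x * f (g x) - u x * indicator A (g x)\<bar> \<partial>nu)"
      by (rule integral_abs_bound)
    also have "\<dots> = (\<integral>x. \<bar>u x\<bar> *\<^sub>R \<bar>f (g x) - indicator A (g x)\<bar> \<partial>nu)"
      by (simp add: abs_mult flip: right_diff_distrib)
    also have "\<dots> = (\<integral>x. \<bar>f (g x) - indicator A (g x)\<bar> \<partial>M1)"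
      unfolding M1_def using m1(3) by (intro integral_density[symmetric]) auto
    finally show ?thesis using ge by linarith
  qed
  have "(\<integral>x. \<bar>f x - indicator A x\<bar> \<partial>M2) = (\<integral>x. \<bar>f (x + t *\<^sub>R h) - indicator A (x + t *\<^sub>R h)\<bar> \<partial>M1)"
    unfolding M2_def using sh by (rule integral_distr) measurable
  then have "\<bar>(\<integral>x. u x * f (x + t *\<^sub>R h) \<partial>nu) - (\<integral>x. u x * indicator A (x + t *\<^sub>R h) \<partial>nu)\<bar> \<le> e / 2"
    using f(4)[of M2] by (intro close) auto
  moreover have "\<bar>(\<integral>x. u x * f x \<partial>nu) - (\<integral>x. u x * indicator A x \<partial>nu)\<bar> \<le> e / 2"
    using f(4)[of M1] by (intro close) auto
  moreover note translate_C1b[OF f(1-3), of t]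
  ultimately show "\<bar>(\<integral>x. u x * indicator A (x + t *\<^sub>R h) \<partial>nu) - (\<integral>x. u x * indicator A x \<partial>nu)\<bar> \<le> C' * \<bar>t\<bar> + e"
    by linarith
qed

lemma translate_bound:
  assumes f: "f \<in> borel_measurable borel" "\<And>x. 0 \<le> f x" "\<And>x. f x \<le> 1"
  shows "\<bar>(\<integral>x. u x * f (x + t *\<^sub>R h) \<partial>nu) - (\<integral>x. u x * f x \<partial>nu)\<bar> \<le> C' * \<bar>t\<bar>"
proof -
  note [measurable] = f(1)
  let ?A = "\<lambda>n j. {x. real j \<le> real n * f x}"
  let ?S = "\<lambda>n g. (\<Sum>j=1..n. \<integral>x. u x * indicator (?A n j) (g x) \<partial>nu) / real n"
  have m: "f \<in> borel_measurable nu" "(\<lambda>x. f (x + t *\<^sub>R h)) \<in> borel_measurable nu"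
    by (rule measurable_nu, measurable)+
  have "(\<lambda>n. ?S n (\<lambda>x. x)) \<longlonglongrightarrow> (\<integral>x. u x * f x \<partial>nu)"
    using integral_layer_limit[OF u_int m(1) f(2,3)] by simp
  moreover have "(\<lambda>n. ?S n (\<lambda>x. x + t *\<^sub>R h)) \<longlonglongrightarrow> (\<integral>x. u x * f (x + t *\<^sub>R h) \<partial>nu)"
    using integral_layer_limit[OF u_int m(2) f(2,3)] by (simp add: indicator_def)
  ultimately have "(\<lambda>n. \<bar>?S n (\<lambda>x. x + t *\<^sub>R h) - ?S n (\<lambda>x. x)\<bar>) \<longlonglongrightarrow>
      \<bar>(\<integral>x. u x * f (x + t *\<^sub>R h) \<partial>nu) - (\<integral>x. u x * f x \<partial>nu)\<bar>"
    by (intro tendsto_rabs tendsto_diff)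
  moreover have "\<bar>?S n (\<lambda>x. x + t *\<^sub>R h) - ?S n (\<lambda>x. x)\<bar> \<le> C' * \<bar>t\<bar>" if n: "n \<ge> 1" for n
  proof -
    have "?S n (\<lambda>x. x + t *\<^sub>R h) - ?S n (\<lambda>x. x) =
       (\<Sum>j=1..n. (\<integral>x. u x * indicator (?A n j) (x + t *\<^sub>R h) \<partial>nu) - (\<integral>x. u x * indicator (?A n j) x \<partial>nu)) / real n"
      by (simp only: sum_subtractf diff_divide_distrib)
    also have "\<bar>\<dots>\<bar> \<le> (\<Sum>j=1..n. C' * \<bar>t\<bar>) / real n"
    proof -
      have "?A n j \<in> sets borel" for j by measurable
      then show ?thesis
        unfolding abs_divide abs_of_nat
        by (intro divide_right_mono order_trans[OF sum_abs] sum_mono translate_indicator) auto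
    qed
    also have "\<dots> = C' * \<bar>t\<bar>" using n by simp
    finally show ?thesis .
  qed
  ultimately show ?thesis by (intro LIMSEQ_le_const2) auto
qed

text \<open>The Lipschitz estimate for Borel functions is turned back into a derivative bound: the
  integral is the derivative at 0 of the integral over translates of \<open>f\<close>.\<close>

lemma deriv_bound:
  assumes f: "line_diff h f f'" "\<And>x. 0 \<le> f x" "\<And>x. f x \<le> 1"
  shows "\<bar>\<integral>x. u x * f' x \<partial>nu\<bar> \<le> C'"
proof -
  let ?G = "\<lambda>t. \<integral>x. u x * f (x + t *\<^sub>R h) \<partial>nu"
  have "((\<lambda>t. (?G t - ?G 0) / t) \<longlongrightarrow> (\<integral>x. u x * f' x \<partial>nu)) (at 0)"
    using DERIV_integral_translate[OF sets_nu u_int f(1), of 0] unfolding DERIV_def by simp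
  then have "((\<lambda>t. \<bar>(?G t - ?G 0) / t\<bar>) \<longlongrightarrow> \<bar>\<integral>x. u x * f' x \<partial>nu\<bar>) (at 0)"
    by (rule tendsto_rabs)
  moreover have "\<bar>(?G t - ?G 0) / t\<bar> \<le> C'" if "t \<noteq> 0" for t
    using translate_bound[OF line_diff_measurable(1)[OF f(1)] f(2,3), of t] that
    by (simp add: abs_divide pos_divide_le_eq)
  then have "\<forall>\<^sub>F t in at 0. \<bar>(?G t - ?G 0) / t\<bar> \<le> C'"
    by (simp add: eventually_at_filter)
  ultimately show ?thesis by (rule tendsto_upperbound) simp
qed

text \<open>The zero-order term is added back to \<open>C'\<close>; \<open>K\<close> bounds
  \<open>L\<close> on the large class.\<close>

definition K :: real where "K = C' + (\<integral>x. \<bar>w x\<bar> \<partial>nu)"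

lemma L_bound:
  assumes f: "f \<in> F" "\<And>x. 0 \<le> f x" "\<And>x. f x \<le> B" and B: "0 < B"
  shows "\<bar>L f\<bar> \<le> K * B"
proof -
  obtain f' where f': "line_diff h f f'" using f(1) by (auto simp: F_def)
  have "line_diff h (\<lambda>x. inverse B * f x) (\<lambda>x. 0 * f x + f' x * inverse B)"
    by (rule line_diff_mult[OF line_diff_const f'])
  then have "\<bar>\<integral>x. u x * (0 * f x + f' x * inverse B) \<partial>nu\<bar> \<le> C'"
    using f B by (intro deriv_bound) (auto simp: field_simps)
  moreover have "(\<integral>x. u x * (0 * f x + f' x * inverse B) \<partial>nu) = (\<integral>x. u x * f' x \<partial>nu) * inverse B"
    by (simp flip: mult.assoc)
  ultimately have "\<bar>\<integral>x. u x * f' x \<partial>nu\<bar> \<le> C' * B"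
    using B by (simp add: abs_mult field_simps)
  moreover have "\<bar>\<integral>x. w x * f x \<partial>nu\<bar> \<le> B * (\<integral>x. \<bar>w x\<bar> \<partial>nu)"
    using f by (intro integral_mult_bounded_le w_int measurable_nu line_diff_measurable(1)[OF f']) (auto simp: abs_of_nonneg)
  ultimately show ?thesis unfolding L_eq[OF f'] K_def by (simp add: algebra_simps)
qed

lemma F_measurable: "f \<in> F \<Longrightarrow> f \<in> borel_measurable borel"
  by (auto simp: F_def dest: line_diff_measurable)

lemma F_const: "(\<lambda>x. c) \<in> F"
  unfolding F_def using line_diff_const by blast

lemma F_add: "f \<in> F \<Longrightarrow> g \<in> F \<Longrightarrow> (\<lambda>x. f x + g x) \<in> F"
  unfolding F_def using line_diff_add by blast

lemma F_mult: "f \<in> F \<Longrightarrow> g \<in> F \<Longrightarrow> (\<lambda>x. f x * g x) \<in> F"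
  unfolding F_def using line_diff_mult by blast

lemma F_step: "f \<in> F \<Longrightarrow> (\<lambda>x. smooth_step (f x)) \<in> F"
  unfolding F_def using line_diff_smooth_step by blast

lemma F_C1b: "C1b f \<Longrightarrow> f \<in> F"
  unfolding F_def using line_diff_C1b by blast

lemma F_diff: "f \<in> F \<Longrightarrow> g \<in> F \<Longrightarrow> (\<lambda>x. f x - g x) \<in> F"
  using F_add[of f "\<lambda>x. -1 * g x"] F_mult[OF F_const[of "-1"], of g] by simp

lemma F_sum: "(\<And>i. i \<in> S \<Longrightarrow> f i \<in> F) \<Longrightarrow> (\<lambda>x. \<Sum>i\<in>S. f i x) \<in> F"
  by (induction S rule: infinite_finite_induct) (auto intro: F_const F_add)

lemma F_divide:
  assumes "f \<in> F" "g \<in> F" "0 < e" "\<And>x. e \<le> g x"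
  shows "(\<lambda>x. f x / g x) \<in> F"
proof -
  obtain g' where "line_diff h g g'" using assms(2) by (auto simp: F_def)
  from line_diff_inverse[OF this assms(3,4)] have "(\<lambda>x. inverse (g x)) \<in> F"
    by (auto simp: F_def)
  from F_mult[OF assms(1) this] show ?thesis by (simp add: divide_inverse)
qed

lemma L_add:
  assumes "f \<in> F" "g \<in> F"
  shows "L (\<lambda>x. f x + g x) = L f + L g"
proof -
  obtain f' g' where fg: "line_diff h f f'" "line_diff h g g'" using assms by (auto simp: F_def)
  show ?thesis
    unfolding L_eq[OF fg(1)] L_eq[OF fg(2)] L_eq[OF line_diff_add[OF fg]]
    using integrable_line[OF fg(1)] integrable_line[OF fg(2)] by (simp add: distrib_left)
qed

lemma L_cmult:
  assumes "f \<in> F"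
  shows "L (\<lambda>x. c * f x) = c * L f"
proof -
  obtain f' where f: "line_diff h f f'" using assms by (auto simp: F_def)
  have "(\<integral>x. w x * (c * f x) \<partial>nu) = (\<integral>x. c * (w x * f x) \<partial>nu)"
    "(\<integral>x. u x * (0 * f x + f' x * c) \<partial>nu) = (\<integral>x. c * (u x * f' x) \<partial>nu)"
    by (simp_all add: ac_simps)
  then show ?thesis
    unfolding L_eq[OF f] L_eq[OF line_diff_mult[OF line_diff_const f]]
    by (simp add: right_diff_distrib)
qed

lemma L_diff:
  assumes "f \<in> F" "g \<in> F"
  shows "L (\<lambda>x. f x - g x) = L f - L g"
  using L_add[OF F_diff[OF assms] assms(2)] by simp

text \<open>The positive part of \<open>L\<close> in the sense of Riesz, with competitors restricted
  to the class \<open>F\<close>.\<close>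

definition Lpos :: "('a \<Rightarrow> real) \<Rightarrow> real" where
  "Lpos f = (SUP g\<in>{g \<in> F. \<forall>x. 0 \<le> g x \<and> g x \<le> f x}. L g)"

lemma Lpos_upper:
  assumes f: "f \<in> F" and g: "g \<in> F" "\<And>x. 0 \<le> g x" "\<And>x. g x \<le> f x"
  shows "L g \<le> Lpos f"
  unfolding Lpos_def
proof (rule cSUP_upper)
  obtain f' where "line_diff h f f'" using f by (auto simp: F_def)
  then obtain B where B: "0 < B" "\<And>x. \<bar>f x\<bar> \<le> B" "\<And>x. \<bar>f' x\<bar> \<le> B"
    using line_diff_bound by blast
  show "bdd_above (L ` {g \<in> F. \<forall>x. 0 \<le> g x \<and> g x \<le> f x})"
  proof (rule bdd_aboveI2)
    fix g assume "g \<in> {g \<in> F. \<forall>x. 0 \<le> g x \<and> g x \<le> f x}"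
    then have "\<bar>L g\<bar> \<le> K * B"
      using B by (intro L_bound) (auto intro: order_trans dest: abs_le_D1)
    then show "L g \<le> K * B" by simp
  qed
qed (use g in auto)

lemma Lpos_least:
  assumes "\<And>x. 0 \<le> f x" "\<And>g. g \<in> F \<Longrightarrow> (\<And>x. 0 \<le> g x) \<Longrightarrow> (\<And>x. g x \<le> f x) \<Longrightarrow> L g \<le> c"
  shows "Lpos f \<le> c"
  unfolding Lpos_def
proof (rule cSUP_least)
  show "{g \<in> F. \<forall>x. 0 \<le> g x \<and> g x \<le> f x} \<noteq> {}"
    using assms(1) F_const[of 0] by auto
qed (use assms(2) in auto)

lemma Lpos_const_le: "0 < e \<Longrightarrow> Lpos (\<lambda>x. e) \<le> K * e"
  by (rule Lpos_least) (auto dest: L_bound[of _ e])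

lemma Lpos_nonneg:
  assumes "f \<in> F" "\<And>x. 0 \<le> f x"
  shows "0 \<le> Lpos f"
proof -
  have "L (\<lambda>x. 0) \<le> Lpos f" using assms by (intro Lpos_upper F_const) auto
  moreover have "L (\<lambda>x. 0) = 0" using L_cmult[OF F_const[of 0], of 0] by simp
  ultimately show ?thesis by simp
qed

text \<open>The class is not a lattice, so the Riesz decomposition of \<open>g \<le> f1 + f2\<close> is only approximate:
  the parts \<open>g * fi / (f1 + f2 + e)\<close> miss \<open>g\<close> by at most \<open>e\<close>.\<close>
lemma Lpos_add:
  assumes f: "f1 \<in> F" "f2 \<in> F" and nonneg: "\<And>x. 0 \<le> f1 x" "\<And>x. 0 \<le> f2 x"
  shows "Lpos (\<lambda>x. f1 x + f2 x) = Lpos f1 + Lpos f2"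
proof (rule antisym)
  show "Lpos (\<lambda>x. f1 x + f2 x) \<le> Lpos f1 + Lpos f2"
  proof (rule Lpos_least)
    show "0 \<le> f1 x + f2 x" for x using nonneg by simp
    fix g assume g: "g \<in> F" "\<And>x. 0 \<le> g x" "\<And>x. g x \<le> f1 x + f2 x"
    show "L g \<le> Lpos f1 + Lpos f2"
    proof (rule field_le_epsilon)
      fix d :: real assume d: "0 < d"
      have K0: "0 \<le> K"
        using C'_nonneg unfolding K_def by simp
      \<comment> \<open>Besides making the lost part cost at most \<open>K * e \<le> d\<close>, a
        positive \<open>e\<close> keeps the denominator away from 0, so the quotients remain in
        \<open>F\<close>.\<close>
      define e where "e = d / (K + 1)"
      have e: "0 < e" "K * e \<le> d" using d K0 by (auto simp: e_def field_simps)
      let ?s = "\<lambda>x. f1 x + f2 x + e"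
      have sF: "?s \<in> F" by (intro F_add f F_const)
      have s: "e \<le> ?s x" "0 < ?s x" for x using nonneg[of x] e by auto
      have parts: "(\<lambda>x. g x * k x / ?s x) \<in> F" if "k \<in> F" for k
        using g that sF e s by (intro F_divide[of _ _ e] F_mult) auto
      have frac: "0 \<le> g x * k / ?s x" "g x * k / ?s x \<le> k" if "0 \<le> k" for k x
      proof -
        show "0 \<le> g x * k / ?s x" using that g(2)[of x] s(2)[of x] by simp
        have "g x * k \<le> ?s x * k" using that g(3)[of x] e by (intro mult_right_mono) auto
        then show "g x * k / ?s x \<le> k" using s(2)[of x] by (simp add: pos_divide_le_eq mult.commute)
      qed
      have "g x = (g x * f1 x / ?s x + g x * f2 x / ?s x) + g x * e / ?s x" for x
      proof -
        have "g x * f1 x / ?s x + g x * f2 x / ?s x + g x * e / ?s x = g x * ?s x / ?s x"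
          by (simp only: add_divide_distrib distrib_left)
        then show ?thesis using s(2)[of x] by simp
      qed
      then have "L g = L (\<lambda>x. (g x * f1 x / ?s x + g x * f2 x / ?s x) + g x * e / ?s x)"
        by (rule arg_cong[where f = L, OF ext])
      also have "\<dots> = (L (\<lambda>x. g x * f1 x / ?s x) + L (\<lambda>x. g x * f2 x / ?s x)) + L (\<lambda>x. g x * e / ?s x)"
        unfolding L_add[OF F_add[OF parts[OF f(1)] parts[OF f(2)]] parts[OF F_const[of e]]]
          L_add[OF parts[OF f(1)] parts[OF f(2)]] ..
      also have "\<dots> \<le> (Lpos f1 + Lpos f2) + K * e"
      proof (intro add_mono)
        show "L (\<lambda>x. g x * f1 x / ?s x) \<le> Lpos f1"
          by (rule Lpos_upper[OF f(1) parts[OF f(1)]]) (use frac nonneg in blast)+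
        show "L (\<lambda>x. g x * f2 x / ?s x) \<le> Lpos f2"
          by (rule Lpos_upper[OF f(2) parts[OF f(2)]]) (use frac nonneg in blast)+
        have "\<bar>L (\<lambda>x. g x * e / ?s x)\<bar> \<le> K * e"
          by (rule L_bound[OF parts[OF F_const[of e]]]) (use frac e in auto)
        then show "L (\<lambda>x. g x * e / ?s x) \<le> K * e" by simp
      qed
      finally show "L g \<le> Lpos f1 + Lpos f2 + d" using e by simp
    qed
  qed
  \<comment> \<open>For the converse, sums of competitors compete for \<open>f1 + f2\<close>; the
    suprema over \<open>g1\<close> and \<open>g2\<close> are taken one after the other.\<close>
  have "L g1 + L g2 \<le> Lpos (\<lambda>x. f1 x + f2 x)"
    if g: "g1 \<in> F" "\<And>x. 0 \<le> g1 x" "\<And>x. g1 x \<le> f1 x" "g2 \<in> F" "\<And>x. 0 \<le> g2 x" "\<And>x. g2 x \<le> f2 x" for g1 g2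
  proof -
    have "L (\<lambda>x. g1 x + g2 x) \<le> Lpos (\<lambda>x. f1 x + f2 x)"
      using g f by (intro Lpos_upper F_add) (auto intro: add_mono)
    then show ?thesis by (simp add: L_add g)
  qed
  then have "L g1 \<le> Lpos (\<lambda>x. f1 x + f2 x) - L g2"
    if "g1 \<in> F" "\<And>x. 0 \<le> g1 x" "\<And>x. g1 x \<le> f1 x" "g2 \<in> F" "\<And>x. 0 \<le> g2 x" "\<And>x. g2 x \<le> f2 x" for g1 g2
    using that by (simp add: le_diff_eq)
  then have "Lpos f1 \<le> Lpos (\<lambda>x. f1 x + f2 x) - L g2"
    if "g2 \<in> F" "\<And>x. 0 \<le> g2 x" "\<And>x. g2 x \<le> f2 x" for g2
    using that by (intro Lpos_least nonneg) auto
  then have "Lpos f2 \<le> Lpos (\<lambda>x. f1 x + f2 x) - Lpos f1"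
    by (intro Lpos_least nonneg) (auto simp: le_diff_eq add.commute)
  then show "Lpos f1 + Lpos f2 \<le> Lpos (\<lambda>x. f1 x + f2 x)" by simp
qed

lemma Lpos_sum_le:
  fixes g :: "nat \<Rightarrow> 'a \<Rightarrow> real"
  assumes "\<And>n. g n \<in> F" "\<And>n x. 0 \<le> g n x"
  shows "Lpos (\<lambda>x. \<Sum>i<N. g i x) \<le> (\<Sum>i<N. Lpos (g i))"
proof (induction N)
  case 0
  have "Lpos (\<lambda>x. 0) = Lpos (\<lambda>x. 0) + Lpos (\<lambda>x. 0)"
    using Lpos_add[OF F_const[of 0] F_const[of 0]] by simp
  then show ?case by simp
next
  case (Suc N)
  have "Lpos (\<lambda>x. (\<Sum>i<N. g i x) + g N x) = Lpos (\<lambda>x. \<Sum>i<N. g i x) + Lpos (g N)"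
    using assms by (intro Lpos_add F_sum sum_nonneg) auto
  with Suc show ?case by simp
qed

text \<open>\<open>L\<close> contains a derivative, so bounded pointwise convergence of the
  functions must be accompanied by that of their derivatives along \<open>h\<close>.\<close>

lemma L_LIMSEQ:
  assumes ld: "\<And>n. line_diff h (f n) (f' n)" "line_diff h l l'"
    and b: "\<And>n x. \<bar>f n x\<bar> \<le> B" "\<And>n x. \<bar>f' n x\<bar> \<le> B"
    and lim: "\<And>x. (\<lambda>n. f n x) \<longlonglongrightarrow> l x" "\<And>x. (\<lambda>n. f' n x) \<longlonglongrightarrow> l' x"
  shows "(\<lambda>n. L (f n)) \<longlonglongrightarrow> L l"
proof -
  have *: "(\<lambda>n. \<integral>x. v x * g n x \<partial>nu) \<longlonglongrightarrow> (\<integral>x. v x * k x \<partial>nu)"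
    if v: "integrable nu v" and gm: "\<And>n. g n \<in> borel_measurable borel" and km: "k \<in> borel_measurable borel"
      and gb: "\<And>n x. \<bar>g n x\<bar> \<le> B" and gl: "\<And>x. (\<lambda>n. g n x) \<longlonglongrightarrow> k x" for v g k
  proof (rule integral_dominated_convergence[where w = "\<lambda>x. B * \<bar>v x\<bar>"])
    have vm: "v \<in> borel_measurable nu" using v by simp
    show "(\<lambda>x. v x * k x) \<in> borel_measurable nu" "\<And>n. (\<lambda>x. v x * g n x) \<in> borel_measurable nu"
      by (intro borel_measurable_times vm measurable_nu km gm)+
    show "integrable nu (\<lambda>x. B * \<bar>v x\<bar>)" using v by simp
    show "AE x in nu. norm (v x * g n x) \<le> B * \<bar>v x\<bar>" for n
      using gb by (intro AE_I2) (simp add: abs_mult mult.commute[of B] mult_left_mono)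
    show "AE x in nu. (\<lambda>n. v x * g n x) \<longlonglongrightarrow> v x * k x"
      by (intro AE_I2 tendsto_mult_left gl)
  qed
  show ?thesis
    unfolding L_eq[OF ld(1)] L_eq[OF ld(2)]
    by (intro tendsto_diff *[OF w_int] *[OF u_int] line_diff_measurable[OF ld(1)]
        line_diff_measurable[OF ld(2)] b lim)
qed

end

section \<open>Daniell continuity on lines and representation by measures\<close>

context line_functional
begin

definition transversal :: "'a \<Rightarrow> 'a" where
  "transversal x = x - coord h x *\<^sub>R h"

lemma transversal_line: "transversal (x + t *\<^sub>R h) = transversal x"
  by (cases "h = 0") (simp_all add: transversal_def coord_line coord_self algebra_simps)

lemma transversal_decomp: "transversal x + coord h x *\<^sub>R h = x"
  by (simp add: transversal_def)

lemma transversal_measurable [measurable]: "transversal \<in> measurable borel borel"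
  unfolding transversal_def[abs_def] by measurable

text \<open>Dini's theorem is applied on a segment of each line parallel to \<open>h\<close>, and the set of lines on
  which the partial sums are already large enough is cut out by an \<open>h\<close>-invariant indicator,
  which does not affect differentiability along \<open>h\<close>.\<close>
lemma L_cutoff_le:
  assumes f: "f \<in> F" and g: "\<And>n. g n \<in> F" "\<And>n x. 0 \<le> g n x"
    and cover: "\<And>x. ennreal (f x) \<le> (\<Sum>n. ennreal (g n x))" and e: "0 < e"
    and k: "line_diff h k k'" "\<And>x. 0 \<le> k x" "\<And>x. k x \<le> f x" "\<And>x. \<bar>coord h x\<bar> \<ge> real T + 1 \<Longrightarrow> k x = 0"
    and s: "\<And>N. (\<Sum>i<N. Lpos (g i)) \<le> s"
  shows "L k \<le> s + K * e"
proof -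
  let ?S = "\<lambda>N x. \<Sum>i<N. g i x"
  let ?d = "\<lambda>N x. f x - ?S N x"
  \<comment> \<open>Rational parameters keep the intersection defining \<open>E N\<close> countable,
    hence Borel; continuity along the line recovers the whole open segment.\<close>
  define Q where "Q = {q \<in> \<rat>. \<bar>q\<bar> < real T + 1}"
  have cQ: "countable Q" unfolding Q_def by (rule countable_subset[OF _ countable_rat]) auto
  have Q0: "Q \<noteq> {}" unfolding Q_def using Rats_0 by force
  define E where "E N = (\<Inter>q\<in>Q. {x. ?d N (transversal x + q *\<^sub>R h) \<le> e})" for N
  have dF: "?d N \<in> F" for N by (intro F_diff f F_sum g)
  have E_meas: "E N \<in> sets borel" for N
  proof -
    note [measurable] = F_measurable[OF dF[of N]]
    have "{x. ?d N (transversal x + q *\<^sub>R h) \<le> e} \<in> sets borel" for q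
      by measurable
    then show ?thesis unfolding E_def using cQ Q0 by (intro sets.countable_INT') auto
  qed
  have E_inv: "x + t *\<^sub>R h \<in> E N \<longleftrightarrow> x \<in> E N" for x t N
    by (simp add: E_def transversal_line)
  have d_cont: "continuous_on S (\<lambda>t. ?d N (y + t *\<^sub>R h))" for N y S
  proof -
    obtain d' where "line_diff h (?d N) d'" using dF[of N] by (auto simp: F_def)
    then show ?thesis by (rule line_diff_continuous)
  qed
  \<comment> \<open>If the inequality failed at a point of the segment, it would fail on an open
    interval of parameters and hence at a rational one.\<close>
  have E_le: "?d N x \<le> e" if x: "x \<in> E N" "\<bar>coord h x\<bar> < real T + 1" for N x
  proof (rule ccontr)
    assume "\<not> ?d N x \<le> e"
    then have gt: "e < ?d N (transversal x + coord h x *\<^sub>R h)"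
      by (simp add: transversal_decomp)
    let ?O = "{t. e < ?d N (transversal x + t *\<^sub>R h)} \<inter> {- (real T + 1)<..<real T + 1}"
    have "open ?O"
      by (intro open_Int open_Collect_less d_cont continuous_on_const open_greaterThanLessThan)
    moreover have "coord h x \<in> ?O" using gt x(2) by (auto simp: abs_less_iff)
    ultimately obtain r where r: "0 < r" "ball (coord h x) r \<subseteq> ?O" by (rule openE)
    obtain q where "q \<in> \<rat>" "coord h x < q" "q < coord h x + r"
      using Rats_dense_in_real[of "coord h x" "coord h x + r"] r(1) by auto
    moreover from this have "q \<in> ball (coord h x) r" by (simp add: dist_real_def)
    ultimately have q: "q \<in> \<rat>" "q \<in> ?O" using r(2) by blast+
    then have "q \<in> Q" by (auto simp: Q_def abs_less_iff)
    then have "?d N (transversal x + q *\<^sub>R h) \<le> e" using x(1) by (auto simp: E_def)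
    then show False using q by auto
  qed
  \<comment> \<open>Dini: the sets \<open>O' N\<close> of parameters are open, increase with
    \<open>N\<close> and cover the compact segment because the series exceeds \<open>f - e\<close>
    everywhere, so one of them contains it.\<close>
  have E_ev: "\<exists>N0. \<forall>N\<ge>N0. x \<in> E N" for x
  proof -
    define y where "y = transversal x"
    define O' where "O' N = {t. ?d N (y + t *\<^sub>R h) < e}" for N
    have op: "open (O' N)" for N
      unfolding O'_def by (intro open_Collect_less d_cont continuous_on_const)
    have mono: "O' N \<subseteq> O' N'" if "N \<le> N'" for N N'
    proof -
      have "?S N z \<le> ?S N' z" for z
        using that g(2) by (intro sum_mono2) auto
      then show ?thesis unfolding O'_def by (auto intro: le_less_trans[rotated])
    qed
    have cov: "{- (real T + 1)..real T + 1} \<subseteq> (\<Union>N. O' N)"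
    proof
      fix t
      let ?z = "y + t *\<^sub>R h"
      have "\<exists>N. ?d N ?z < e"
      proof (rule ccontr)
        assume "\<not> ?thesis"
        then have le: "?S N ?z \<le> f ?z - e" for N by (auto simp: not_less algebra_simps)
        have "(\<Sum>n. ennreal (g n ?z)) \<le> ennreal (f ?z - e)"
        proof (rule suminf_le_const)
          show "(\<Sum>i<N. ennreal (g i ?z)) \<le> ennreal (f ?z - e)" for N
            using le[of N] g(2) by (simp add: sum_ennreal ennreal_leI)
        qed auto
        then have "ennreal (f ?z) \<le> ennreal (f ?z - e)"
          using cover[of ?z] by (rule order_trans[rotated])
        moreover have "0 \<le> f ?z - e" using le[of 0] by simp
        ultimately show False using e by (simp add: ennreal_le_iff)
      qed
      then show "t \<in> (\<Union>N. O' N)" by (auto simp: O'_def)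
    qed
    obtain D where D: "finite D" "{- (real T + 1)..real T + 1} \<subseteq> (\<Union>N\<in>D. O' N)"
      using compactE_image[OF compact_Icc, of UNIV O' "- (real T + 1)" "real T + 1"] op cov by metis
    define N0 where "N0 = Max (insert 0 D)"
    have "x \<in> E N" if N: "N \<ge> N0" for N
    proof -
      have "q \<in> O' N" if "q \<in> Q" for q
      proof -
        have "q \<in> {- (real T + 1)..real T + 1}" using that by (auto simp: Q_def)
        then obtain n where n: "n \<in> D" "q \<in> O' n" using D(2) by blast
        then have "n \<le> N" using D(1) N by (auto simp: N0_def)
        then show ?thesis using mono n by blast
      qed
      then show ?thesis by (force simp: E_def O'_def y_def)
    qed
    then show ?thesis by blast
  qed
  \<comment> \<open>Multiplication by the invariant indicator multiplies the derivative by it too.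
    Each point lies in \<open>E N\<close> for large \<open>N\<close>, so function and derivative are
    eventually unchanged there.\<close>
  define kN where "kN N x = k x * indicator (E N) x" for N x
  define kN' where "kN' N x = k' x * indicator (E N) x + 0 * k x" for N x
  have ld: "line_diff h (kN N) (kN' N)" for N
    unfolding kN_def[abs_def] kN'_def[abs_def]
    by (intro line_diff_mult k(1) line_diff_invariant_indicator E_meas E_inv)
  obtain B where B: "0 < B" "\<And>x. \<bar>k x\<bar> \<le> B" "\<And>x. \<bar>k' x\<bar> \<le> B"
    using line_diff_bound[OF k(1)] by blast
  have "(\<lambda>N. L (kN N)) \<longlonglongrightarrow> L k"
  proof (rule L_LIMSEQ[OF ld k(1)])
    show "\<bar>kN N x\<bar> \<le> B" "\<bar>kN' N x\<bar> \<le> B" for N x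
      using B(1) B(2,3)[of x] by (auto simp: kN_def kN'_def indicator_def)
    fix x
    obtain N0 where N0: "\<And>N. N \<ge> N0 \<Longrightarrow> x \<in> E N" using E_ev by blast
    have "kN N x = k x" "kN' N x = k' x" if "N \<ge> N0" for N
      using N0[OF that] by (auto simp: kN_def kN'_def)
    then show "(\<lambda>N. kN N x) \<longlonglongrightarrow> k x" "(\<lambda>N. kN' N x) \<longlonglongrightarrow> k' x"
      by (auto intro!: tendsto_eventually eventually_sequentiallyI[of N0])
  qed
  moreover have "L (kN N) \<le> s + K * e" for N
  proof -
    have SF: "?S N \<in> F" by (intro F_sum g)
    have S0: "0 \<le> ?S N x" for x by (intro sum_nonneg g)
    \<comment> \<open>On \<open>E N\<close> within the segment this is \<open>E_le\<close>;
      elsewhere \<open>kN N x = 0\<close>, off the segment because \<open>k\<close> is cut off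
      there.\<close>
    have "kN N x \<le> ?S N x + e" for x
    proof (cases "x \<in> E N \<and> \<bar>coord h x\<bar> < real T + 1")
      case True
      then show ?thesis using E_le[of x N] k(3)[of x] by (simp add: kN_def)
    next
      case False
      then have "kN N x = 0" using k(4)[of x] by (auto simp: kN_def indicator_def)
      then show ?thesis using S0[of x] e by simp
    qed
    moreover have "0 \<le> kN N x" for x using k(2)[of x] by (simp add: kN_def)
    ultimately have "L (kN N) \<le> Lpos (\<lambda>x. ?S N x + e)"
      using ld[of N] by (intro Lpos_upper F_add SF F_const) (auto simp: F_def)
    also have "\<dots> = Lpos (?S N) + Lpos (\<lambda>x. e)"
      using S0 e by (intro Lpos_add SF F_const) auto
    also have "\<dots> \<le> s + K * e"
      by (intro add_mono order_trans[OF Lpos_sum_le s] g Lpos_const_le e)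
    finally show ?thesis .
  qed
  ultimately show ?thesis by (intro LIMSEQ_le_const2) auto
qed

text \<open>Every competitor \<open>k\<close> of \<open>f\<close> is multiplied by
  \<open>line_cutoff\<close>, which reduces it to a segment of each line; afterwards
  \<open>T\<close> tends to infinity by dominated convergence and \<open>e\<close> to 0.\<close>

lemma Lpos_sigma:
  assumes f: "f \<in> F" "\<And>x. 0 \<le> f x" and g: "\<And>n::nat. g n \<in> F" "\<And>n x. 0 \<le> g n x"
    and cover: "\<And>x. ennreal (f x) \<le> (\<Sum>n. ennreal (g n x))"
  shows "ennreal (Lpos f) \<le> (\<Sum>n. ennreal (Lpos (g n)))"
proof (cases "(\<Sum>n. ennreal (Lpos (g n)))" rule: ennreal_cases)
  case (real s)
  have s: "(\<Sum>i<N. Lpos (g i)) \<le> s" for N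
  proof -
    have "ennreal (\<Sum>i<N. Lpos (g i)) = (\<Sum>i<N. ennreal (Lpos (g i)))"
      using Lpos_nonneg g by (intro sum_ennreal[symmetric]) auto
    also have "\<dots> \<le> (\<Sum>n. ennreal (Lpos (g n)))" by (rule sum_le_suminf) auto
    finally show ?thesis using real by (simp add: ennreal_le_iff)
  qed
  have "Lpos f \<le> s"
  proof (rule Lpos_least[OF f(2)])
    fix k assume k: "k \<in> F" "\<And>x. 0 \<le> k x" "\<And>x. k x \<le> f x"
    obtain k' where k': "line_diff h k k'" using k(1) by (auto simp: F_def)
    obtain B where B: "0 < B" "\<And>x. \<bar>k x\<bar> \<le> B" "\<And>x. \<bar>k' x\<bar> \<le> B"
      using line_diff_bound[OF k'] by blast
    let ?k = "\<lambda>T x. k x * line_cutoff h T x" and ?k' = "\<lambda>T x. k' x * line_cutoff h T x + line_cutoff' h T x * k x"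
    have ld: "line_diff h (?k T) (?k' T)" for T
      by (rule line_diff_mult[OF k' line_cutoff_diff])
    have lim: "(\<lambda>T. L (?k T)) \<longlonglongrightarrow> L k"
    proof (rule L_LIMSEQ[OF ld k'])
      fix T x
      have "\<bar>k x\<bar> * \<bar>line_cutoff h T x\<bar> \<le> B * 1" "\<bar>k' x\<bar> * \<bar>line_cutoff h T x\<bar> \<le> B * 1"
        "\<bar>line_cutoff' h T x\<bar> * \<bar>k x\<bar> \<le> 4 * B"
        using line_cutoff_bounds[of h T x] line_cutoff'_bound[of h T x] B by (intro mult_mono; simp)+
      \<comment> \<open>\<open>5 * B\<close> collects \<open>B\<close> from the derivative of
        \<open>k\<close> and \<open>4 * B\<close> from that of the cut-off, uniformly in
        \<open>T\<close>.\<close>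
      then show "\<bar>?k T x\<bar> \<le> 5 * B" "\<bar>?k' T x\<bar> \<le> 5 * B"
        using B(1) abs_triangle_ineq[of "k' x * line_cutoff h T x" "line_cutoff' h T x * k x"]
        unfolding abs_mult by linarith+
    next
      fix x
      obtain n :: nat where n: "\<bar>coord h x\<bar> \<le> real n" using real_arch_simple by blast
      have "?k T x = k x" "?k' T x = k' x" if "T \<ge> n" for T
      proof -
        have "\<bar>coord h x\<bar> \<le> real T" using n that by simp
        then show "?k T x = k x" "?k' T x = k' x" by (simp_all add: line_cutoff_1)
      qed
      then show "(\<lambda>T. ?k T x) \<longlonglongrightarrow> k x" "(\<lambda>T. ?k' T x) \<longlonglongrightarrow> k' x"
        by (auto intro!: tendsto_eventually eventually_sequentiallyI[of n])
    qed
    have "L (?k T) \<le> s + K * e" if e: "0 < e" for T e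
    proof (rule L_cutoff_le[OF f(1) g cover e ld _ _ _ s])
      show "0 \<le> ?k T x" for x by (intro mult_nonneg_nonneg k(2) line_cutoff_bounds)
      show "?k T x \<le> f x" for x
        using k(2,3)[of x] line_cutoff_bounds[of h T x] mult_left_le[of "line_cutoff h T x" "k x"] by simp
      show "?k T x = 0" if "\<bar>coord h x\<bar> \<ge> real T + 1" for x
        using line_cutoff_0[OF that] by simp
    qed
    then have le: "L k \<le> s + K * e" if "0 < e" for e
      using that by (intro LIMSEQ_le_const2[OF lim]) auto
    have "(\<lambda>n. s + K * inverse (real (Suc n))) \<longlonglongrightarrow> s + K * 0"
      by (intro tendsto_intros LIMSEQ_inverse_real_of_nat)
    then have "L k \<le> s + K * 0"
      by (rule LIMSEQ_le_const) (auto intro!: le)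
    then show "L k \<le> s" by simp
  qed
  then show ?thesis using real by (simp add: ennreal_leI)
qed simp

lemma Lpos_measure:
  obtains P where "finite_measure P" "sets P = sets borel"
    "\<And>f. \<lbrakk>f \<in> F; \<And>x. 0 \<le> f x; \<And>x. f x \<le> 1\<rbrakk> \<Longrightarrow> (\<integral>x. f x \<partial>P) = Lpos f"
proof -
  interpret daniell_functional F Lpos
    by (rule daniell_functional.intro)
      (fact F_measurable F_const F_add F_mult F_step F_C1b[OF ball_bump_C1b] Lpos_nonneg Lpos_add Lpos_sigma)+
  show ?thesis using representing_measure that by metis
qed

lemma uminus_functional: "line_functional nu h (\<lambda>x. - u x) (\<lambda>x. - w x) C"
proof
  fix f :: "'a \<Rightarrow> real" assume "C1b f" "\<And>x. 0 \<le> f x" "\<And>x. f x \<le> 1"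
  moreover have "(\<integral>x. - w x * f x - - u x * (grad f x \<bullet> h) \<partial>nu) = (\<integral>x. - (w x * f x - u x * (grad f x \<bullet> h)) \<partial>nu)"
    by simp
  ultimately show "\<bar>\<integral>x. - w x * f x - - u x * (grad f x \<bullet> h) \<partial>nu\<bar> \<le> C"
    using bound_C1b[of f] by (simp only: integral_minus abs_minus)
qed (use sets_nu u_int w_int in auto)

theorem signed_representation:
  obtains P N where "finite_measure P" "sets P = sets borel" "finite_measure N" "sets N = sets borel"
    "\<And>f. C1b f \<Longrightarrow> (\<integral>x. w x * f x - u x * (grad f x \<bullet> h) \<partial>nu) = (\<integral>x. f x \<partial>P) - (\<integral>x. f x \<partial>N)"
proof -
  \<comment> \<open>The positive part of \<open>-L\<close> serves as the negative part of
    \<open>L\<close>. The class \<open>F\<close> depends on \<open>h\<close> only, so both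
    functionals live on the same class.\<close>
  interpret neg: line_functional nu h "\<lambda>x. - u x" "\<lambda>x. - w x" C by (rule uminus_functional)
  obtain P where P: "finite_measure P" "sets P = sets borel"
    "\<And>f. \<lbrakk>f \<in> F; \<And>x. 0 \<le> f x; \<And>x. f x \<le> 1\<rbrakk> \<Longrightarrow> (\<integral>x. f x \<partial>P) = Lpos f"
    using Lpos_measure by metis
  obtain N where N: "finite_measure N" "sets N = sets borel"
    "\<And>f. \<lbrakk>f \<in> F; \<And>x. 0 \<le> f x; \<And>x. f x \<le> 1\<rbrakk> \<Longrightarrow> (\<integral>x. f x \<partial>N) = neg.Lpos f"
    using neg.Lpos_measure by metis
  have negL: "neg.L f = - L f" for f
    unfolding neg.L_def L_def by (simp flip: integral_minus)
  \<comment> \<open>The map sending \<open>g\<close> to \<open>f - g\<close> exchanges the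
    competitors for the two suprema and shifts the value by \<open>L f\<close>.\<close>
  have diff: "Lpos f - neg.Lpos f = L f" if f: "f \<in> F" "\<And>x. 0 \<le> f x" for f
  proof -
    have "neg.Lpos f \<le> Lpos f - L f"
    proof (rule neg.Lpos_least[OF f(2)])
      fix g assume g: "g \<in> F" "\<And>x. 0 \<le> g x" "\<And>x. g x \<le> f x"
      have "L (\<lambda>x. f x - g x) \<le> Lpos f"
        using g f by (intro Lpos_upper F_diff) auto
      then show "neg.L g \<le> Lpos f - L f" using g f by (simp add: L_diff negL)
    qed
    moreover have "Lpos f \<le> neg.Lpos f + L f"
    proof (rule Lpos_least[OF f(2)])
      fix g assume g: "g \<in> F" "\<And>x. 0 \<le> g x" "\<And>x. g x \<le> f x"
      have "neg.L (\<lambda>x. f x - g x) \<le> neg.Lpos f"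
        using g f by (intro neg.Lpos_upper) (auto intro: F_diff)
      then show "L g \<le> neg.Lpos f + L f" using g f by (simp add: L_diff negL)
    qed
    ultimately show ?thesis by simp
  qed
  have repr01: "L f = (\<integral>x. f x \<partial>P) - (\<integral>x. f x \<partial>N)" if "f \<in> F" "\<And>x. 0 \<le> f x" "\<And>x. f x \<le> 1" for f
    using P(3)[OF that] N(3)[OF that] diff[OF that(1,2)] by simp
  show ?thesis
  proof (rule that[OF P(1,2) N(1,2)])
    fix f :: "'a \<Rightarrow> real" assume f: "C1b f"
    obtain B where B: "0 < B" "\<And>x. \<bar>f x\<bar> \<le> B" "\<And>x. norm (grad f x) \<le> B"
      using C1b_bound[OF f] by blast
    \<comment> \<open>The representation is known for values in [0,1]; an affine change of
      \<open>f\<close> brings it into that range, and constants are represented as well.\<close>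
    define g where "g x = inverse (2 * B) * (f x + B)" for x
    have fF: "f \<in> F" by (rule F_C1b[OF f])
    have gF: "g \<in> F" unfolding g_def[abs_def] by (intro F_mult F_const F_add fF)
    have "0 \<le> g x" "g x \<le> 1" for x
      using B(1) B(2)[of x] unfolding g_def by (auto simp: field_simps abs_le_iff)
    from repr01[OF gF this] have g: "L g = (\<integral>x. g x \<partial>P) - (\<integral>x. g x \<partial>N)" .
    have one: "L (\<lambda>x. 1) = (\<integral>x. 1 \<partial>P) - (\<integral>x. 1 \<partial>N)"
      by (intro repr01 F_const) auto
    have fg: "f = (\<lambda>x. (2 * B) * g x + (- B) * 1)"
      using B(1) by (simp add: g_def fun_eq_iff field_simps)
    have int: "integrable M g" "integrable M (\<lambda>x. 1 :: real)" if "M \<in> {P, N}" for M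
    proof -
      have M: "finite_measure M" "sets M = sets borel" using that P N by auto
      show "integrable M (\<lambda>x. 1 :: real)" using M(1) by (simp add: finite_measure.integrable_const)
      show "integrable M g"
        using \<open>\<And>x. 0 \<le> g x\<close> \<open>\<And>x. g x \<le> 1\<close>
        by (intro finite_measure_integrable_bounded[OF M F_measurable[OF gF], of 1]) (simp add: abs_of_nonneg)
    qed
    have intf: "(\<integral>x. f x \<partial>M) = (2 * B) * (\<integral>x. g x \<partial>M) + (- B) * (\<integral>x. 1 \<partial>M)" if "M \<in> {P, N}" for M
    proof -
      have "(\<integral>x. f x \<partial>M) = (\<integral>x. (2 * B) * g x + (- B) * 1 \<partial>M)" by (subst fg) simp
      also have "\<dots> = (\<integral>x. (2 * B) * g x \<partial>M) + (\<integral>x. (- B) * 1 \<partial>M)"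
        by (intro Bochner_Integration.integral_add integrable_mult_right int that)
      finally show ?thesis by (simp only: integral_mult_right_zero)
    qed
    have "L f = (2 * B) * L g + (- B) * L (\<lambda>x. 1)"
      using L_add[OF F_mult[OF F_const[of "2 * B"] gF] F_mult[OF F_const[of "- B"] F_const[of 1]]]
      unfolding L_cmult[OF gF] L_cmult[OF F_const] fg[symmetric] .
    then have "L f = (\<integral>x. f x \<partial>P) - (\<integral>x. f x \<partial>N)"
      using intf[of P] intf[of N] unfolding g one by (simp add: algebra_simps)
    then show "(\<integral>x. w x * f x - u x * (grad f x \<bullet> h) \<partial>nu) = (\<integral>x. f x \<partial>P) - (\<integral>x. f x \<partial>N)"
      unfolding L_def line_diff_dline[OF line_diff_C1b[OF f]] .
  qed
qed

end

section \<open>Signed measures and total variation\<close>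

text \<open>Integration against a signed measure does not depend on how it is written as a
  difference. This links the pairs found by the Daniell construction to the Jordan pair inside
  \<open>signed_integral\<close>.\<close>

lemma integral_diff_eq_of_measure_diff_eq:
  fixes f :: "'a::topological_space \<Rightarrow> real"
  assumes P: "finite_measure P" "sets P = sets borel" and N: "finite_measure N" "sets N = sets borel"
    and P': "finite_measure P'" "sets P' = sets borel" and N': "finite_measure N'" "sets N' = sets borel"
    and eq: "\<And>A. A \<in> sets borel \<Longrightarrow> measure P A - measure N A = measure P' A - measure N' A"
    and f: "f \<in> borel_measurable borel" "\<And>x. \<bar>f x\<bar> \<le> B"
  shows "(\<integral>x. f x \<partial>P) - (\<integral>x. f x \<partial>N) = (\<integral>x. f x \<partial>P') - (\<integral>x. f x \<partial>N')"
proof -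
  have B0: "0 \<le> B" using f(2)[of undefined] by simp
  define g where "g x = inverse (2 * B + 1) * (f x + B)" for x
  have B1: "0 < 2 * B + 1" using B0 by simp
  have g01: "0 \<le> g x" "g x \<le> 1" for x
    using B1 f(2)[of x] unfolding g_def by (auto simp: field_simps abs_le_iff)
  have gm [measurable]: "g \<in> borel_measurable borel" unfolding g_def[abs_def] using f(1) by measurable
  have fg: "f x = (2 * B + 1) * g x + (- B) * 1" for x
    using B1 by (simp add: g_def flip: mult.assoc)
  let ?s = "\<lambda>M n. (\<Sum>j=1..n. measure M {x. real j \<le> real n * g x}) / real n"
  have lim: "(\<lambda>n. ?s M n) \<longlonglongrightarrow> (\<integral>x. g x \<partial>M)" if M: "finite_measure M" "sets M = sets borel" for M
  proof -
    have sp: "space M = UNIV" using sets_eq_imp_space_eq[OF M(2)] by simp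
    have "g \<in> borel_measurable M" using gm measurable_cong_sets[OF M(2) refl] by blast
    from integral_layer_limit[of M "\<lambda>_. 1", OF _ this g01]
    have "(\<lambda>n. (\<Sum>j=1..n. \<integral>x. indicator {x. real j \<le> real n * g x} x \<partial>M) / real n) \<longlonglongrightarrow> (\<integral>x. g x \<partial>M)"
      using M(1) by (simp add: finite_measure.integrable_const)
    moreover have "{x. real j \<le> real n * g x} \<in> sets M" for j n
      unfolding M(2) by measurable
    ultimately show ?thesis by (simp add: sp)
  qed
  have "?s P n - ?s N n = ?s P' n - ?s N' n" for n
  proof -
    have m: "{x. real j \<le> real n * g x} \<in> sets borel" for j by measurable
    have "(\<Sum>j=1..n. measure P {x. real j \<le> real n * g x} - measure N {x. real j \<le> real n * g x})
      = (\<Sum>j=1..n. measure P' {x. real j \<le> real n * g x} - measure N' {x. real j \<le> real n * g x})"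
      by (intro sum.cong refl eq m)
    then show ?thesis by (simp add: sum_subtractf flip: diff_divide_distrib)
  qed
  then have g_eq: "(\<integral>x. g x \<partial>P) - (\<integral>x. g x \<partial>N) = (\<integral>x. g x \<partial>P') - (\<integral>x. g x \<partial>N')"
    using LIMSEQ_unique[OF tendsto_diff[OF lim[OF P] lim[OF N]]] tendsto_diff[OF lim[OF P'] lim[OF N']] by simp
  have intf: "(\<integral>x. f x \<partial>M) = (2 * B + 1) * (\<integral>x. g x \<partial>M) - B * measure M UNIV"
    if M: "finite_measure M" "sets M = sets borel" for M
  proof -
    have sp: "space M = UNIV" using sets_eq_imp_space_eq[OF M(2)] by simp
    have i: "integrable M g" "integrable M (\<lambda>x. 1 :: real)"
      using g01 M(1) by (auto intro!: finite_measure_integrable_bounded[OF M gm, of 1]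
          simp: abs_of_nonneg finite_measure.integrable_const)
    have "(\<integral>x. f x \<partial>M) = (\<integral>x. (2 * B + 1) * g x \<partial>M) + (\<integral>x. (- B) * 1 \<partial>M)"
      unfolding fg by (intro Bochner_Integration.integral_add integrable_mult_right i)
    then show ?thesis by (simp add: sp mult.commute)
  qed
  have "measure P UNIV - measure N UNIV = measure P' UNIV - measure N' UNIV"
    by (rule eq) simp
  then have "B * measure P UNIV - B * measure N UNIV = B * measure P' UNIV - B * measure N' UNIV"
    by (simp flip: right_diff_distrib)
  moreover have "(2 * B + 1) * (\<integral>x. g x \<partial>P) - (2 * B + 1) * (\<integral>x. g x \<partial>N)
      = (2 * B + 1) * (\<integral>x. g x \<partial>P') - (2 * B + 1) * (\<integral>x. g x \<partial>N')"
    using g_eq by (simp flip: right_diff_distrib)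
  ultimately show ?thesis
    unfolding intf[OF P] intf[OF N] intf[OF P'] intf[OF N'] by linarith
qed

locale bounded_signed_measure =
  fixes \<mu> :: "'a::topological_space set \<Rightarrow> real" and c :: real
  assumes sums: "\<And>B :: nat \<Rightarrow> 'a set. range B \<subseteq> sets borel \<Longrightarrow> disjoint_family B \<Longrightarrow>
      (\<lambda>n. \<mu> (B n)) sums \<mu> (\<Union>(range B))"
    and bound: "\<And>A. A \<in> sets borel \<Longrightarrow> \<bar>\<mu> A\<bar> \<le> c"
begin

lemma empty: "\<mu> {} = 0"
proof -
  have "(\<lambda>n::nat. \<mu> {}) sums \<mu> (\<Union>(range (\<lambda>n::nat. {})))"
    by (rule sums) (auto simp: disjoint_family_on_def)
  then have "(\<lambda>n::nat. \<mu> {}) \<longlonglongrightarrow> 0"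
    using sums_summable summable_LIMSEQ_zero by blast
  then show ?thesis by (simp add: LIMSEQ_const_iff)
qed

lemma Un:
  assumes "A \<in> sets borel" "B \<in> sets borel" "A \<inter> B = {}"
  shows "\<mu> (A \<union> B) = \<mu> A + \<mu> B"
proof -
  have "(\<lambda>n. \<mu> (binaryset A B n)) sums \<mu> (\<Union>(range (binaryset A B)))"
    using assms by (intro sums) (auto simp: binaryset_def disjoint_family_on_def)
  moreover have "(\<lambda>n. \<mu> (binaryset A B n)) sums (\<mu> A + \<mu> B)"
    using binaryset_sums[of \<mu> A B] empty by blast
  ultimately show ?thesis using sums_unique2 by (metis UN_binaryset_eq)
qed

lemma pos_var_upper:
  assumes "A \<in> sets borel" "A \<subseteq> B"
  shows "\<mu> A \<le> pos_var \<mu> B"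
  unfolding pos_var_def
proof (rule cSUP_upper)
  show "bdd_above (\<mu> ` {A \<in> sets borel. A \<subseteq> B})"
    using bound by (intro bdd_aboveI2[of _ _ c]) (auto dest: abs_le_D1)
qed (use assms in auto)

lemma pos_var_least:
  assumes "\<And>A. A \<in> sets borel \<Longrightarrow> A \<subseteq> B \<Longrightarrow> \<mu> A \<le> s"
  shows "pos_var \<mu> B \<le> s"
  unfolding pos_var_def by (rule cSUP_least) (use assms in auto)

lemma pos_var_nonneg: "0 \<le> pos_var \<mu> B"
  using pos_var_upper[of "{}" B] by (simp add: empty)

lemma pos_var_mono:
  assumes "A \<subseteq> B"
  shows "pos_var \<mu> A \<le> pos_var \<mu> B"
  using assms by (intro pos_var_least pos_var_upper) auto

lemma pos_var_empty: "pos_var \<mu> {} = 0"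
  using pos_var_least[of "{}" 0] pos_var_nonneg[of "{}"] empty by fastforce

lemma pos_var_Un:
  assumes "A \<inter> B = {}"
  shows "pos_var \<mu> A + pos_var \<mu> B \<le> pos_var \<mu> (A \<union> B)"
proof -
  have *: "\<mu> A' + \<mu> B' \<le> pos_var \<mu> (A \<union> B)"
    if "A' \<in> sets borel" "A' \<subseteq> A" "B' \<in> sets borel" "B' \<subseteq> B" for A' B'
  proof -
    have "\<mu> A' + \<mu> B' = \<mu> (A' \<union> B')"
      using that assms by (intro Un[symmetric]) auto
    also have "\<dots> \<le> pos_var \<mu> (A \<union> B)"
      using that by (intro pos_var_upper) auto
    finally show ?thesis .
  qed
  have "\<mu> A' \<le> pos_var \<mu> (A \<union> B) - pos_var \<mu> B" if A': "A' \<in> sets borel" "A' \<subseteq> A" for A'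
  proof -
    have "pos_var \<mu> B \<le> pos_var \<mu> (A \<union> B) - \<mu> A'"
      by (rule pos_var_least) (use *[OF A'] in \<open>simp add: le_diff_eq add.commute\<close>)
    then show ?thesis by simp
  qed
  then have "pos_var \<mu> A \<le> pos_var \<mu> (A \<union> B) - pos_var \<mu> B"
    by (rule pos_var_least)
  then show ?thesis by simp
qed

lemma pos_var_sum:
  fixes B :: "nat \<Rightarrow> 'a set"
  assumes "disjoint_family B"
  shows "(\<Sum>n<k. pos_var \<mu> (B n)) \<le> pos_var \<mu> (\<Union>n<k. B n)"
proof (induction k)
  case (Suc k)
  have "B n \<inter> B k = {}" if "n < k" for n
    using disjoint_family_onD[OF assms, of n k] that by simp
  then have "(\<Union>n<k. B n) \<inter> B k = {}" by blast
  from pos_var_Un[OF this] have "pos_var \<mu> (\<Union>n<k. B n) + pos_var \<mu> (B k) \<le> pos_var \<mu> (\<Union>n<Suc k. B n)"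
    by (simp only: lessThan_Suc UN_insert Un_commute)
  with Suc show ?case by simp
qed (simp add: pos_var_empty)

text \<open>One inequality is finite superadditivity with monotonicity; for the other, a test set
  \<open>A\<close> is cut into the pieces \<open>A \<inter> B n\<close> and countable additivity of
  the signed measure is applied.\<close>

lemma pos_var_countably_additive: "countably_additive (sets borel) (\<lambda>B. ennreal (pos_var \<mu> B))"
proof (rule countably_additiveI)
  fix B :: "nat \<Rightarrow> 'a set"
  assume B: "range B \<subseteq> sets borel" "disjoint_family B"
  have sum_eq: "(\<Sum>n<k. ennreal (pos_var \<mu> (B n))) = ennreal (\<Sum>n<k. pos_var \<mu> (B n))" for k
    by (intro sum_ennreal pos_var_nonneg)
  show "(\<Sum>n. ennreal (pos_var \<mu> (B n))) = ennreal (pos_var \<mu> (\<Union>n. B n))"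
  proof (rule antisym)
    show "(\<Sum>n. ennreal (pos_var \<mu> (B n))) \<le> ennreal (pos_var \<mu> (\<Union>n. B n))"
    proof (rule suminf_le_const)
      fix k
      have "(\<Sum>n<k. pos_var \<mu> (B n)) \<le> pos_var \<mu> (\<Union>n. B n)"
        by (rule order_trans[OF pos_var_sum[OF B(2)] pos_var_mono]) blast
      then show "(\<Sum>n<k. ennreal (pos_var \<mu> (B n))) \<le> ennreal (pos_var \<mu> (\<Union>n. B n))"
        unfolding sum_eq by (rule ennreal_leI)
    qed auto
    show "ennreal (pos_var \<mu> (\<Union>n. B n)) \<le> (\<Sum>n. ennreal (pos_var \<mu> (B n)))"
    proof (cases "(\<Sum>n. ennreal (pos_var \<mu> (B n)))" rule: ennreal_cases)
      case (real s)
      have s: "(\<Sum>n<k. pos_var \<mu> (B n)) \<le> s" for k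
      proof -
        have "ennreal (\<Sum>n<k. pos_var \<mu> (B n)) \<le> ennreal s"
          unfolding sum_eq[symmetric] real(2)[symmetric] by (rule sum_le_suminf) auto
        then show ?thesis using real(1) by (simp add: ennreal_le_iff)
      qed
      have "pos_var \<mu> (\<Union>n. B n) \<le> s"
      proof (rule pos_var_least)
        fix A assume A: "A \<in> sets borel" "A \<subseteq> (\<Union>n. B n)"
        have "(\<lambda>n. \<mu> (A \<inter> B n)) sums \<mu> (\<Union>(range (\<lambda>n. A \<inter> B n)))"
        proof (rule sums)
          show "range (\<lambda>n. A \<inter> B n) \<subseteq> sets borel" using A B by auto
          show "disjoint_family (\<lambda>n. A \<inter> B n)"
            using B(2) by (rule disjoint_family_on_bisimulation) blast
        qed
        moreover have "\<Union>(range (\<lambda>n. A \<inter> B n)) = A" using A(2) by blast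
        ultimately have "(\<lambda>k. \<Sum>n<k. \<mu> (A \<inter> B n)) \<longlonglongrightarrow> \<mu> A" by (simp add: sums_def)
        moreover have "(\<Sum>n<k. \<mu> (A \<inter> B n)) \<le> s" for k
        proof (rule order_trans[OF sum_mono s])
          show "\<mu> (A \<inter> B n) \<le> pos_var \<mu> (B n)" for n
            using A B by (intro pos_var_upper) auto
        qed
        ultimately show "\<mu> A \<le> s" by (intro LIMSEQ_le_const2) auto
      qed
      then show ?thesis unfolding real(2) by (rule ennreal_leI)
    qed simp
  qed
qed

lemma pos_var_measure:
  defines "M \<equiv> measure_of UNIV (sets borel) (\<lambda>B. ennreal (pos_var \<mu> B))"
  shows "finite_measure M" "sets M = sets borel" "\<And>A. A \<in> sets borel \<Longrightarrow> measure M A = pos_var \<mu> A"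
proof -
  have em: "emeasure M A = ennreal (pos_var \<mu> A)" if "A \<in> sets borel" for A
    unfolding M_def
  proof (rule emeasure_measure_of_sigma)
    show "sigma_algebra UNIV (sets borel :: 'a set set)"
      using sets.sigma_algebra_axioms[of "borel :: 'a measure"] by simp
    show "positive (sets borel) (\<lambda>B. ennreal (pos_var \<mu> B))"
      by (simp add: positive_def pos_var_empty)
  qed (use pos_var_countably_additive that in auto)
  show "sets M = sets borel"
    unfolding M_def using sets.sigma_sets_eq[of "borel :: 'a measure"] by (simp add: sets_measure_of)
  have "space M = UNIV" unfolding M_def by simp
  then show "finite_measure M"
    by (intro finite_measureI) (simp add: em)
  show "measure M A = pos_var \<mu> A" if "A \<in> sets borel" for A
    using em[OF that] pos_var_nonneg by (simp add: measure_def)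
qed

lemma uminus: "bounded_signed_measure (\<lambda>A. - \<mu> A) c"
  by unfold_locales (auto intro: sums_minus sums bound)

text \<open>No Hahn set is used: \<open>\<mu> B = \<mu> A + \<mu> (B - A)\<close> exchanges test
  sets for the positive and negative variation, so the two differ by \<open>\<mu> B\<close>.\<close>

lemma jordan:
  obtains P N where "finite_measure P" "sets P = sets borel" "finite_measure N" "sets N = sets borel"
    "\<And>A. A \<in> sets borel \<Longrightarrow> measure P A - measure N A = \<mu> A"
    "\<And>f. signed_integral \<mu> f = (\<integral>x. f x \<partial>P) - (\<integral>x. f x \<partial>N)"
proof -
  interpret neg: bounded_signed_measure "\<lambda>A. - \<mu> A" c by (rule uminus)
  have neg_eq: "neg_var \<mu> = pos_var (\<lambda>A. - \<mu> A)"
    by (simp add: neg_var_def[abs_def] pos_var_def[abs_def])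
  have diff: "pos_var \<mu> B - pos_var (\<lambda>A. - \<mu> A) B = \<mu> B" if B: "B \<in> sets borel" for B
  proof -
    have split: "\<mu> B = \<mu> A + \<mu> (B - A)" if "A \<in> sets borel" "A \<subseteq> B" for A
    proof -
      have "\<mu> (A \<union> (B - A)) = \<mu> A + \<mu> (B - A)" using that B by (intro Un) auto
      moreover have "A \<union> (B - A) = B" using that by blast
      ultimately show ?thesis by simp
    qed
    have "pos_var \<mu> B \<le> \<mu> B + pos_var (\<lambda>A. - \<mu> A) B"
    proof (rule pos_var_least)
      fix A assume A: "A \<in> sets borel" "A \<subseteq> B"
      then show "\<mu> A \<le> \<mu> B + pos_var (\<lambda>A. - \<mu> A) B"
        using split[OF A] neg.pos_var_upper[of "B - A" B] B by auto
    qed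
    moreover have "pos_var (\<lambda>A. - \<mu> A) B \<le> pos_var \<mu> B - \<mu> B"
    proof (rule neg.pos_var_least)
      fix A assume A: "A \<in> sets borel" "A \<subseteq> B"
      then show "- \<mu> A \<le> pos_var \<mu> B - \<mu> B"
        using split[OF A] pos_var_upper[of "B - A" B] B by auto
    qed
    ultimately show ?thesis by simp
  qed
  show ?thesis
    by (rule that[OF pos_var_measure(1,2) neg.pos_var_measure(1,2)])
      (simp_all add: pos_var_measure(3) neg.pos_var_measure(3) diff signed_integral_def neg_eq)
qed

end

text \<open>\<open>total_var\<close> ranges over sequences that partition the whole space, so a
  finite family is completed by its complement and by empty sets. Here \<open>m\<close> is
  arbitrary; the added terms are dropped merely because norms are nonnegative.\<close>

lemma finite_family_le_total_var:
  fixes A :: "'i \<Rightarrow> 'a::real_normed_vector set"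
  assumes "finite I" "disjoint_family_on A I" "\<And>i. i \<in> I \<Longrightarrow> A i \<in> sets borel"
  shows "ereal (\<Sum>i\<in>I. norm (m (A i))) \<le> total_var m"
proof -
  obtain e where e: "bij_betw e {..<card I} I"
    using ex_bij_betw_nat_finite[OF assms(1)] by (auto simp: atLeast0LessThan)
  define B where "B n = (if n < card I then A (e n) else if n = card I then UNIV - (\<Union>i\<in>I. A i) else {})" for n
  have eI: "e n \<in> I" if "n < card I" for n using e that by (auto simp: bij_betw_def)
  have "range B \<subseteq> sets borel"
    using assms eI by (auto simp: B_def intro!: sets.Diff sets.finite_UN)
  moreover have "disjoint_family B"
    unfolding disjoint_family_on_def
  proof (intro ballI impI)
    fix i j :: nat assume ij: "i \<noteq> j"
    have "A (e i) \<inter> A (e j) = {}" if "i < card I" "j < card I"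
    proof -
      have "e i \<noteq> e j" using e ij that by (auto simp: bij_betw_def inj_on_def)
      then show ?thesis using assms(2) eI that by (auto simp: disjoint_family_on_def)
    qed
    then show "B i \<inter> B j = {}" using eI ij by (auto simp: B_def)
  qed
  moreover have "\<Union>(range B) = UNIV"
  proof -
    have "x \<in> \<Union>(range B)" for x
    proof (cases "x \<in> (\<Union>i\<in>I. A i)")
      case True
      then obtain i where "i \<in> I" "x \<in> A i" by blast
      moreover have "e ` {..<card I} = I" using e by (simp add: bij_betw_def)
      ultimately have "i \<in> e ` {..<card I}" by simp
      then obtain n where "n < card I" "e n = i" by (rule imageE) simp
      then have "x \<in> B n" using \<open>x \<in> A i\<close> by (simp add: B_def)
      then show ?thesis by blast
    next
      case False
      then have "x \<in> B (card I)" by (simp add: B_def)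
      then show ?thesis by blast
    qed
    then show ?thesis by blast
  qed
  ultimately have "(\<Sum>n. ereal (norm (m (B n)))) \<le> total_var m"
    unfolding total_var_def by (intro SUP_upper) auto
  moreover have "(\<Sum>n<card I. ereal (norm (m (B n)))) \<le> (\<Sum>n. ereal (norm (m (B n))))"
    by (intro suminf_upper) simp
  moreover have "(\<Sum>n<card I. ereal (norm (m (B n)))) = ereal (\<Sum>i\<in>I. norm (m (A i)))"
  proof -
    have "(\<Sum>n<card I. norm (m (B n))) = (\<Sum>n<card I. norm (m (A (e n))))"
      by (intro sum.cong) (auto simp: B_def)
    also have "\<dots> = (\<Sum>i\<in>I. norm (m (A i)))"
      by (rule sum.reindex_bij_betw[OF e])
    finally show ?thesis by simp
  qed
  ultimately show ?thesis by simp
qed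

lemma vec_measure_component:
  fixes m :: "'a::real_inner set \<Rightarrow> 'a"
  assumes "vec_measure m"
  obtains c where "bounded_signed_measure (\<lambda>B. m B \<bullet> z) c"
proof -
  obtain T where T: "total_var m \<le> ereal T"
    using assms unfolding vec_measure_def by (cases "total_var m") auto
  have "bounded_signed_measure (\<lambda>B. m B \<bullet> z) (T * norm z)"
  proof
    fix B :: "nat \<Rightarrow> 'a set" assume "range B \<subseteq> sets borel" "disjoint_family B"
    then have "(\<lambda>n. m (B n)) sums m (\<Union>(range B))"
      using assms unfolding vec_measure_def by blast
    then show "(\<lambda>n. m (B n) \<bullet> z) sums (m (\<Union>(range B)) \<bullet> z)"
      by (rule bounded_linear.sums[OF bounded_linear_inner_left])
  next
    fix A :: "'a set" assume "A \<in> sets borel"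
    then have "ereal (norm (m A)) \<le> total_var m"
      using finite_family_le_total_var[of "{()}" "\<lambda>_. A" m] by (simp add: disjoint_family_on_def)
    then have "norm (m A) \<le> T" using T order_trans ereal_less_eq(3) by metis
    then show "\<bar>m A \<bullet> z\<bar> \<le> T * norm z"
      by (intro order_trans[OF Cauchy_Schwarz_ineq2] mult_right_mono) auto
  qed
  then show ?thesis by (rule that)
qed

section \<open>Vector fields and the variation\<close>

lemma integral_measure_diff_le:
  fixes f :: "'a::topological_space \<Rightarrow> real"
  assumes M: "finite_measure M" "sets M = sets borel" and f: "f \<in> borel_measurable borel" "\<And>x. 0 \<le> f x" "\<And>x. f x \<le> 1"
    and A: "A \<in> sets borel"
  shows "\<bar>(\<integral>x. f x \<partial>M) - measure M A\<bar> \<le> (\<integral>x. \<bar>f x - indicator A x\<bar> \<partial>M)"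
proof -
  have sp: "space M = UNIV" using sets_eq_imp_space_eq[OF M(2)] by simp
  have i: "integrable M f" "integrable M (indicator A :: 'a \<Rightarrow> real)"
    using f A by (auto intro!: finite_measure_integrable_bounded[OF M, of _ 1] simp: abs_of_nonneg)
  have "(\<integral>x. f x \<partial>M) - measure M A = (\<integral>x. f x - indicator A x \<partial>M)"
    using i A M by (simp add: sp)
  also have "\<bar>\<dots>\<bar> \<le> (\<integral>x. \<bar>f x - indicator A x\<bar> \<partial>M)"
    by (rule integral_abs_bound)
  finally show ?thesis .
qed

section \<open>The functional on fields and lower bounds for the variation\<close>

locale bv_setting =
  fixes nu :: "'a::{real_inner, complete_space, second_countable_topology} measure"
    and R :: "'a \<Rightarrow>\<^sub>L 'a" and v :: "'a \<Rightarrow> 'a \<Rightarrow> real" and u :: "'a \<Rightarrow> real"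
  assumes sets_nu: "sets nu = sets borel"
    and u_int: "integrable nu u"
    and uv_int: "\<And>z. integrable nu (\<lambda>x. u x * v z x)"
begin

abbreviation V :: ereal where "V \<equiv> Vvar nu R v u"

definition Lam :: "'a \<Rightarrow> ('a \<Rightarrow> real) \<Rightarrow> real" where
  "Lam z f = (\<integral>x. u x * (- (blinfun_apply R (grad f x) \<bullet> z) + v z x * f x) \<partial>nu)"

definition represents :: "'a \<Rightarrow> 'a measure \<Rightarrow> 'a measure \<Rightarrow> bool" where
  "represents z P N \<longleftrightarrow> finite_measure P \<and> sets P = sets borel \<and> finite_measure N \<and> sets N = sets borel \<and>
     (\<forall>f. C1b f \<longrightarrow> Lam z f = (\<integral>x. f x \<partial>P) - (\<integral>x. f x \<partial>N))"

definition adj :: "'a \<Rightarrow> 'a" where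
  "adj z = (SOME h. \<forall>w. blinfun_apply R w \<bullet> z = h \<bullet> w)"

lemma adj: "blinfun_apply R w \<bullet> z = w \<bullet> adj z"
proof -
  have "bounded_linear (\<lambda>w. blinfun_apply R w \<bullet> z)"
    by (intro bounded_linear_intros)
  then obtain h where "\<And>w. blinfun_apply R w \<bullet> z = h \<bullet> w"
    using riesz_representation by blast
  then have "\<forall>w. blinfun_apply R w \<bullet> z = adj z \<bullet> w"
    unfolding adj_def by (intro someI[of "\<lambda>h. \<forall>w. blinfun_apply R w \<bullet> z = h \<bullet> w"]) blast
  then show ?thesis by (simp add: inner_commute)
qed

lemma Lam_integrable:
  assumes "C1b f"
  shows "integrable nu (\<lambda>x. u x * v z x * f x - u x * (grad f x \<bullet> adj z))"
proof -
  have mn: "g \<in> borel_measurable nu" if "g \<in> borel_measurable borel" for g :: "'a \<Rightarrow> real"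
    using that measurable_cong_sets[OF sets_nu refl] by blast
  note ld = line_diff_C1b[OF assms, of "adj z"]
  obtain K where K: "0 < K" "\<And>x. \<bar>f x\<bar> \<le> K" "\<And>x. \<bar>grad f x \<bullet> adj z\<bar> \<le> K"
    using line_diff_bound[OF ld] by blast
  show ?thesis
    by (rule Bochner_Integration.integrable_diff[OF
        integrable_mult_bounded[OF uv_int mn[OF line_diff_measurable(1)[OF ld]] K(2)]
        integrable_mult_bounded[OF u_int mn[OF line_diff_measurable(2)[OF ld]] K(3)]])
qed

lemma Lam_integrand:
  "u x * (- (blinfun_apply R (grad f x) \<bullet> z) + v z x * f x) = u x * v z x * f x - u x * (grad f x \<bullet> adj z)"
  by (simp add: adj algebra_simps)

lemma Lam_cmult:
  assumes "C1b f"
  shows "Lam z (\<lambda>x. c * f x) = c * Lam z f"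
proof -
  have "Lam z (\<lambda>x. c * f x) = (\<integral>x. c * (u x * (- (blinfun_apply R (grad f x) \<bullet> z) + v z x * f x)) \<partial>nu)"
    unfolding Lam_def C1b_cmult(2)[OF assms] by (simp add: blinfun.scaleR_right algebra_simps)
  then show ?thesis unfolding Lam_def by simp
qed

lemma integral_Mstar:
  assumes "\<And>f z. (f, z) \<in> set Fs \<Longrightarrow> C1b f"
  shows "(\<integral>x. u x * Mstar R v Fs x \<partial>nu) = (\<Sum>(f, z)\<leftarrow>Fs. Lam z f)
     \<and> integrable nu (\<lambda>x. u x * Mstar R v Fs x)"
  using assms
proof (induction Fs)
  case Nil
  then show ?case by (simp add: Mstar_def)
next
  case (Cons p Fs)
  obtain f z where p: "p = (f, z)" by (cases p)
  have f: "C1b f" using Cons.prems p by auto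
  have IH: "(\<integral>x. u x * Mstar R v Fs x \<partial>nu) = (\<Sum>(f, z)\<leftarrow>Fs. Lam z f)"
    "integrable nu (\<lambda>x. u x * Mstar R v Fs x)"
    using Cons by auto
  have split: "u x * Mstar R v (p # Fs) x =
      u x * (- (blinfun_apply R (grad f x) \<bullet> z) + v z x * f x) + u x * Mstar R v Fs x" for x
    by (simp add: Mstar_def p distrib_left)
  have i: "integrable nu (\<lambda>x. u x * (- (blinfun_apply R (grad f x) \<bullet> z) + v z x * f x))"
    unfolding Lam_integrand by (rule Lam_integrable[OF f])
  show ?case
    unfolding split using Bochner_Integration.integrable_add[OF i IH(2)]
      Bochner_Integration.integral_add[OF i IH(2)] by (simp add: IH(1) p Lam_def)
qed

lemma fields_le_V:
  assumes "\<And>f z. (f, z) \<in> set Fs \<Longrightarrow> C1b f" "\<And>x. norm (vfield Fs x) \<le> 1"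
  shows "ereal (\<Sum>(f, z)\<leftarrow>Fs. Lam z f) \<le> V"
proof -
  have "ereal (\<integral>x. u x * Mstar R v Fs x \<partial>nu) \<le> V"
    unfolding Vvar_def by (rule SUP_upper) (use assms in auto)
  then show ?thesis using integral_Mstar[OF assms(1)] by simp
qed

lemma V_nonneg: "0 \<le> V"
  using fields_le_V[of "[]"] by (simp add: vfield_def zero_ereal_def)

text \<open>The step field equal to \<open>z i\<close> on \<open>B i\<close> is approximated by the
  sum of the \<open>f i *\<^sub>R z i\<close>; since the nonnegative coefficients sum to at most 1,
  the field is admissible in \<open>V\<close>.\<close>

lemma partition_sum_le_V:
  assumes rep: "\<And>i. i < n \<Longrightarrow> represents (z i) (P i) (N i)"
    and z: "\<And>i. i < n \<Longrightarrow> norm (z i) \<le> 1"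
    and B: "\<And>i. i < n \<Longrightarrow> B i \<in> sets borel" and disj: "disjoint_family_on B {..<n::nat}"
  shows "ereal (\<Sum>i<n. measure (P i) (B i) - measure (N i) (B i)) \<le> V"
proof (rule ereal_le_epsilon2)
  fix e :: real assume e: "0 < e"
  \<comment> \<open>Each of the \<open>n\<close> sets contributes two errors, one for
    \<open>P i\<close> and one for \<open>N i\<close>; the added 1 covers
    \<open>n = 0\<close>.\<close>
  define d where "d = e / (2 * real n + 1)"
  have d: "0 < d" "2 * real n * d \<le> e" using e by (auto simp: d_def field_simps)
  have fin: "finite_measure (P i)" "sets (P i) = sets borel" "finite_measure (N i)" "sets (N i) = sets borel"
    if "i < n" for i
    using rep[OF that] by (auto simp: represents_def)
  interpret finite_borel_measures "P ` {..<n} \<union> N ` {..<n}"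
    by (rule finite_borel_measures_images) (simp_all only: fin lessThan_iff finite_lessThan)
  show "ereal (\<Sum>i<n. measure (P i) (B i) - measure (N i) (B i)) \<le> V + ereal e"
  proof (rule approx_partition[OF B disj d(1)])
    fix f assume f: "\<And>i. i < n \<Longrightarrow> C1b (f i)" "\<And>i x. i < n \<Longrightarrow> 0 \<le> f i x" "\<And>x. (\<Sum>i<n. f i x) \<le> 1"
      "\<And>i M. \<lbrakk>i < n; M \<in> P ` {..<n} \<union> N ` {..<n}\<rbrakk> \<Longrightarrow> (\<integral>x. \<bar>f i x - indicator (B i) x\<bar> \<partial>M) < d"
    have f1: "f i x \<le> 1" if "i < n" for i x
    proof -
      have "f i x \<le> (\<Sum>i<n. f i x)" using that f(2) by (intro member_le_sum) auto
      then show ?thesis using f(3)[of x] by simp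
    qed
    have le: "measure (P i) (B i) - measure (N i) (B i) \<le> Lam (z i) (f i) + 2 * d" if i: "i < n" for i
    proof -
      have "\<bar>(\<integral>x. f i x \<partial>M) - measure M (B i)\<bar> < d" if "M \<in> {P i, N i}" for M
        using that f(4)[OF i, of M] i fin[OF i]
        by (intro le_less_trans[OF integral_measure_diff_le[OF _ _ C1b_measurable[OF f(1)[OF i]] f(2)[OF i] f1[OF i] B[OF i]]]) auto
      from this[of "P i"] this[of "N i"]
      have "\<bar>(\<integral>x. f i x \<partial>P i) - measure (P i) (B i)\<bar> < d" "\<bar>(\<integral>x. f i x \<partial>N i) - measure (N i) (B i)\<bar> < d"
        by simp_all
      moreover have "Lam (z i) (f i) = (\<integral>x. f i x \<partial>P i) - (\<integral>x. f i x \<partial>N i)"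
        using rep[OF i] f(1)[OF i] by (simp add: represents_def)
      ultimately show ?thesis by linarith
    qed
    define Fs where "Fs = map (\<lambda>i. (f i, z i)) [0..<n]"
    have "ereal (\<Sum>(f, z)\<leftarrow>Fs. Lam z f) \<le> V"
    proof (rule fields_le_V)
      show "C1b g" if "(g, y) \<in> set Fs" for g y using that f(1) by (auto simp: Fs_def)
      fix x
      have "vfield Fs x = (\<Sum>i<n. f i x *\<^sub>R z i)"
        unfolding vfield_def Fs_def
        by (simp add: o_def interv_sum_list_conv_sum_set_nat atLeast0LessThan)
      also have "norm \<dots> \<le> (\<Sum>i<n. f i x)"
        using f(2) z by (intro order_trans[OF norm_sum] sum_mono) (simp add: mult_left_le)
      finally show "norm (vfield Fs x) \<le> 1" using f(3)[of x] by simp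
    qed
    then have V: "ereal (\<Sum>i<n. Lam (z i) (f i)) \<le> V"
      by (simp add: Fs_def o_def interv_sum_list_conv_sum_set_nat atLeast0LessThan)
    have "(\<Sum>i<n. measure (P i) (B i) - measure (N i) (B i)) \<le> (\<Sum>i<n. Lam (z i) (f i) + 2 * d)"
      using le by (intro sum_mono) auto
    also have "\<dots> = (\<Sum>i<n. Lam (z i) (f i)) + 2 * real n * d"
      by (simp add: sum.distrib)
    finally have "ereal (\<Sum>i<n. measure (P i) (B i) - measure (N i) (B i)) \<le> ereal (\<Sum>i<n. Lam (z i) (f i)) + ereal e"
      using d(2) by simp
    also have "\<dots> \<le> V + ereal e" by (intro add_right_mono V)
    finally show "ereal (\<Sum>i<n. measure (P i) (B i) - measure (N i) (B i)) \<le> V + ereal e" .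
  qed
qed

text \<open>The optimal direction on \<open>B i\<close> is \<open>sgn (m (B i))\<close>, whose inner
  product with \<open>m (B i)\<close> is the norm. Countable additivity of \<open>m\<close> is not
  assumed, because this bound later serves to prove it.\<close>

lemma norm_sum_le_V:
  assumes rep: "\<And>z. represents z (P z) (N z)"
    and m: "\<And>z A. A \<in> sets borel \<Longrightarrow> m A \<bullet> z = measure (P z) A - measure (N z) A"
    and B: "\<And>i. i < n \<Longrightarrow> B i \<in> sets borel" "disjoint_family_on B {..<n::nat}"
  shows "ereal (\<Sum>i<n. norm (m (B i))) \<le> V"
proof -
  have "ereal (\<Sum>i<n. measure (P (sgn (m (B i)))) (B i) - measure (N (sgn (m (B i)))) (B i)) \<le> V"
    using B by (intro partition_sum_le_V[where z = "\<lambda>i. sgn (m (B i))"] rep) (auto simp: norm_sgn)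
  moreover have "measure (P (sgn (m (B i)))) (B i) - measure (N (sgn (m (B i)))) (B i) = norm (m (B i))" if "i < n" for i
  proof -
    have "m (B i) \<bullet> sgn (m (B i)) = norm (m (B i))"
      by (cases "m (B i) = 0") (simp_all add: sgn_div_norm power2_eq_square flip: power2_norm_eq_inner)
    then show ?thesis using m[OF B(1)[OF that]] by metis
  qed
  ultimately show ?thesis by simp
qed

lemma total_var_le_V:
  assumes rep: "\<And>z. represents z (P z) (N z)"
    and m: "\<And>z A. A \<in> sets borel \<Longrightarrow> m A \<bullet> z = measure (P z) A - measure (N z) A"
  shows "total_var m \<le> V"
  unfolding total_var_def
proof (rule SUP_least)
  fix B :: "nat \<Rightarrow> 'a set"
  assume "B \<in> {B. range B \<subseteq> sets borel \<and> disjoint_family B \<and> \<Union> (range B) = UNIV}"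
  then have B: "\<And>i. B i \<in> sets borel" "\<And>n. disjoint_family_on B {..<n}"
    by (auto simp: disjoint_family_on_def)
  show "(\<Sum>n. ereal (norm (m (B n)))) \<le> V"
  proof (rule suminf_bound)
    show "\<forall>n. (\<Sum>i<n. ereal (norm (m (B i)))) \<le> V"
      using norm_sum_le_V[OF rep m B(1) B(2)] by simp
  qed simp
qed

end

text \<open>Indexes the cell of \<open>x\<close> in the partition by coefficient values at mesh
  \<open>1 / n\<close>. Since the coefficients are bounded there are finitely many cells, which
  gives uniform approximation by step functions without compactness.\<close>

definition grid_key :: "nat \<Rightarrow> (('a \<Rightarrow> real) \<times> 'b) list \<Rightarrow> 'a \<Rightarrow> int list" where
  "grid_key n Fs x = map (\<lambda>(f, z). \<lfloor>real n * f x\<rfloor>) Fs"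

lemma grid_key_close:
  assumes "(f, z) \<in> set Fs" "grid_key n Fs x = grid_key n Fs y" "0 < n"
  shows "\<bar>f x - f y\<bar> \<le> inverse (real n)"
proof -
  have "\<lfloor>real n * f x\<rfloor> = \<lfloor>real n * f y\<rfloor>"
    using assms(1,2) unfolding grid_key_def by (auto simp: map_eq_conv)
  then have "\<bar>real n * f x - real n * f y\<bar> \<le> 1" by linarith
  then have "real n * \<bar>f x - f y\<bar> \<le> 1"
    by (simp add: abs_mult flip: right_diff_distrib)
  then show ?thesis using assms(3) by (simp add: field_simps)
qed

lemma finite_range_grid_key:
  fixes Fs :: "(('a::real_inner \<Rightarrow> real) \<times> 'b) list"
  assumes "\<And>f z. (f, z) \<in> set Fs \<Longrightarrow> C1b f"
  shows "finite (range (grid_key n Fs))"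
  using assms
proof (induction Fs)
  case Nil
  then show ?case by (simp add: grid_key_def)
next
  case (Cons p Fs)
  obtain f z where p: "p = (f, z)" by (cases p)
  then have f: "C1b f" using Cons.prems by auto
  obtain K where K: "0 < K" "\<And>x. \<bar>f x\<bar> \<le> K" "\<And>x. norm (grad f x) \<le> K"
    using C1b_bound[OF f] by blast
  have "\<lfloor>real n * f x\<rfloor> \<in> {\<lfloor>- (real n * K)\<rfloor>..\<lfloor>real n * K\<rfloor>}" for x
  proof -
    have "f x \<le> K" "- K \<le> f x" using K(2)[of x] by auto
    then have "real n * f x \<le> real n * K" "real n * (- K) \<le> real n * f x"
      by (intro mult_left_mono; simp)+
    then show ?thesis by (auto intro!: floor_mono)
  qed
  then have "finite (range (\<lambda>x. \<lfloor>real n * f x\<rfloor>))"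
    by (intro finite_subset[OF _ finite_atLeastAtMost_int]) blast
  moreover have "finite (range (grid_key n Fs))" using Cons by auto
  ultimately have "finite ((\<lambda>(a, b). a # b) ` (range (\<lambda>x. \<lfloor>real n * f x\<rfloor>) \<times> range (grid_key n Fs)))"
    by blast
  moreover have "range (grid_key n (p # Fs)) \<subseteq> \<dots>"
    by (auto simp: grid_key_def p)
  ultimately show ?case by (rule finite_subset[rotated])
qed

lemma grid_cell_measurable:
  fixes Fs :: "(('a::real_inner \<Rightarrow> real) \<times> 'b) list"
  assumes "\<And>f z. (f, z) \<in> set Fs \<Longrightarrow> C1b f"
  shows "{x. grid_key n Fs x = k} \<in> sets borel"
  using assms
proof (induction Fs arbitrary: k)
  case Nil
  then show ?case by (simp add: grid_key_def)
next
  case (Cons p Fs)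
  obtain f z where p: "p = (f, z)" by (cases p)
  then have [measurable]: "f \<in> borel_measurable borel" using Cons.prems C1b_measurable by auto
  show ?case
  proof (cases k)
    case Nil
    then show ?thesis by (simp add: grid_key_def)
  next
    case (Cons a k')
    have "{x. \<lfloor>real n * f x\<rfloor> = a} \<in> sets borel" by measurable
    moreover have "{x. grid_key n Fs x = k'} \<in> sets borel"
      using Cons.IH Cons.prems by auto
    moreover have "{x. grid_key n (p # Fs) x = k} = {x. \<lfloor>real n * f x\<rfloor> = a} \<inter> {x. grid_key n Fs x = k'}"
      by (auto simp: grid_key_def p Cons)
    ultimately show ?thesis by (simp add: sets.Int)
  qed
qed

text \<open>Replacing each coefficient by a constant on every grid cell turns the sum into inner
  products of \<open>m (A k)\<close> with values of the field, which are at most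
  \<open>norm (m (A k))\<close>.\<close>

lemma field_integral_le_total_var:
  fixes m :: "'a::{real_inner, second_countable_topology} set \<Rightarrow> 'a"
  assumes fin: "\<And>z. finite_measure (P z)" "\<And>z. sets (P z) = sets borel"
      "\<And>z. finite_measure (N z)" "\<And>z. sets (N z) = sets borel"
    and m: "\<And>z A. A \<in> sets borel \<Longrightarrow> m A \<bullet> z = measure (P z) A - measure (N z) A"
    and Fs: "\<And>f z. (f, z) \<in> set Fs \<Longrightarrow> C1b f" "\<And>x. norm (vfield Fs x) \<le> 1"
  shows "ereal (\<Sum>(f, z)\<leftarrow>Fs. (\<integral>x. f x \<partial>P z) - (\<integral>x. f x \<partial>N z)) \<le> total_var m"
proof (cases "total_var m")
  case (real T)
  let ?I = "\<lambda>f z. (\<integral>x. f x \<partial>P z) - (\<integral>x. f x \<partial>N z)"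
  \<comment> \<open>The total mass of all measures involved: each coefficient changes by at most
    \<open>1 / n\<close>, so the total error is at most \<open>c / n\<close>.\<close>
  define c where "c = (\<Sum>(f, z)\<leftarrow>Fs. measure (P z) UNIV + measure (N z) UNIV)"
  have main: "(\<Sum>(f, z)\<leftarrow>Fs. ?I f z) \<le> T + c * inverse (real n)" if n: "0 < n" for n
  proof -
    define S where "S = range (grid_key n Fs)"
    define A where "A k = {x. grid_key n Fs x = k}" for k
    \<comment> \<open>For occupied cells this is a true point of the cell, the same for all
      coefficients; the step field therefore takes values of the original field and inherits its
      norm bound exactly.\<close>
    define y where "y k = (SOME x. grid_key n Fs x = k)" for k
    have finS: "finite S" unfolding S_def by (rule finite_range_grid_key[OF Fs(1)])
    have A_meas: "A k \<in> sets borel" for k unfolding A_def by (rule grid_cell_measurable[OF Fs(1)])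
    have y: "grid_key n Fs (y (grid_key n Fs x)) = grid_key n Fs x" for x
      unfolding y_def by (rule someI[of "\<lambda>x'. grid_key n Fs x' = grid_key n Fs x"]) simp
    have int: "\<bar>(\<integral>x. f x \<partial>M) - (\<Sum>k\<in>S. f (y k) * measure M (A k))\<bar> \<le> measure M UNIV * inverse (real n)"
      if fz: "(f, z) \<in> set Fs" and M: "finite_measure M" "sets M = sets borel" for f z M
    proof -
      have sp: "space M = UNIV" using sets_eq_imp_space_eq[OF M(2)] by simp
      interpret finite_measure M by fact
      have f: "C1b f" using Fs(1) fz by blast
      obtain K where K: "0 < K" "\<And>x. \<bar>f x\<bar> \<le> K" "\<And>x. norm (grad f x) \<le> K"
        using C1b_bound[OF f] by blast
      have i1: "integrable M f"
        by (rule finite_measure_integrable_bounded[OF M C1b_measurable[OF f] K(2)])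
      let ?g = "\<lambda>x. \<Sum>k\<in>S. f (y k) * indicator (A k) x"
      have g: "?g x = f (y (grid_key n Fs x))" for x
      proof -
        have "?g x = (\<Sum>k\<in>S. if k = grid_key n Fs x then f (y k) else 0)"
          by (intro sum.cong) (auto simp: A_def)
        also have "\<dots> = f (y (grid_key n Fs x))"
          using finS by (subst sum.delta) (auto simp: S_def)
        finally show ?thesis .
      qed
      have i2: "integrable M (\<lambda>x. f (y k) * indicator (A k) x)" for k
        using A_meas[of k] M(2) by (intro integrable_mult_right integrable_real_indicator) (auto simp: less_top[symmetric])
      have "(\<integral>x. ?g x \<partial>M) = (\<Sum>k\<in>S. f (y k) * measure M (A k))"
        using A_meas M(2) by (simp add: Bochner_Integration.integral_sum[OF i2] sp)
      then have "(\<integral>x. f x \<partial>M) - (\<Sum>k\<in>S. f (y k) * measure M (A k)) = (\<integral>x. f x - ?g x \<partial>M)"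
        using Bochner_Integration.integral_diff[OF i1 Bochner_Integration.integrable_sum[where I = S, OF i2]] by simp
      also have "\<bar>\<dots>\<bar> \<le> (\<integral>x. \<bar>f x - ?g x\<bar> \<partial>M)" by (rule integral_abs_bound)
      also have "\<dots> \<le> (\<integral>x. inverse (real n) \<partial>M)"
      proof (rule integral_mono)
        show "integrable M (\<lambda>x. \<bar>f x - ?g x\<bar>)"
          by (intro integrable_abs Bochner_Integration.integrable_diff i1 Bochner_Integration.integrable_sum i2)
        show "\<bar>f x - ?g x\<bar> \<le> inverse (real n)" for x
          unfolding g by (rule grid_key_close[OF fz _ n]) (simp add: y)
      qed simp
      finally show ?thesis by (simp add: sp mult.commute)
    qed
    have step: "?I f z \<le> (\<Sum>k\<in>S. f (y k) * (m (A k) \<bullet> z)) + (measure (P z) UNIV + measure (N z) UNIV) * inverse (real n)"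
      if fz: "(f, z) \<in> set Fs" for f z
    proof -
      have "(\<Sum>k\<in>S. f (y k) * (m (A k) \<bullet> z)) = (\<Sum>k\<in>S. f (y k) * measure (P z) (A k)) - (\<Sum>k\<in>S. f (y k) * measure (N z) (A k))"
        by (simp add: m[OF A_meas] right_diff_distrib sum_subtractf)
      then show ?thesis
        using int[OF fz fin(1,2)[of z]] int[OF fz fin(3,4)[of z]] by (simp add: distrib_right)
    qed
    \<comment> \<open>Stated for lists of pairs from \<open>Fs\<close> to allow induction; the norm
      bound holds only for the full field and is applied afterwards.\<close>
    have sum_list_le: "(\<Sum>(f, z)\<leftarrow>Gs. ?I f z) \<le> (\<Sum>k\<in>S. m (A k) \<bullet> vfield Gs (y k))
        + (\<Sum>(f, z)\<leftarrow>Gs. measure (P z) UNIV + measure (N z) UNIV) * inverse (real n)"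
      if "set Gs \<subseteq> set Fs" for Gs
      using that
    proof (induction Gs)
      case (Cons q Gs)
      obtain f z where q: "q = (f, z)" by (cases q)
      have "m (A k) \<bullet> vfield (q # Gs) (y k) = f (y k) * (m (A k) \<bullet> z) + m (A k) \<bullet> vfield Gs (y k)" for k
        by (simp add: vfield_def q inner_add_right)
      then show ?case
        using Cons step[of f z] by (simp add: q sum.distrib distrib_right)
    qed (simp add: vfield_def)
    have "(\<Sum>k\<in>S. m (A k) \<bullet> vfield Fs (y k)) \<le> (\<Sum>k\<in>S. norm (m (A k)))"
    proof (rule sum_mono)
      fix k
      have "m (A k) \<bullet> vfield Fs (y k) \<le> norm (m (A k)) * norm (vfield Fs (y k))"
        by (rule norm_cauchy_schwarz)
      also have "\<dots> \<le> norm (m (A k))" using Fs(2) by (simp add: mult_left_le)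
      finally show "m (A k) \<bullet> vfield Fs (y k) \<le> norm (m (A k))" .
    qed
    also have "\<dots> \<le> T"
      using finite_family_le_total_var[OF finS, of A m] A_meas real
      by (auto simp: disjoint_family_on_def A_def)
    finally show ?thesis using sum_list_le[of Fs] by (simp add: c_def)
  qed
  have "(\<lambda>n. T + c * inverse (real n)) \<longlonglongrightarrow> T + c * 0"
    by (intro tendsto_intros lim_inverse_n)
  then have "(\<Sum>(f, z)\<leftarrow>Fs. ?I f z) \<le> T + c * 0"
    using main by (intro LIMSEQ_le_const[OF _ exI[of _ 1]]) auto
  then show ?thesis using real by simp
next
  case MInf
  have "ereal (\<Sum>i\<in>{}. norm (m {})) \<le> total_var m"
    by (rule finite_family_le_total_var) (auto simp: disjoint_family_on_def)
  then show ?thesis using MInf by simp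
qed simp

text \<open>Young's inequality bounds the product by an integrable function.\<close>

lemma integrable_mult_Lp:
  assumes p: "1 < p" "1 < q" "1 / p + 1 / q = 1" and u: "Lp M p u" and w: "Lp M q w"
  shows "integrable M (\<lambda>x. u x * w x)"
proof (rule Bochner_Integration.integrable_bound)
  show "integrable M (\<lambda>x. \<bar>u x\<bar> powr p / p + \<bar>w x\<bar> powr q / q)"
    using u w by (auto simp: Lp_def)
  show "(\<lambda>x. u x * w x) \<in> borel_measurable M"
    using u w by (auto simp: Lp_def)
  have "\<bar>u x\<bar> * \<bar>w x\<bar> \<le> \<bar>\<bar>u x\<bar> powr p / p + \<bar>w x\<bar> powr q / q\<bar>" for x
    using Youngs_inequality[OF p, of "\<bar>u x\<bar>" "\<bar>w x\<bar>"] by simp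
  then show "AE x in M. norm (u x * w x) \<le> norm (\<bar>u x\<bar> powr p / p + \<bar>w x\<bar> powr q / q)"
    by (simp add: abs_mult)
qed

section \<open>Equality of variation and total variation for a representing measure\<close>

context bv_setting
begin

text \<open>The Jordan pairs of the components of \<open>m\<close> represent \<open>Lam\<close>, so
  the step-field bounds apply in both directions. Finiteness of \<open>V\<close> is not presupposed;
  it follows from that of \<open>total_var m\<close>.\<close>

lemma total_var_eq_V:
  assumes m: "vec_measure m" and repr: "BV_repr nu R v u m"
  shows "total_var m = V"
proof -
  have "\<exists>P N. finite_measure P \<and> sets P = sets borel \<and> finite_measure N \<and> sets N = sets borel \<and>
      (\<forall>A\<in>sets borel. measure P A - measure N A = m A \<bullet> z) \<and>
      (\<forall>f. signed_integral (\<lambda>B. m B \<bullet> z) f = (\<integral>x. f x \<partial>P) - (\<integral>x. f x \<partial>N))" for z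
  proof -
    obtain c where "bounded_signed_measure (\<lambda>B. m B \<bullet> z) c"
      using vec_measure_component[OF m] by blast
    then interpret bounded_signed_measure "\<lambda>B. m B \<bullet> z" c .
    show ?thesis by (rule jordan) blast
  qed
  then obtain P N where PN: "\<And>z. finite_measure (P z)" "\<And>z. sets (P z) = sets borel"
      "\<And>z. finite_measure (N z)" "\<And>z. sets (N z) = sets borel"
    and mz: "\<And>z A. A \<in> sets borel \<Longrightarrow> m A \<bullet> z = measure (P z) A - measure (N z) A"
    and si: "\<And>z f. signed_integral (\<lambda>B. m B \<bullet> z) f = (\<integral>x. f x \<partial>P z) - (\<integral>x. f x \<partial>N z)"
    by metis
  have Lam: "Lam z f = (\<integral>x. f x \<partial>P z) - (\<integral>x. f x \<partial>N z)" if "C1b f" for z f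
  proof -
    have "Lam z f = (\<integral>x. - (u x * (blinfun_apply R (grad f x) \<bullet> z - v z x * f x)) \<partial>nu)"
      unfolding Lam_def by (rule Bochner_Integration.integral_cong) (simp_all add: algebra_simps)
    also have "\<dots> = - (\<integral>x. u x * (blinfun_apply R (grad f x) \<bullet> z - v z x * f x) \<partial>nu)"
      by (rule integral_minus)
    finally show ?thesis using repr that by (simp add: BV_repr_def si)
  qed
  have rep: "represents z (P z) (N z)" for z
    unfolding represents_def using PN Lam by simp
  show ?thesis
  proof (rule antisym)
    show "total_var m \<le> V" by (rule total_var_le_V[OF rep mz])
    show "V \<le> total_var m"
      unfolding Vvar_def
    proof (rule SUP_least)
      fix Fs :: "(('a \<Rightarrow> real) \<times> 'a) list"
      assume "Fs \<in> {Fs. (\<forall>(f, z)\<in>set Fs. C1b f) \<and> (\<forall>x. norm (vfield Fs x) \<le> 1)}"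
      then have Fs: "\<And>f z. (f, z) \<in> set Fs \<Longrightarrow> C1b f" "\<And>x. norm (vfield Fs x) \<le> 1"
        by auto
      have "(\<integral>x. u x * Mstar R v Fs x \<partial>nu) = (\<Sum>(f, z)\<leftarrow>Fs. Lam z f)"
        by (rule conjunct1[OF integral_Mstar]) (rule Fs(1))
      also have "\<dots> = (\<Sum>(f, z)\<leftarrow>Fs. (\<integral>x. f x \<partial>P z) - (\<integral>x. f x \<partial>N z))"
        using Fs(1) Lam by (intro arg_cong[where f = sum_list] map_cong) auto
      finally show "ereal (\<integral>x. u x * Mstar R v Fs x \<partial>nu) \<le> total_var m"
        using field_integral_le_total_var[OF PN mz Fs] by simp
    qed
  qed
qed

end

section \<open>Construction of the vector measure from finite variation\<close>

locale finite_variation = bv_setting +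
  fixes T :: real
  assumes V_eq: "V = ereal T"
begin

lemma T_nonneg: "0 \<le> T"
  using V_nonneg V_eq by simp

text \<open>The fields \<open>c f z\<close> with \<open>c\<close> equal to plus or minus
  \<open>1 / (norm z + 1)\<close> are admissible; the added 1 avoids a case distinction at
  \<open>z = 0\<close>.\<close>

lemma Lam_bound:
  assumes "C1b f" "\<And>x. 0 \<le> f x" "\<And>x. f x \<le> 1"
  shows "\<bar>Lam z f\<bar> \<le> T * (norm z + 1)"
proof -
  have "c * Lam z f \<le> T" if c: "\<bar>c\<bar> * norm z \<le> 1" for c
  proof -
    have "ereal (\<Sum>(f, z)\<leftarrow>[(\<lambda>x. c * f x, z)]. Lam z f) \<le> V"
    proof (rule fields_le_V)
      show "C1b g" if "(g, y) \<in> set [(\<lambda>x. c * f x, z)]" for g y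
        using that C1b_cmult(1)[OF assms(1)] by simp
      fix x
      have "f x * (\<bar>c\<bar> * norm z) \<le> 1 * 1" using assms c by (intro mult_mono) auto
      then show "norm (vfield [(\<lambda>x. c * f x, z)] x) \<le> 1"
        using assms(2)[of x] by (simp add: vfield_def abs_mult abs_of_nonneg ac_simps)
    qed
    then show ?thesis by (simp add: V_eq Lam_cmult[OF assms(1)])
  qed
  note c = this
  have pos: "0 < norm z + 1" by (simp add: add_nonneg_pos)
  have "norm z * inverse (norm z + 1) \<le> (norm z + 1) * inverse (norm z + 1)"
    using pos by (intro mult_right_mono) auto
  then have le1: "\<bar>inverse (norm z + 1)\<bar> * norm z \<le> 1"
    using pos by (simp add: abs_of_pos mult.commute)
  have "inverse (norm z + 1) * Lam z f \<le> T" "- inverse (norm z + 1) * Lam z f \<le> T"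
    using le1 by (intro c; simp)+
  then show ?thesis using pos by (simp add: abs_le_iff field_simps)
qed

text \<open>A field that vanishes identically may be scaled arbitrarily, so finiteness of the variation
  forces its integral to be zero. This makes \<open>Lam\<close> linear in the direction even though
  \<open>v\<close> is only given pointwise.\<close>
lemma null_field:
  assumes C: "\<And>f z. (f, z) \<in> set Fs \<Longrightarrow> C1b f" and null: "\<And>x. vfield Fs x = 0"
  shows "(\<Sum>(f, z)\<leftarrow>Fs. Lam z f) = 0"
proof (rule ccontr)
  define D where "D = (\<Sum>(f, z)\<leftarrow>Fs. Lam z f)"
  assume "(\<Sum>(f, z)\<leftarrow>Fs. Lam z f) \<noteq> 0"
  then have D: "D \<noteq> 0" by (simp add: D_def)
  \<comment> \<open>Scaled so that the integral of the null field becomes \<open>T + 1\<close>,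
    above the supremum \<open>T\<close>.\<close>
  let ?c = "(T + 1) / D"
  define G where "G = map (\<lambda>(f, z). (\<lambda>x. ?c * f x, z)) Fs"
  have scaled: "vfield (map (\<lambda>(f, z). (\<lambda>x. c * f x, z)) H) x = c *\<^sub>R vfield H x" for c H and x :: 'a
    unfolding vfield_def by (induction H) (auto simp: scaleR_add_right)
  have G0: "vfield G x = 0" for x unfolding G_def scaled null by simp
  have scaled_Lam: "(\<Sum>(f, z)\<leftarrow>map (\<lambda>(f, z). (\<lambda>x. c * f x, z)) H. Lam z f) = c * (\<Sum>(f, z)\<leftarrow>H. Lam z f)"
    if "\<And>f z. (f, z) \<in> set H \<Longrightarrow> C1b f" for c H
    using that
  proof (induction H)
    case (Cons q H)
    obtain f z where q: "q = (f, z)" by (cases q)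
    have "C1b f" using Cons.prems[of f z] q by simp
    moreover have "(\<Sum>(f, z)\<leftarrow>map (\<lambda>(f, z). (\<lambda>x. c * f x, z)) H. Lam z f) = c * (\<Sum>(f, z)\<leftarrow>H. Lam z f)"
      using Cons.prems by (intro Cons.IH) auto
    ultimately show ?case by (simp add: q Lam_cmult distrib_left)
  qed simp
  have "(\<Sum>(f, z)\<leftarrow>G. Lam z f) = ?c * D"
    unfolding G_def D_def by (rule scaled_Lam) (rule C)
  moreover have "ereal (\<Sum>(f, z)\<leftarrow>G. Lam z f) \<le> V"
  proof (rule fields_le_V)
    show "C1b g" if "(g, y) \<in> set G" for g y
    proof -
      obtain f where "(f, y) \<in> set Fs" "g = (\<lambda>x. ?c * f x)"
        using \<open>(g, y) \<in> set G\<close> by (auto simp: G_def)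
      then show ?thesis using C1b_cmult(1)[OF C] by blast
    qed
    show "norm (vfield G x) \<le> 1" for x
      by (simp add: G0)
  qed
  ultimately show False using D by (simp add: V_eq)
qed

text \<open>The field with coefficients \<open>f\<close>, \<open>-f\<close>, \<open>-f\<close> in
  the directions \<open>z + w\<close>, \<open>z\<close>, \<open>w\<close> vanishes
  identically.\<close>

lemma Lam_add:
  assumes f: "C1b f"
  shows "Lam (z + w) f = Lam z f + Lam w f"
proof -
  have "(\<Sum>(f, z)\<leftarrow>[(f, z + w), (\<lambda>x. -1 * f x, z), (\<lambda>x. -1 * f x, w)]. Lam z f) = 0"
    by (rule null_field) (use f C1b_cmult(1)[OF f, of "-1"] in \<open>auto simp: vfield_def scaleR_add_right\<close>)
  then show ?thesis using Lam_cmult[OF f, of _ "-1"] by simp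
qed

lemma Lam_scaleR:
  assumes f: "C1b f"
  shows "Lam (a *\<^sub>R z) f = a * Lam z f"
proof -
  have "(\<Sum>(f, z)\<leftarrow>[(f, a *\<^sub>R z), (\<lambda>x. - a * f x, z)]. Lam z f) = 0"
    by (rule null_field) (use f C1b_cmult(1)[OF f, of "- a"] in \<open>auto simp: vfield_def\<close>)
  then show ?thesis using Lam_cmult[OF f, of _ "- a"] by simp
qed

lemma represents_exists: "\<exists>P N. represents z P N"
proof -
  interpret line_functional nu "adj z" u "\<lambda>x. u x * v z x" "T * (norm z + 1)"
  proof
    fix f :: "'a \<Rightarrow> real" assume "C1b f" "\<And>x. 0 \<le> f x" "\<And>x. f x \<le> 1"
    then show "\<bar>\<integral>x. u x * v z x * f x - u x * (grad f x \<bullet> adj z) \<partial>nu\<bar> \<le> T * (norm z + 1)"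
      using Lam_bound[of f z] unfolding Lam_def Lam_integrand by blast
  qed (use sets_nu u_int uv_int in auto)
  show ?thesis
  proof (rule signed_representation)
    fix P N assume "finite_measure P" "sets P = sets borel" "finite_measure N" "sets N = sets borel"
      "\<And>f. C1b f \<Longrightarrow> (\<integral>x. u x * v z x * f x - u x * (grad f x \<bullet> adj z) \<partial>nu) = (\<integral>x. f x \<partial>P) - (\<integral>x. f x \<partial>N)"
    then have "represents z P N"
      unfolding represents_def Lam_def Lam_integrand by simp
    then show ?thesis by blast
  qed
qed

definition Pm :: "'a \<Rightarrow> 'a measure" where "Pm z = (SOME P. \<exists>N. represents z P N)"

definition Nm :: "'a \<Rightarrow> 'a measure" where "Nm z = (SOME N. represents z (Pm z) N)"

lemma represents: "represents z (Pm z) (Nm z)"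
  unfolding Nm_def Pm_def using someI_ex[OF someI_ex[OF represents_exists]] .

definition mu :: "'a \<Rightarrow> 'a set \<Rightarrow> real" where
  "mu z A = measure (Pm z) A - measure (Nm z) A"

text \<open>\<open>Pm z\<close> and \<open>Nm z\<close> are chosen for each \<open>z\<close>
  independently. One function close to the indicator of \<open>A\<close> for all directions in
  \<open>Z\<close> carries the linear relations of \<open>Lam\<close> over to
  \<open>mu\<close>.\<close>

lemma mu_approx:
  assumes Z: "finite Z" and A: "A \<in> sets borel" and e: "0 < e"
  shows "\<exists>f. C1b f \<and> (\<forall>x. 0 \<le> f x \<and> f x \<le> 1) \<and> (\<forall>z\<in>Z. \<bar>Lam z f - mu z A\<bar> < e)"
proof -
  have fin: "finite_measure (Pm z)" "sets (Pm z) = sets borel" "finite_measure (Nm z)" "sets (Nm z) = sets borel" for z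
    using represents[of z] by (auto simp: represents_def)
  interpret finite_borel_measures "Pm ` Z \<union> Nm ` Z"
    by (rule finite_borel_measures_images[OF Z fin])
  have e2: "0 < e / 2" using e by simp
  obtain f where f: "C1b f" "\<And>x. 0 \<le> f x" "\<And>x. f x \<le> 1"
    "\<And>M. M \<in> Pm ` Z \<union> Nm ` Z \<Longrightarrow> (\<integral>x. \<bar>f x - indicator A x\<bar> \<partial>M) < e / 2"
    using approx_indicator[OF A e2] by blast
  have "\<bar>Lam z f - mu z A\<bar> < e" if z: "z \<in> Z" for z
  proof -
    have "\<bar>(\<integral>x. f x \<partial>Pm z) - measure (Pm z) A\<bar> < e / 2"
      by (rule le_less_trans[OF integral_measure_diff_le[OF fin(1,2) C1b_measurable[OF f(1)] f(2,3) A] f(4)]) (use z in blast)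
    moreover have "\<bar>(\<integral>x. f x \<partial>Nm z) - measure (Nm z) A\<bar> < e / 2"
      by (rule le_less_trans[OF integral_measure_diff_le[OF fin(3,4) C1b_measurable[OF f(1)] f(2,3) A] f(4)]) (use z in blast)
    moreover have "Lam z f = (\<integral>x. f x \<partial>Pm z) - (\<integral>x. f x \<partial>Nm z)"
      using represents[of z] f(1) by (simp add: represents_def)
    ultimately show ?thesis unfolding mu_def by linarith
  qed
  then show ?thesis using f by blast
qed

lemma mu_add:
  assumes A: "A \<in> sets borel"
  shows "mu (z + w) A = mu z A + mu w A"
proof -
  have "\<bar>mu (z + w) A - (mu z A + mu w A)\<bar> \<le> 0 + e" if e: "0 < e" for e
  proof -
    obtain f where f: "C1b f" "\<forall>y\<in>{z + w, z, w}. \<bar>Lam y f - mu y A\<bar> < e / 3"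
      using mu_approx[of "{z + w, z, w}" A "e / 3"] A e by auto
    then show ?thesis using Lam_add[OF f(1), of z w] by (simp add: abs_if split: if_splits)
  qed
  then have "\<bar>mu (z + w) A - (mu z A + mu w A)\<bar> \<le> 0" by (rule field_le_epsilon)
  then show ?thesis by simp
qed

lemma mu_scaleR:
  assumes A: "A \<in> sets borel"
  shows "mu (a *\<^sub>R z) A = a * mu z A"
proof -
  have "\<bar>mu (a *\<^sub>R z) A - a * mu z A\<bar> \<le> 0 + e" if e: "0 < e" for e
  proof -
    define d where "d = e / (1 + \<bar>a\<bar>)"
    have "0 < 1 + \<bar>a\<bar>" by simp
    then have d: "0 < d" "d * (1 + \<bar>a\<bar>) = e" using e by (simp_all add: d_def)
    obtain f where f: "C1b f" "\<forall>y\<in>{a *\<^sub>R z, z}. \<bar>Lam y f - mu y A\<bar> < d"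
      using mu_approx[of "{a *\<^sub>R z, z}" A d] A d(1) by auto
    have "\<bar>a * Lam z f - a * mu z A\<bar> \<le> \<bar>a\<bar> * d"
      unfolding right_diff_distrib[symmetric] abs_mult using f(2) by (intro mult_left_mono) auto
    moreover have "\<bar>a * Lam z f - mu (a *\<^sub>R z) A\<bar> < d"
      using f(2) Lam_scaleR[OF f(1), of a z] by simp
    moreover have "d + \<bar>a\<bar> * d = e" using d(2) by (simp add: algebra_simps)
    ultimately show ?thesis by linarith
  qed
  then have "\<bar>mu (a *\<^sub>R z) A - a * mu z A\<bar> \<le> 0" by (rule field_le_epsilon)
  then show ?thesis by simp
qed

lemma mu_bound:
  assumes A: "A \<in> sets borel"
  shows "\<bar>mu z A\<bar> \<le> norm z * (2 * T)"
proof -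
  have b: "\<bar>mu z A\<bar> \<le> T * (norm z + 1)" for z
  proof (rule field_le_epsilon)
    fix e :: real assume "0 < e"
    then obtain f where f: "C1b f" "\<And>x. 0 \<le> f x" "\<And>x. f x \<le> 1" "\<bar>Lam z f - mu z A\<bar> < e"
      using mu_approx[of "{z}" A e] A by auto
    then show "\<bar>mu z A\<bar> \<le> T * (norm z + 1) + e"
      using Lam_bound[OF f(1-3), of z] by linarith
  qed
  have "mu z A = norm z * mu (sgn z) A"
  proof -
    have "norm z *\<^sub>R sgn z = z" by (cases "z = 0") (simp_all add: sgn_div_norm)
    then show ?thesis using mu_scaleR[OF A, of "norm z" "sgn z"] by simp
  qed
  \<comment> \<open>The affine bound at a vector of norm at most 1 gives \<open>2 * T\<close>;
    homogeneity then produces a bound proportional to \<open>norm z\<close>, as Riesz representation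
    requires.\<close>
  moreover have "\<bar>mu (sgn z) A\<bar> \<le> 2 * T"
    using b[of "sgn z"] T_nonneg by (auto simp: norm_sgn split: if_splits)
  ultimately show ?thesis by (simp add: abs_mult mult_left_mono)
qed

definition m :: "'a set \<Rightarrow> 'a" where
  "m A = (SOME y. \<forall>z. mu z A = y \<bullet> z)"

lemma m_inner:
  assumes A: "A \<in> sets borel"
  shows "m A \<bullet> z = mu z A"
proof -
  have "bounded_linear (\<lambda>z. mu z A)"
    by (rule bounded_linear_intro[of _ "2 * T"]) (use mu_add mu_scaleR mu_bound A in auto)
  then obtain y where "\<And>z. mu z A = y \<bullet> z"
    using riesz_representation by blast
  then have "\<forall>z. mu z A = m A \<bullet> z"
    unfolding m_def by (intro someI[of "\<lambda>y. \<forall>z. mu z A = y \<bullet> z"]) blast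
  then show ?thesis by simp
qed

text \<open>Components alone would give only weak convergence. The variation bounds the sums of
  norms, so the series converges absolutely in the complete space, and its sum is identified through
  the components.\<close>

lemma m_sums:
  fixes B :: "nat \<Rightarrow> 'a set"
  assumes B: "range B \<subseteq> sets borel" "disjoint_family B"
  shows "(\<lambda>n. m (B n)) sums m (\<Union>(range B))"
proof -
  have Bm: "B i \<in> sets borel" for i using B(1) by blast
  have "disjoint_family_on B {..<n}" for n
    using B(2) by (auto simp: disjoint_family_on_def)
  then have "ereal (\<Sum>i<n. norm (m (B i))) \<le> V" for n
    by (intro norm_sum_le_V[OF represents]) (auto simp: m_inner mu_def Bm)
  then have "summable (\<lambda>n. norm (m (B n)))"
    by (intro summableI_nonneg_bounded[of _ T]) (auto simp: V_eq)
  then have cauchy: "Cauchy (\<lambda>n. \<Sum>i<n. norm (m (B i)))"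
    by (simp add: summable_iff_convergent convergent_Cauchy)
  have "Cauchy (\<lambda>n. \<Sum>i<n. m (B i))"
  proof (rule metric_CauchyI)
    fix e :: real assume "0 < e"
    then obtain M where M: "\<And>k l. k \<ge> M \<Longrightarrow> l \<ge> M \<Longrightarrow> dist (\<Sum>i<k. norm (m (B i))) (\<Sum>i<l. norm (m (B i))) < e"
      using metric_CauchyD[OF cauchy] by blast
    have le: "dist (\<Sum>i<k. m (B i)) (\<Sum>i<l. m (B i)) < e" if "M \<le> k" "k \<le> l" for k l
    proof -
      have split: "(\<Sum>i<l. g i) - (\<Sum>i<k. g i) = (\<Sum>i\<in>{k..<l}. g i)" for g :: "nat \<Rightarrow> 'b::ab_group_add"
        using sum.atLeastLessThan_concat[of 0 k l g] that(2) by (simp add: atLeast0LessThan algebra_simps)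
      have "dist (\<Sum>i<k. m (B i)) (\<Sum>i<l. m (B i)) = norm (\<Sum>i\<in>{k..<l}. m (B i))"
        by (simp add: dist_norm norm_minus_commute flip: split)
      also have "\<dots> \<le> (\<Sum>i\<in>{k..<l}. norm (m (B i)))" by (rule norm_sum)
      also have "\<dots> \<le> dist (\<Sum>i<k. norm (m (B i))) (\<Sum>i<l. norm (m (B i)))"
        by (simp add: dist_real_def flip: split)
      also have "\<dots> < e" using M that by simp
      finally show ?thesis .
    qed
    have "dist (\<Sum>i<k. m (B i)) (\<Sum>i<l. m (B i)) < e" if "M \<le> k" "M \<le> l" for k l
      using le[of k l] le[of l k] that by (cases "k \<le> l") (auto simp: dist_commute)
    then show "\<exists>M. \<forall>k\<ge>M. \<forall>l\<ge>M. dist (\<Sum>i<k. m (B i)) (\<Sum>i<l. m (B i)) < e" by blast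
  qed
  then obtain l where l: "(\<lambda>n. m (B n)) sums l"
    using Cauchy_convergent unfolding sums_def convergent_def by blast
  have U: "\<Union>(range B) \<in> sets borel" using Bm by auto
  have "l \<bullet> z = m (\<Union>(range B)) \<bullet> z" for z
  proof -
    have "(\<lambda>n. m (B n) \<bullet> z) sums (l \<bullet> z)"
      by (rule bounded_linear.sums[OF bounded_linear_inner_left l])
    moreover have "(\<lambda>n. mu z (B n)) sums mu z (\<Union>(range B))"
      unfolding mu_def using represents[of z] B
      by (intro sums_diff finite_measure.finite_measure_UNION) (auto simp: represents_def)
    ultimately show ?thesis using sums_unique2 by (simp add: m_inner Bm U)
  qed
  then have "(l - m (\<Union>(range B))) \<bullet> (l - m (\<Union>(range B))) = 0"
    by (simp add: inner_diff_left)
  then show ?thesis using l by simp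
qed

lemma vec_measure_m: "vec_measure m"
proof -
  have "total_var m \<le> V"
    by (rule total_var_le_V[OF represents]) (simp add: m_inner mu_def)
  then have "total_var m < \<infinity>" unfolding V_eq by (cases "total_var m") auto
  then show ?thesis unfolding vec_measure_def using m_sums by blast
qed

text \<open>\<open>signed_integral\<close> uses the Jordan pair of the component of
  \<open>m\<close>, while \<open>Lam\<close> is expressed by \<open>Pm z\<close> and
  \<open>Nm z\<close>; both pairs have the same difference on Borel sets.\<close>

lemma BV_repr_m: "BV_repr nu R v u m"
  unfolding BV_repr_def
proof (intro allI impI)
  fix z f assume f: "C1b (f :: 'a \<Rightarrow> real)"
  obtain c where "bounded_signed_measure (\<lambda>B. m B \<bullet> z) c"
    using vec_measure_component[OF vec_measure_m] by blast
  then interpret bounded_signed_measure "\<lambda>B. m B \<bullet> z" c .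
  obtain P N where PN: "finite_measure P" "sets P = sets borel" "finite_measure N" "sets N = sets borel"
    and diff: "\<And>A. A \<in> sets borel \<Longrightarrow> measure P A - measure N A = m A \<bullet> z"
    and si: "\<And>f. signed_integral (\<lambda>B. m B \<bullet> z) f = (\<integral>x. f x \<partial>P) - (\<integral>x. f x \<partial>N)"
    using jordan by metis
  obtain K where K: "0 < K" "\<And>x. \<bar>f x\<bar> \<le> K" "\<And>x. norm (grad f x) \<le> K"
    using C1b_bound[OF f] by blast
  have fin: "finite_measure (Pm z)" "sets (Pm z) = sets borel" "finite_measure (Nm z)" "sets (Nm z) = sets borel"
    and Lam: "Lam z f = (\<integral>x. f x \<partial>Pm z) - (\<integral>x. f x \<partial>Nm z)"
    using represents[of z] f by (auto simp: represents_def)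
  have "(\<integral>x. f x \<partial>P) - (\<integral>x. f x \<partial>N) = (\<integral>x. f x \<partial>Pm z) - (\<integral>x. f x \<partial>Nm z)"
    by (rule integral_diff_eq_of_measure_diff_eq[OF PN fin _ C1b_measurable[OF f] K(2)])
      (simp add: diff m_inner mu_def)
  then have "signed_integral (\<lambda>B. m B \<bullet> z) f = Lam z f" by (simp add: si Lam)
  moreover have "(\<integral>x. u x * (blinfun_apply R (grad f x) \<bullet> z - v z x * f x) \<partial>nu)
      = (\<integral>x. - (u x * (- (blinfun_apply R (grad f x) \<bullet> z) + v z x * f x)) \<partial>nu)"
    by (rule Bochner_Integration.integral_cong) (simp_all add: algebra_simps)
  ultimately show "(\<integral>x. u x * (blinfun_apply R (grad f x) \<bullet> z - v z x * f x) \<partial>nu) = - signed_integral (\<lambda>B. m B \<bullet> z) f"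
    unfolding Lam_def by (simp only: integral_minus)
qed

end

theorem theorem3p5:
  fixes nu :: "'a::{real_inner, complete_space, second_countable_topology} measure"
    and R :: "'a \<Rightarrow>\<^sub>L 'a"
    and v :: "'a \<Rightarrow> 'a \<Rightarrow> real"
    and u :: "'a \<Rightarrow> real"
    and p :: real
  assumes nu_prob: "prob_space nu"
    and nu_borel: "sets nu = sets borel"
    and v_Lp: "\<And>z q. q > 1 \<Longrightarrow> Lp nu q (v z)"
    and v_ibp: "\<And>z \<phi>. C1b \<phi> \<Longrightarrow>
        (\<integral>x. blinfun_apply R (grad \<phi> x) \<bullet> z \<partial>nu) = (\<integral>x. v z x * \<phi> x \<partial>nu)"
    and p_gt: "p > 1"
    and u_Lp: "Lp nu p u"
  shows "(BV nu R v u \<longleftrightarrow> Vvar nu R v u < \<infinity>)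
     \<and> (\<forall>m. vec_measure m \<and> BV_repr nu R v u m \<longrightarrow> total_var m = Vvar nu R v u)"
proof -
  interpret prob_space nu by (rule nu_prob)
  \<comment> \<open>The conjugate exponent: each \<open>v z\<close> lies in every such space, so its
    product with \<open>u\<close> is integrable.\<close>
  define q where "q = p / (p - 1)"
  have q: "1 < q" "1 / p + 1 / q = 1"
    using p_gt by (simp_all add: q_def field_simps)
  \<comment> \<open>The constant 1 lies in this space because \<open>nu\<close> is finite, and
    pairing with it gives integrability of \<open>u\<close> itself.\<close>
  have "Lp nu q (\<lambda>x. 1)" by (simp add: Lp_def)
  from integrable_mult_Lp[OF p_gt q u_Lp this] have u_int: "integrable nu u" by simp
  interpret bv_setting nu R v u
    by unfold_locales (use nu_borel u_int integrable_mult_Lp[OF p_gt q u_Lp v_Lp[OF q(1)]] in auto)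
  have tv: "total_var m = V" if "vec_measure m" "BV_repr nu R v u m" for m
    using total_var_eq_V[OF that] .
  moreover have "V < \<infinity>" if "BV nu R v u"
  proof -
    obtain m where "vec_measure m" "BV_repr nu R v u m" using \<open>BV nu R v u\<close> unfolding BV_def by blast
    then show ?thesis using tv[of m] unfolding vec_measure_def by simp
  qed
  moreover have "BV nu R v u" if fin: "V < \<infinity>"
  proof -
    \<comment> \<open>\<open>V\<close> is not minus infinity because the empty field contributes
      0.\<close>
    have "V = ereal (real_of_ereal V)"
      using fin V_nonneg by (cases V) auto
    then interpret finite_variation nu R v u "real_of_ereal V"
      by unfold_locales
    show ?thesis unfolding BV_def using vec_measure_m BV_repr_m by blast
  qed
  ultimately show ?thesis by blast
qed

end
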